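(* For each $j=0,\dots,4$, let $W_j$ be the subgroup of $P\Gamma^{\mathbb{R}}_j$ generated by reflections. Then $W_j$ is the Coxeter group generated by the reflections in the roots $R_j$ listed below, the polyhedron $C_j=\{[v]\in H^4_j: v\cdot r\le 0\text{ for all }r\in R_j\}$ is a Weyl chamber (fundamental domain) for $W_j$, and $P\Gamma^{\mathbb{R}}_j$ is the semidirect product of $W_j$ by the group of diagram automorphisms (the isometries preserving $C_j$), which is $\mathbb{Z}/2$ if $j=1$ or $2$ and trivial otherwise. The lists (coordinates in $\mathcal{E}^5$) are: $R_0$: $(0,1,-1,0,0)$, $(0,0,1,-1,0)$, $(0,0,0,1,-1)$, $(0,0,0,0,1)$, $(1,-1,-1,-1,0)$. $R_1$: $(0,1,-1,0,0)$, $(0,0,1,-1,0)$, $(0,0,0,1,0)$, $(0,0,0,0,\theta)$, $(1,0,0,0,-\theta)$, $(1,-1,-1,-1,0)$, $(3,-3,0,0,-\theta)$. $R_2$: $(0,1,-1,0,0)$, $(0,0,1,0,0)$, $(0,0,0,-\theta,\theta)$, $(0,0,0,\theta,0)$, $(1,0,0,0,-\theta)$, $(1,-1,-1,0,0)$, $(3,-3,0,-\theta,-\theta)$. $R_3$: $(0,1,0,0,0)$, $(0,0,0,-\theta,\theta)$, $(0,0,-\theta,\theta,0)$, $(0,0,\theta,0,0)$, $(1,0,0,0,-\theta)$, $(3,-3,0,-\theta,-\theta)$, $(3,-1,-\theta,-\theta,-\theta)$. $R_4$: $(0,0,0,-\theta,\theta)$, $(0,0,-\theta,\theta,0)$, $(0,-\theta,\theta,0,0)$,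 $(0,\theta,0,0,0)$, $(1,0,0,0,-\theta)$, $(3,-\theta,-\theta,-\theta,-\theta)$.
   Context: Let $\omega=e^{2\pi i/3}$, $\mathcal{E}=\mathbb{Z}[\omega]$, $\theta=\sqrt{-3}$. Let $\Lambda=\mathcal{E}^5$ with Hermitian form $x\cdot y=h(x,y)=-x_0\bar y_0+x_1\bar y_1+\dots+x_4\bar y_4$, $\Gamma$ its group of $\mathcal{E}$-linear isometries, $P\Gamma=\Gamma/\{\text{unit scalars}\}$, and $\mathbb{C}H^4$ the set of negative lines in $\Lambda\otimes_{\mathcal{E}}\mathbb{C}$. For $j=0,\dots,4$, $\xi_j$ is the antilinear map conjugating all coordinates and negating the last $j$ of them; $H^4_j$ is its fixed set in $\mathbb{C}H^4$ (a real hyperbolic $4$-space, the projectivized negative vectors of $\Lambda_j\otimes\mathbb{R}$ where $\Lambda_j=\mathbb{Z}^{5-j}\oplus\theta\mathbb{Z}^j$), and $P\Gamma^{\mathbb{R}}_j$ is the stabilizer of $H^4_j$ in $P\Gamma$. The reflection in a vector $r$ of positive norm is $x\mapsto x-2\frac{x\cdot r}{r\cdot r}r$. *)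

theory Defs
  imports "HOL-Analysis.Analysis"
begin

type_synonym cvec = "complex ^ 5"
type_synonym cmat = "complex ^ 5 ^ 5"

section \<open>Eisenstein integers, the lattice and the Hermitian form\<close>

definition omega :: complex where "omega = exp (2 * pi * \<i> / 3)"

(* theta = sqrt(-3), principal branch *)
definition theta :: complex where "theta = \<i> * complex_of_real (sqrt 3)"

definition Eis :: "complex set" where
  "Eis = {of_int a + of_int b * omega | a b. True}"

definition EisUnits :: "complex set" where
  "EisUnits = {u \<in> Eis. \<exists>v\<in>Eis. u * v = 1}"

definition Lam :: "cvec set" where
  "Lam = {x. \<forall>i. x $ i \<in> Eis}"

definition hform :: "cvec \<Rightarrow> cvec \<Rightarrow> complex" where
  "hform x y = (\<Sum>i\<in>UNIV. (if i = 0 then -1 else 1) * x $ i * cnj (y $ i))"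

definition vec5 :: "complex \<Rightarrow> complex \<Rightarrow> complex \<Rightarrow> complex \<Rightarrow> complex \<Rightarrow> cvec" where
  "vec5 a b c d e = (\<chi> i. if i = 0 then a else if i = 1 then b else if i = 2 then c
                          else if i = 3 then d else e)"

section \<open>The group Gamma (as matrices) and scalars\<close>

definition Gam :: "cmat set" where
  "Gam = {g. (\<forall>i k. g $ i $ k \<in> Eis)
           \<and> (\<forall>x\<in>Lam. \<forall>y\<in>Lam. hform (g *v x) (g *v y) = hform x y)
           \<and> (\<lambda>x. g *v x) ` Lam = Lam}"

(* g is a unit scalar, i.e. trivial in P Gamma *)
definition pscalar :: "cmat \<Rightarrow> bool" where
  "pscalar g \<longleftrightarrow> (\<exists>u\<in>EisUnits. g = mat u)"

(* equality in P Gamma *)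
definition pequiv :: "cmat \<Rightarrow> cmat \<Rightarrow> bool" where
  "pequiv g h \<longleftrightarrow> (\<exists>u\<in>EisUnits. g = mat u ** h)"

definition mprod :: "cmat list \<Rightarrow> cmat" where
  "mprod ws = foldr (**) ws (mat 1)"

section \<open>Complex hyperbolic space and its real forms\<close>

definition cline :: "cvec \<Rightarrow> cvec set" where
  "cline v = range (\<lambda>c. c *s v)"

definition CH4 :: "cvec set set" where
  "CH4 = {cline v | v. Re (hform v v) < 0}"

(* coordinate i is among the last j coordinates x_{5-j},...,x_4 *)
definition neg_coord :: "nat \<Rightarrow> 5 \<Rightarrow> bool" where
  "neg_coord j i \<longleftrightarrow> (i = 4 \<and> j \<ge> 1) \<or> (i = 3 \<and> j \<ge> 2) \<or> (i = 2 \<and> j \<ge> 3)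
                      \<or> (i = 1 \<and> j \<ge> 4) \<or> (i = 0 \<and> j \<ge> 5)"

definition xi :: "nat \<Rightarrow> cvec \<Rightarrow> cvec" where
  "xi j x = (\<chi> i. if neg_coord j i then - cnj (x $ i) else cnj (x $ i))"

definition H4 :: "nat \<Rightarrow> cvec set set" where
  "H4 j = {L \<in> CH4. xi j ` L = L}"

(* Lambda_j tensor R, as the fixed vectors of xi_j in C^5 *)
definition Vreal :: "nat \<Rightarrow> cvec set" where
  "Vreal j = {v. xi j v = v}"

definition act :: "cmat \<Rightarrow> cvec set \<Rightarrow> cvec set" where
  "act g L = (\<lambda>v. g *v v) ` L"

(* preimage in Gamma of P Gamma^R_j *)
definition Stab :: "nat \<Rightarrow> cmat set" where
  "Stab j = {g \<in> Gam. act g ` H4 j = H4 j}"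

section \<open>Reflections and generated subgroups\<close>

definition reflm :: "cvec \<Rightarrow> cmat" where
  "reflm r = (\<chi> a b. (if a = b then 1 else 0)
      - 2 * r $ a * (if b = 0 then -1 else 1) * cnj (r $ b) / hform r r)"

(* elements of P Gamma^R_j which are reflections (in P Gamma) *)
definition ReflS :: "nat \<Rightarrow> cmat set" where
  "ReflS j = {g \<in> Stab j. \<exists>r. Re (hform r r) > 0 \<and> pequiv g (reflm r)}"

(* preimage in Gamma of the subgroup of P Gamma generated by S *)
definition Wgen :: "cmat set \<Rightarrow> cmat set" where
  "Wgen S = {mat u ** mprod ws | u ws. u \<in> EisUnits \<and> set ws \<subseteq> S \<union> matrix_inv ` S}"

definition W :: "nat \<Rightarrow> cmat set" where
  "W j = Wgen (ReflS j)"

section \<open>Coxeter presentations\<close>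

inductive cox_eq :: "nat list set \<Rightarrow> nat list \<Rightarrow> nat list \<Rightarrow> bool" for rels where
  cox_refl: "cox_eq rels w w"
| cox_del: "r \<in> rels \<Longrightarrow> cox_eq rels (a @ r @ b) (a @ b)"
| cox_sym: "cox_eq rels u w \<Longrightarrow> cox_eq rels w u"
| cox_trans: "cox_eq rels u v \<Longrightarrow> cox_eq rels v w \<Longrightarrow> cox_eq rels u w"

(* order in P Gamma of the product s_i s_k, when finite *)
definition pord :: "cmat \<Rightarrow> nat" where
  "pord g = (LEAST m. m > 0 \<and> pscalar (mprod (replicate m g)))"

definition cox_rels :: "nat \<Rightarrow> (nat \<Rightarrow> cmat) \<Rightarrow> nat list set" where
  "cox_rels n s =
     {concat (replicate (pord (s i ** s k)) [i, k]) | i k.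
        i < n \<and> k < n \<and> (\<exists>m>0. pscalar (mprod (replicate m (s i ** s k))))}"

(* the group (mod unit scalars) generated by s 0, ..., s (n-1) is the Coxeter group
   with these generators: distinct involutions, and every relation is a consequence of the
   Coxeter relations (s_i s_k)^{m_ik} = 1, m_ik = order of s_i s_k *)
definition coxeter_system :: "nat \<Rightarrow> (nat \<Rightarrow> cmat) \<Rightarrow> bool" where
  "coxeter_system n s \<longleftrightarrow>
     (\<forall>i<n. \<not> pscalar (s i) \<and> pscalar (s i ** s i))
   \<and> (\<forall>i<n. \<forall>k<n. i \<noteq> k \<longrightarrow> \<not> pscalar (s i ** s k))
   \<and> (\<forall>w. set w \<subseteq> {..<n} \<longrightarrow> pscalar (mprod (map s w)) \<longrightarrow> cox_eq (cox_rels n s) w [])"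

section \<open>Roots, chambers, fundamental domains\<close>

definition roots :: "nat \<Rightarrow> cvec list" where
  "roots j = (if j = 0 then
     [vec5 0 1 (-1) 0 0, vec5 0 0 1 (-1) 0, vec5 0 0 0 1 (-1), vec5 0 0 0 0 1, vec5 1 (-1) (-1) (-1) 0]
   else if j = 1 then
     [vec5 0 1 (-1) 0 0, vec5 0 0 1 (-1) 0, vec5 0 0 0 1 0, vec5 0 0 0 0 theta,
      vec5 1 0 0 0 (-theta), vec5 1 (-1) (-1) (-1) 0, vec5 3 (-3) 0 0 (-theta)]
   else if j = 2 then
     [vec5 0 1 (-1) 0 0, vec5 0 0 1 0 0, vec5 0 0 0 (-theta) theta, vec5 0 0 0 theta 0,
      vec5 1 0 0 0 (-theta), vec5 1 (-1) (-1) 0 0, vec5 3 (-3) 0 (-theta) (-theta)]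
   else if j = 3 then
     [vec5 0 1 0 0 0, vec5 0 0 0 (-theta) theta, vec5 0 0 (-theta) theta 0, vec5 0 0 theta 0 0,
      vec5 1 0 0 0 (-theta), vec5 3 (-3) 0 (-theta) (-theta), vec5 3 (-1) (-theta) (-theta) (-theta)]
   else
     [vec5 0 0 0 (-theta) theta, vec5 0 0 (-theta) theta 0, vec5 0 (-theta) theta 0 0,
      vec5 0 theta 0 0 0, vec5 1 0 0 0 (-theta), vec5 3 (-theta) (-theta) (-theta) (-theta)])"

(* C_j = { [v] in H^4_j : v . r <= 0 for all r in R_j }, v a representative in Lambda_j (x) R *)
definition Cj :: "nat \<Rightarrow> cvec set set" where
  "Cj j = {L \<in> H4 j. \<exists>v\<in>L. v \<in> Vreal j \<and> Re (hform v v) < 0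
                        \<and> (\<forall>r\<in>set (roots j). Re (hform v r) \<le> 0)}"

(* topological interior of S \<subseteq> H^4_j (quotient topology from the negative cone in Lambda_j (x) R) *)
definition hint :: "nat \<Rightarrow> cvec set set \<Rightarrow> cvec set set" where
  "hint j S = {L \<in> S. \<exists>v\<in>L. v \<in> Vreal j \<and> Re (hform v v) < 0 \<and>
                 (\<exists>e>0. \<forall>u\<in>Vreal j. norm (u - v) < e \<longrightarrow> cline u \<in> S)}"

definition fundamental_domain :: "nat \<Rightarrow> cmat set \<Rightarrow> cvec set set \<Rightarrow> bool" where
  "fundamental_domain j G C \<longleftrightarrow>
     C \<subseteq> H4 j
   \<and> (\<Union>g\<in>G. act g ` C) = H4 j
   \<and> (\<forall>g\<in>G. act g ` hint j C \<inter> hint j C \<noteq> {} \<longrightarrow> pscalar g)"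

(* diagram automorphisms: elements of P Gamma^R_j preserving C_j *)
definition Dj :: "nat \<Rightarrow> cmat set" where
  "Dj j = {g \<in> Stab j. act g ` Cj j = Cj j}"

end

(*
  Let W' be generated by the reflections in R_j. The Gram matrix of R_j is crystallographic, so
  Tits' argument (if l(w s_i) > l(w) then w maps the root r_i to a root that is nonpositive on C_j)
  shows that W' is the Coxeter group on R_j and that w C_j meets the interior of C_j only for w = 1.
  Every point of H^4_j can be moved into C_j by minimizing its product with the W'-orbit of an
  interior lattice point, since only finitely many lattice vectors of given norm are near a point.

  An element of the stabilizer is, up to a unit, an automorphism of the integral form of Lambda_j:
  it commutes with xi_j up to a unit, and the sign -1 that remains after rescaling is excluded by a
  determinant modulo theta. The vector e_0 is moved into C_j by W', where the only vectors of norm -1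
  equivalent to it are e_0 and, for j = 1, 2, its image under the diagram automorphism d. The stabilizer
  of e_0 consists of signed permutations and is generated by the first four roots.
  So P Gamma^R_j is generated by W' and d. Finally a reflection with a mirror not belonging to W'
  would fix an interior point of some chamber, hence be conjugate to d, which is not a reflection.
*)
theory Submission
  imports Defs
begin

section \<open>Words modulo Coxeter relations\<close>

text \<open>Up to seven simple roots live in dimension five, so they can be linearly dependent, and
  a root cannot be called positive by the signs of its coefficients. Positivity is tested against
  the chamber instead: \<open>positive\<close> means nonpositive product with each of its vectors.
  Besides obtuseness, the argument uses of a pair of roots only its cartan product, which is 0, 1,
  2, 3 or at least 4. The first four values give dihedral orbits short enough to be listed; beyond
  them the coefficients never decrease.

  \<open>W j\<close> is generated by all reflections of the stabilizer, with complex mirror vectors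
  and up to units, so its generators cannot be read off from the root list. The whole stabilizer has
  to be known before a single reflection can be located, and the enumeration of chamber vectors of
  norm -1 is what makes the stabilizer accessible. For \<open>j = 2\<close> this enumeration meets
  an obstacle: \<open>(3, -1, -1, -1, -1)\<close> lies in the chamber as well, and a parity argument
  has to separate it from \<open>(1, 0, 0, 0, 0)\<close>.\<close>

lemma cox_eq_context: "cox_eq R u w \<Longrightarrow> cox_eq R (a @ u @ b) (a @ w @ b)"
proof (induction rule: cox_eq.induct)
  case (cox_del r c d)
  then have "cox_eq R ((a @ c) @ r @ (d @ b)) ((a @ c) @ (d @ b))" by (rule cox_eq.cox_del)
  then show ?case by simp
qed (auto intro: cox_eq.intros)

lemma cox_eq_append:
  assumes "cox_eq R u u'" "cox_eq R w w'"
  shows "cox_eq R (u @ w) (u' @ w')"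
  using cox_eq_context[OF assms(1), of "[]" w] cox_eq_context[OF assms(2), of u' "[]"]
  by (auto intro: cox_eq.cox_trans)

text \<open>Letters are added in front, so the last letter of a nonempty word is always
  \<open>k\<close>, and the shorter alternating words are suffixes of the longer ones.\<close>

fun alt :: "nat \<Rightarrow> 'a \<Rightarrow> 'a \<Rightarrow> 'a list" where
  "alt 0 k i = []"
| "alt (Suc p) k i = (if even p then k else i) # alt p k i"

lemma length_alt [simp]: "length (alt p k i) = p"
  by (induction p) auto

lemma set_alt: "set (alt p k i) \<subseteq> {i, k}"
  by (induction p) auto

lemma alt_snoc: "alt (Suc p) k i = alt p i k @ [k]"
  by (induction p) auto

lemma alt_add: "\<exists>u. alt (q + p) k i = u @ alt p k i \<and> length u = q"
proof (induction q)
  case (Suc q)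
  then obtain u where "alt (q + p) k i = u @ alt p k i" "length u = q" by blast
  then show ?case by (intro exI[of _ "(if even (q + p) then k else i) # u"]) auto
qed auto

lemma concat_replicate_pair: "concat (replicate m [i, k]) = alt (2 * m) k i"
  by (induction m) auto

text \<open>Equal parity makes the letters on the two sides of the seam different. With
  \<open>p = q = m\<close> it splits a relator of length \<open>2 * m\<close> into two
  halves.\<close>

lemma rev_alt_append: "even (p + q) \<Longrightarrow> rev (alt p i k) @ alt q k i = alt (p + q) k i"
proof (induction p arbitrary: q)
  case (Suc p)
  have "rev (alt (Suc p) i k) @ alt q k i = rev (alt p i k) @ alt (Suc q) k i"
    using Suc.prems by auto
  also have "\<dots> = alt (p + Suc q) k i" using Suc.prems by (intro Suc.IH) auto
  finally show ?case by simp
qed auto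

locale cox_words =
  fixes n :: nat and R :: "nat list set"
  assumes rel_letters: "r \<in> R \<Longrightarrow> set r \<subseteq> {..<n}"
    and rel_even: "r \<in> R \<Longrightarrow> even (length r)"
    and rel_invol: "i < n \<Longrightarrow> [i, i] \<in> R"
begin

lemma cox_eq_parity: "cox_eq R u w \<Longrightarrow> even (length u) = even (length w)"
  by (induction rule: cox_eq.induct) (use rel_even in auto)

lemma cox_eq_letters: "cox_eq R u w \<Longrightarrow> set u \<subseteq> {..<n} \<longleftrightarrow> set w
  \<subseteq> {..<n}"
  by (induction rule: cox_eq.induct) (use rel_letters in auto)

lemma append_rev_trivial: "set w \<subseteq> {..<n} \<Longrightarrow> cox_eq R (w @ rev w) []"
proof (induction w)
  case (Cons i w)
  have "cox_eq R ([i] @ (w @ rev w) @ [i]) ([i] @ [] @ [i])"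
    by (rule cox_eq_context) (use Cons in auto)
  moreover have "cox_eq R ([] @ [i, i] @ []) ([] @ [])"
    by (rule cox_eq.cox_del) (use Cons rel_invol in auto)
  ultimately show ?case by (auto intro: cox_eq.cox_trans)
qed (auto intro: cox_eq.intros)

section \<open>Word length modulo the relations\<close>

definition len :: "nat list \<Rightarrow> nat" where
  "len w = (LEAST k. \<exists>w'. cox_eq R w w' \<and> length w' = k)"

lemma len_le: "cox_eq R w w' \<Longrightarrow> len w \<le> length w'"
  unfolding len_def by (rule Least_le) blast

lemma reduced_word: "\<exists>w'. cox_eq R w w' \<and> length w' = len w"
  unfolding len_def by (rule LeastI_ex) (auto intro: cox_eq.cox_refl)

lemma len_cong: "cox_eq R u w \<Longrightarrow> len u = len w"
  by (metis cox_eq.cox_sym cox_eq.cox_trans len_le reduced_word le_antisym)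

lemma even_len: "even (len w) = even (length w)"
  using reduced_word[of w] cox_eq_parity by metis

lemma len_append_le: "len (u @ w) \<le> len u + length w"
  by (metis reduced_word len_le cox_eq_append cox_eq.cox_refl length_append)

text \<open>Appending the letter twice changes nothing, so the two lengths differ by at most one;
  the sign character given by the even relators excludes equality.\<close>

lemma len_snoc:
  assumes "i < n"
  shows "len (w @ [i]) = Suc (len w) \<or> len w = Suc (len (w @ [i]))"
proof -
  have "len (w @ [i]) \<le> Suc (len w)" using len_append_le[of w "[i]"] by simp
  moreover have "cox_eq R (w @ [i, i]) w"
    using cox_eq.cox_del[OF rel_invol[OF assms], of w "[]"] by simp
  then have "len w \<le> Suc (len (w @ [i]))"
    using len_append_le[of "w @ [i]" "[i]"] len_cong by fastforce
  moreover have "len w \<noteq> len (w @ [i])" using even_len[of w] even_len[of "w @ [i]"] by auto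
  ultimately show ?thesis by linarith
qed

text \<open>The relator is the reverse of \<open>alt m i k\<close> followed by
  \<open>alt m k i\<close>; multiplication on the left by \<open>alt m i k\<close> cancels its
  reverse.\<close>

lemma braid:
  assumes "concat (replicate m [i, k]) \<in> R" "i < n" "k < n"
  shows "cox_eq R (alt m k i) (alt m i k)"
proof -
  have l: "set (alt m i k) \<subseteq> {..<n}" using set_alt[of m i k] assms by auto
  have "cox_eq R ([] @ concat (replicate m [i, k]) @ []) ([] @ [])"
    by (rule cox_eq.cox_del) fact
  then have 1: "cox_eq R (rev (alt m i k) @ alt m k i) []"
    by (simp add: concat_replicate_pair rev_alt_append mult_2)
  have "cox_eq R ((alt m i k @ rev (alt m i k)) @ alt m k i) ([] @ alt m k i)"
    by (intro cox_eq_append append_rev_trivial l cox_eq.cox_refl)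
  moreover have "cox_eq R (alt m i k @ (rev (alt m i k) @ alt m k i)) (alt m i k @ [])"
    by (intro cox_eq_append 1 cox_eq.cox_refl)
  ultimately show ?thesis by (auto intro: cox_eq.intros)
qed

end

section \<open>Reflection representations and Tits' theorem\<close>

definition reflect :: "('v::real_vector \<Rightarrow> 'v \<Rightarrow> real) \<Rightarrow> 'v \<Rightarrow>
  'v \<Rightarrow> 'v" where
  "reflect B a x = x - (2 * B x a / B a a) *\<^sub>R a"

definition refl_word :: "('v::real_vector \<Rightarrow> 'v \<Rightarrow> real) \<Rightarrow> (nat
  \<Rightarrow> 'v) \<Rightarrow> nat list \<Rightarrow> 'v \<Rightarrow> 'v" where
  "refl_word B \<alpha> w = foldr (\<lambda>i f. reflect B (\<alpha> i) \<circ> f) w id"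

lemma refl_word_Nil [simp]: "refl_word B \<alpha> [] x = x"
  and refl_word_Cons [simp]: "refl_word B \<alpha> (i # w) x = reflect B (\<alpha> i) (refl_word B \<alpha>
    w x)"
  by (simp_all add: refl_word_def)

lemma refl_word_append [simp]: "refl_word B \<alpha> (u @ w) x = refl_word B \<alpha> u (refl_word B
  \<alpha> w x)"
  by (induction u) auto

locale bilin =
  fixes B :: "'v::real_vector \<Rightarrow> 'v \<Rightarrow> real"
  assumes B_sym: "B x y = B y x"
    and B_add: "B (x + y) z = B x z + B y z"
    and B_scale: "B (c *\<^sub>R x) z = c * B x z"
begin

lemma B_add_right: "B z (x + y) = B z x + B z y"
  using B_add B_sym by metis
lemma B_scale_right: "B z (c *\<^sub>R x) = c * B z x"
  using B_scale B_sym by metis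
lemma B_minus: "B (- x) z = - B x z"
  using B_scale[of "-1" x z] by simp
lemma B_minus_right: "B z (- x) = - B z x"
  using B_minus B_sym by metis
lemma B_diff: "B (x - y) z = B x z - B y z"
  using B_add[of x "- y" z] by (simp add: B_minus)
lemma B_diff_right: "B z (x - y) = B z x - B z y"
  using B_diff B_sym by metis
lemma B_zero: "B 0 z = 0" "B z 0 = 0"
  using B_scale[of 0 0 z] B_scale_right[of z 0 0] by auto

lemmas B_simps = B_add B_add_right B_scale B_scale_right B_minus B_minus_right B_diff B_diff_right B_zero

lemma linear_refl: "linear (reflect B a)"
  by (rule linearI) (auto simp: reflect_def B_simps algebra_simps add_divide_distrib)

lemma linear_refl_word: "linear (refl_word B \<alpha> w)"
  by (rule linearI; induction w) (simp_all add: linear_add[OF linear_refl] linear_scale[OF linear_refl])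

lemma refl_refl: "B a a \<noteq> 0 \<Longrightarrow> reflect B a (reflect B a x) = x"
  by (simp add: reflect_def B_simps)

lemma B_refl: "B a a \<noteq> 0 \<Longrightarrow> B (reflect B a x) (reflect B a y) = B x y"
  by (simp add: reflect_def B_simps B_sym[of a y])

lemma B_refl_word:
  "(\<And>i. i \<in> set w \<Longrightarrow> B (\<alpha> i) (\<alpha> i) \<noteq> 0) \<Longrightarrow> B
    (refl_word B \<alpha> w x) (refl_word B \<alpha> w y) = B x y"
  by (induction w) (auto simp: B_refl)

lemma refl_word_rev:
  "(\<And>i. i \<in> set w \<Longrightarrow> B (\<alpha> i) (\<alpha> i) \<noteq> 0) \<Longrightarrow>
    refl_word B \<alpha> (rev w) (refl_word B \<alpha> w x) = x"
  by (induction w arbitrary: x) (auto simp: refl_refl)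

lemma refl_scale: "c \<noteq> 0 \<Longrightarrow> reflect B (c *\<^sub>R a) = reflect B a"
  by (auto simp: reflect_def B_simps fun_eq_iff field_simps)

lemma refl_conj:
  assumes "linear f" "linear f'" "\<And>x y. B (f x) (f y) = B x y" "\<And>x. f (f' x) = x"
  shows "f (reflect B a (f' x)) = reflect B (f a) x"
proof -
  have "B (f' x) a = B x (f a)" using assms(3)[of "f' x" a] assms(4) by simp
  then show ?thesis
    using assms by (simp add: reflect_def linear_diff linear_scale)
qed

end

text \<open>The orbit of a simple root under a dihedral group, in terms of the negated Cartan integers
  \<open>a\<close>, \<open>b\<close> of the pair; \<open>a * b = 4 cos\<^sup>2 (\<pi> / m)\<close> when the
    product of the two reflections has order \<open>m\<close>.\<close>

fun dihedral_coeffs :: "real \<Rightarrow> real \<Rightarrow> nat \<Rightarrow> real \<times> real" where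
  "dihedral_coeffs a b 0 = (1, 0)"
| "dihedral_coeffs a b (Suc p) =
    (let (x, y) = dihedral_coeffs a b p in if even p then (x, a * x - y) else (b * y - x, y))"

text \<open>Upper bounds instead of equalities: positivity of the coefficients before step
  \<open>m\<close> passes to every smaller \<open>m\<close>, so exact orders never have to be
  computed.\<close>

definition order_bound :: "real \<Rightarrow> nat \<Rightarrow> bool" where
  "order_bound c m \<longleftrightarrow> c = 0 \<and> m \<le> 2 \<or> c = 1 \<and> m \<le> 3 \<or> c = 2
    \<and> m \<le> 4 \<or> c = 3 \<and> m \<le> 6"

text \<open>There are at most six terms. They are explicit polynomials in \<open>a * b\<close>, up
  to a factor \<open>a\<close>, and nonnegative at the value of \<open>a * b\<close> that belongs to
  the bound.\<close>

lemma dihedral_coeffs_finite: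
  assumes "0 \<le> a" "0 \<le> b" "a = 0 \<longleftrightarrow> b = 0" "order_bound (a * b) m" "p < m"
  shows "0 \<le> fst (dihedral_coeffs a b p) \<and> 0 \<le> snd (dihedral_coeffs a b p)"
proof -
  have "p = 0 \<or> p = 1 \<or> p = 2 \<or> p = 3 \<or> p = 4 \<or> p = 5"
    using assms(4,5) by (auto simp: order_bound_def)
  then have p: "p = 0 \<or> p = Suc 0 \<or> p = Suc (Suc 0) \<or>
      p = Suc (Suc (Suc 0)) \<or> p = Suc (Suc (Suc (Suc 0))) \<or> p = Suc (Suc (Suc (Suc (Suc 0))))"
    by (simp add: eval_nat_numeral)
  have u: "dihedral_coeffs a b (Suc 0) = (1, a)"
     "dihedral_coeffs a b (Suc (Suc 0)) = (a * b - 1, a)"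
     "dihedral_coeffs a b (Suc (Suc (Suc 0))) = (a * b - 1, a * (a * b - 2))"
     "dihedral_coeffs a b (Suc (Suc (Suc (Suc 0)))) =
       ((a * b) * (a * b) - 3 * (a * b) + 1, a * (a * b - 2))"
     "dihedral_coeffs a b (Suc (Suc (Suc (Suc (Suc 0))))) =
       ((a * b) * (a * b) - 3 * (a * b) + 1, a * ((a * b) * (a * b) - 4 * (a * b) + 3))"
    by (simp_all add: algebra_simps)
  show ?thesis using assms p u
    unfolding order_bound_def
    by (elim disjE) (auto simp del: dihedral_coeffs.simps(2))
qed

text \<open>The last conjunct is the invariant that carries the induction: the most recent update
  did not lower the coordinate that it changed. Multiplied by \<open>a\<close> or \<open>b\<close>,
  and with \<open>4 \<le> a * b\<close>, it yields the same for the next update.\<close>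

lemma dihedral_coeffs_infinite:
  assumes "0 \<le> a" "0 \<le> b" "4 \<le> a * b"
  shows "0 \<le> fst (dihedral_coeffs a b p) \<and> 0 \<le> snd (dihedral_coeffs a b p) \<and>
    (if even p then b * snd (dihedral_coeffs a b p) \<le> 2 * fst (dihedral_coeffs a b p)
     else a * fst (dihedral_coeffs a b p) \<le> 2 * snd (dihedral_coeffs a b p))"
proof (induction p)
  case (Suc p)
  obtain x y where xy: "dihedral_coeffs a b p = (x, y)" by fastforce
  have 1: "b * (2 * y) \<ge> b * (a * x)" if "a * x \<le> 2 * y"
    using that assms by (intro mult_left_mono) auto
  have 2: "a * (2 * x) \<ge> a * (b * y)" if "b * y \<le> 2 * x"
    using that assms by (intro mult_left_mono) auto
  have 3: "a * b * x \<ge> 4 * x" if "0 \<le> x" using that assms by (intro mult_right_mono) auto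
  have 4: "a * b * y \<ge> 4 * y" if "0 \<le> y" using that assms by (intro mult_right_mono) auto
  show ?case using Suc xy 1 2 3 4 by (auto simp: algebra_simps split: if_splits)
qed auto

abbreviation cartan_product :: "('v \<Rightarrow> 'v \<Rightarrow> real) \<Rightarrow> 'v \<Rightarrow> 'v
  \<Rightarrow> real" where
  "cartan_product B a b \<equiv> 4 * B a b ^ 2 / (B a a * B b b)"

locale refl_rep = cox_words n R + bilin B for n R and B :: "'v::real_vector \<Rightarrow> 'v \<Rightarrow>
  real" +
  fixes \<alpha> :: "nat \<Rightarrow> 'v"
  assumes root_pos: "i < n \<Longrightarrow> 0 < B (\<alpha> i) (\<alpha> i)"
    and root_obtuse: "\<lbrakk>i < n; k < n; i \<noteq> k\<rbrakk> \<Longrightarrow> B (\<alpha> i)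
      (\<alpha> k) \<le> 0"
    and rel_trivial: "r \<in> R \<Longrightarrow> refl_word B \<alpha> r = id"
    and rel_order: "\<lbrakk>i < n; k < n; i \<noteq> k\<rbrakk> \<Longrightarrow>
      4 \<le> cartan_product B (\<alpha> i) (\<alpha> k) \<or>
      (\<exists>m>0. concat (replicate m [i, k]) \<in> R \<and>
        order_bound (cartan_product B (\<alpha> i) (\<alpha> k)) m)"
begin

abbreviation rho where "rho \<equiv> refl_word B \<alpha>"

lemma rho_cong: "cox_eq R u w \<Longrightarrow> rho u = rho w"
proof (induction rule: cox_eq.induct)
  case (cox_del r a b)
  then show ?case using rel_trivial[of r] by (auto simp: fun_eq_iff)
qed auto

definition chamber :: "'v set" where
  "chamber = {v. \<forall>i<n. B v (\<alpha> i) \<le> 0}"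

definition positive :: "'v \<Rightarrow> bool" where
  "positive \<beta> \<longleftrightarrow> (\<forall>v\<in>chamber. B v \<beta> \<le> 0)"

lemma positive_comb: "\<lbrakk>positive \<beta>; positive \<gamma>; 0 \<le> x; 0 \<le> y\<rbrakk>
  \<Longrightarrow> positive (x *\<^sub>R \<beta> + y *\<^sub>R \<gamma>)"
  by (auto simp: positive_def B_simps mult_nonneg_nonpos add_nonpos_nonpos)

lemma rho_alt:
  assumes "i < n" "k < n"
  defines "a \<equiv> - 2 * B (\<alpha> i) (\<alpha> k) / B (\<alpha> k) (\<alpha> k)"
    and "b \<equiv> - 2 * B (\<alpha> i) (\<alpha> k) / B (\<alpha> i) (\<alpha> i)"
  shows "rho (alt p k i) (\<alpha> i) =
    fst (dihedral_coeffs a b p) *\<^sub>R \<alpha> i + snd (dihedral_coeffs a b p) *\<^sub>R \<alpha> k"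
proof (induction p)
  case (Suc p)
  obtain x y where xy: "dihedral_coeffs a b p = (x, y)" by fastforce
  have "reflect B (\<alpha> k) (x *\<^sub>R \<alpha> i + y *\<^sub>R \<alpha> k) = x *\<^sub>R \<alpha> i +
    (a * x - y) *\<^sub>R \<alpha> k"
    using root_pos[OF assms(2)]
    by (simp add: reflect_def B_simps a_def field_simps scaleR_add_left[symmetric] del: scaleR_add_left)
  moreover have "reflect B (\<alpha> i) (x *\<^sub>R \<alpha> i + y *\<^sub>R \<alpha> k) = (b * y - x)
    *\<^sub>R \<alpha> i + y *\<^sub>R \<alpha> k"
    using root_pos[OF assms(1)] B_sym[of "\<alpha> k" "\<alpha> i"]
    by (simp add: reflect_def B_simps b_def field_simps scaleR_add_left[symmetric] del: scaleR_add_left)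
  ultimately show ?case using Suc xy by auto
qed auto

lemma tits_positive:
  assumes "set w \<subseteq> {..<n}" "i < n" "len (w @ [i]) = Suc (len w)"
  shows "positive (rho w (\<alpha> i))"
  using assms
proof (induction "len w" arbitrary: w i rule: less_induct)
  case less
  show ?case
  proof (cases "len w = 0")
    case True
    then have "cox_eq R w []" using reduced_word[of w] by auto
    then have "rho w = rho []" by (rule rho_cong)
    then show ?thesis using less.prems by (auto simp: positive_def chamber_def)
  next
    case False
    obtain w' where w': "cox_eq R w w'" "length w' = len w" using reduced_word by blast
    with False obtain u k where "w' = u @ [k]" by (cases w' rule: rev_cases) auto
    with w' have uk: "cox_eq R w (u @ [k])" "Suc (length u) = len w" by auto
    have un: "set u \<subseteq> {..<n}" "k < n" using cox_eq_letters[OF uk(1)] less.prems by auto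
    have ki: "k \<noteq> i"
    proof
      assume "k = i"
      then have "cox_eq R (w @ [i]) (u @ [i, i])" using cox_eq_context[OF uk(1), of "[]" "[i]"] by simp
      moreover have "cox_eq R (u @ [i, i] @ []) (u @ [])"
        by (rule cox_eq.cox_del) (use rel_invol less.prems in auto)
      ultimately have "cox_eq R (w @ [i]) u" by (auto intro: cox_eq.cox_trans)
      then have "len (w @ [i]) \<le> length u" by (rule len_le)
      then show False using uk less.prems by simp
    qed
    \<comment> \<open>Split off from the end of \<open>w\<close> the longest possible alternating word in
      \<open>i\<close> and \<open>k\<close>; the rest \<open>v\<close>
      then gets longer when multiplied by \<open>i\<close> or by \<open>k\<close>, and the induction
        hypothesis applies to it.\<close>
    define P where "P p \<longleftrightarrow> 0 < p \<and> (\<exists>v. cox_eq R w (v @ alt p k i) \<and>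
      length v + p = len w)" for p
    have "P 1" unfolding P_def using uk by (auto intro!: exI[of _ u])
    moreover have Pb: "\<forall>p. P p \<longrightarrow> p \<le> len w" by (auto simp: P_def)
    ultimately obtain p where p: "P p" and pmax: "\<And>q. P q \<Longrightarrow> q \<le> p"
      using GreatestI_nat[of P 1] Greatest_le_nat[of P] by metis
    then obtain v where v: "cox_eq R w (v @ alt p k i)" "length v + p = len w" "0 < p"
      by (auto simp: P_def)
    have vn: "set v \<subseteq> {..<n}" using cox_eq_letters[OF v(1)] less.prems by auto
    have lv: "len v = length v"
      using len_append_le[of v "alt p k i"] len_cong[OF v(1)] v(2) len_le[OF cox_eq.cox_refl, of v] by simp
    \<comment> \<open>If \<open>v @ [c]\<close> were shorter, \<open>v\<close> could be rewritten to
      end in \<open>c\<close>. Then \<open>c\<close> either prolongs the alternating word, against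
      the choice of \<open>p\<close>, or cancels its first letter, against the length of
      \<open>w\<close>.\<close>
    have step: "len (v @ [c]) = Suc (len v)" if c: "c \<in> {i, k}" for c
    proof (rule ccontr)
      have cn: "c < n" using c less.prems un by auto
      assume "len (v @ [c]) \<noteq> Suc (len v)"
      then have lc: "len v = Suc (len (v @ [c]))" using len_snoc[OF cn, of v] by simp
      obtain v' where v': "cox_eq R (v @ [c]) v'" "length v' = len (v @ [c])" using reduced_word by blast
      have "cox_eq R (v @ [c, c]) v"
        using cox_eq.cox_del[OF rel_invol[OF cn], of v "[]"] by simp
      moreover have "cox_eq R (v @ [c, c]) (v' @ [c])" using cox_eq_context[OF v'(1), of "[]" "[c]"] by simp
      ultimately have vc: "cox_eq R v (v' @ [c])" by (auto intro: cox_eq.intros)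
      have "cox_eq R w (v' @ c # alt p k i)"
        using v(1) cox_eq_context[OF vc, of "[]" "alt p k i"] by (auto intro: cox_eq.cox_trans)
      note wv = this
      show False
      proof (cases "c = (if even p then k else i)")
        case True
        then have "P (Suc p)" unfolding P_def using wv v' v lc lv by (intro conjI exI[of _ v']) auto
        then show False using pmax by fastforce
      next
        case False
        obtain q where q: "p = Suc q" using v(3) by (cases p) auto
        with False c have "alt p k i = c # alt q k i" by auto
        with wv have "cox_eq R w (v' @ [c, c] @ alt q k i)" by simp
        moreover have "cox_eq R (v' @ [c, c] @ alt q k i) (v' @ alt q k i)"
          by (rule cox_eq.cox_del) (use rel_invol cn in auto)
        ultimately have "cox_eq R w (v' @ alt q k i)" by (rule cox_eq.cox_trans)
        then have "len w \<le> length v' + q" using len_le by fastforce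
        then show False using v v' lc lv q by simp
      qed
    qed
    have pos: "positive (rho v (\<alpha> i))" "positive (rho v (\<alpha> k))"
      using less.hyps[of v i] less.hyps[of v k] step vn un less.prems v lv by auto
    let ?a = "- 2 * B (\<alpha> i) (\<alpha> k) / B (\<alpha> k) (\<alpha> k)" and ?b =
      "- 2 * B (\<alpha> i) (\<alpha> k) / B (\<alpha> i) (\<alpha> i)"
    let ?c = "cartan_product B (\<alpha> i) (\<alpha> k)"
    have i: "i < n" and k: "k < n" using less.prems un by auto
    have ab: "0 \<le> ?a" "0 \<le> ?b" "?a = 0 \<longleftrightarrow> ?b = 0" "?a * ?b = ?c"
      using root_obtuse[OF i k] ki root_pos[OF i] root_pos[OF k]
      by (auto simp: divide_nonpos_pos power2_eq_square field_simps)
    have "0 \<le> fst (dihedral_coeffs ?a ?b p) \<and> 0 \<le> snd (dihedral_coeffs ?a ?b p)"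
    proof (cases "4 \<le> ?c")
      case True
      then show ?thesis using dihedral_coeffs_infinite[of ?a ?b p] ab by auto
    next
      case False
      then obtain m where m: "0 < m" "concat (replicate m [i, k]) \<in> R" "order_bound ?c m"
        using rel_order[OF i k] ki by auto
      \<comment> \<open>An alternating suffix of length \<open>m\<close> could be rewritten by the
        braid relation so that it ends in \<open>i\<close>; then \<open>w @ [i]\<close> would be
        shorter than \<open>w\<close>.\<close>
      have "p < m"
      proof (rule ccontr)
        assume "\<not> p < m"
        then obtain q where q: "p = q + m" using le_Suc_ex by (metis add.commute not_less)
        obtain t where t: "alt p k i = t @ alt m k i" "length t = q" using alt_add[of q m k i] q by auto
        have "cox_eq R ((v @ t) @ alt m k i) ((v @ t) @ alt m i k)"
          by (intro cox_eq_append cox_eq.cox_refl braid m i k)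
        then have w1: "cox_eq R w (v @ t @ alt m i k)" using v(1) t by (auto intro: cox_eq.cox_trans)
        obtain m' where m': "m = Suc m'" using m by (cases m) auto
        with w1 have "cox_eq R w (v @ t @ alt m' k i @ [i])" by (simp only: alt_snoc)
        then have "cox_eq R (w @ [i]) (v @ t @ alt m' k i @ [i, i])"
          using cox_eq_context[of R _ _ "[]" "[i]"] by fastforce
        moreover have "cox_eq R ((v @ t @ alt m' k i) @ [i, i] @ []) ((v @ t @ alt m' k i) @ [])"
          by (rule cox_eq.cox_del) (use rel_invol i in auto)
        ultimately have "cox_eq R (w @ [i]) (v @ t @ alt m' k i)" by (auto intro: cox_eq.cox_trans)
        then have "len (w @ [i]) \<le> length v + (q + m')" using len_le t by fastforce
        then show False using less.prems v q m' by simp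
      qed
      then show ?thesis using dihedral_coeffs_finite[of ?a ?b m p] ab m by auto
    qed
    then have "positive (fst (dihedral_coeffs ?a ?b p) *\<^sub>R rho v (\<alpha> i) + snd (dihedral_coeffs
      ?a ?b p) *\<^sub>R rho v (\<alpha> k))"
      by (intro positive_comb pos) auto
    also have "fst (dihedral_coeffs ?a ?b p) *\<^sub>R rho v (\<alpha> i) + snd (dihedral_coeffs ?a ?b p)
      *\<^sub>R rho v (\<alpha> k)
      = rho v (rho (alt p k i) (\<alpha> i))"
      unfolding rho_alt[OF i k] by (simp add: linear_add[OF linear_refl_word] linear_scale[OF linear_refl_word])
    also have "\<dots> = rho w (\<alpha> i)" using rho_cong[OF v(1)] by simp
    finally show ?thesis .
  qed
qed

text \<open>If a reduced word for \<open>w\<close> ends in \<open>k\<close>, then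
  \<open>rho w\<close> sends the root of \<open>k\<close> to the negative of a positive root, so
  \<open>rho w v\<close> in the chamber forces a nonnegative product of \<open>v\<close> with that
  root. The statement serves twice: it separates the translates of the chamber, and applied to words
  acting trivially it gives the presentation.\<close>

theorem chamber_trivial_word:
  assumes w: "set w \<subseteq> {..<n}" and v: "\<And>i. i < n \<Longrightarrow> B v (\<alpha> i) < 0" and
    wv: "rho w v \<in> chamber"
  shows "cox_eq R w []"
proof (rule ccontr)
  assume nt: "\<not> cox_eq R w []"
  obtain w' where w': "cox_eq R w w'" "length w' = len w" using reduced_word by blast
  with nt have "w' \<noteq> []" by auto
  then obtain u k where uk: "w' = u @ [k]" by (cases w' rule: rev_cases) auto
  have un: "set u \<subseteq> {..<n}" "k < n" using cox_eq_letters[OF w'(1)] w uk by auto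
  have "len (u @ [k]) = length u + 1" using len_cong[OF w'(1)] w' uk by simp
  then have "len (u @ [k]) = Suc (len u)"
    using len_append_le[of u "[k]"] len_le[OF cox_eq.cox_refl, of u] by simp
  then have pos: "positive (rho u (\<alpha> k))" using tits_positive un by blast
  have rn: "B (\<alpha> i) (\<alpha> i) \<noteq> 0" if "i \<in> set w" for i using root_pos[of i] w that by auto
  have "rho w (\<alpha> k) = rho u (reflect B (\<alpha> k) (\<alpha> k))" using rho_cong[OF w'(1)] uk by simp
  also have "reflect B (\<alpha> k) (\<alpha> k) = - \<alpha> k" using root_pos[OF un(2)] by (simp add:
    reflect_def)
      (simp add: scaleR_2)
  finally have "rho w (\<alpha> k) = - rho u (\<alpha> k)" by (simp add: linear_neg[OF linear_refl_word])
  then have "B v (\<alpha> k) = - B (rho w v) (rho u (\<alpha> k))"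
    using B_refl_word[of w \<alpha> v "\<alpha> k", OF rn] by (simp add: B_simps)
  moreover have "B (rho w v) (rho u (\<alpha> k)) \<le> 0" using pos wv by (auto simp: positive_def)
  ultimately show False using v[OF un(2)] by simp
qed

end

section \<open>The order of a product of two reflections\<close>

context bilin
begin

text \<open>The product \<open>T\<close> is the identity modulo the span of \<open>a\<close> and
  \<open>b\<close>, and on the span it has trace \<open>c - 2\<close> and determinant 1. So it is
  annihilated by \<open>(t - 1) * (t^2 - (c - 2) * t + 1)\<close>, which divides
  \<open>t^3 - 1\<close>, \<open>t^4 - 1\<close>, \<open>t^6 - 1\<close> for
  \<open>c = 1, 2, 3\<close>. For \<open>c = 0\<close> this polynomial has a double root, and
  orthogonality of \<open>a\<close> and \<open>b\<close> is used instead.\<close>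

lemma refl_product_order:
  assumes a: "0 < B a a" and b: "0 < B b b"
    and c: "c = cartan_product B a b" "c \<in> {0, 1, 2, 3}"
  shows "\<exists>m>0. order_bound c m \<and> ((reflect B a \<circ> reflect B b) ^^ m) = id"
proof -
  define T where "T = reflect B a \<circ> reflect B b"
  define l where "l = 2 * B a b / B b b"
  define m where "m = 2 * B a b / B a a"
  have lm: "l * m = c" using a b c by (simp add: l_def m_def power2_eq_square)
  have lin: "linear T" unfolding T_def by (intro linear_compose linear_refl)
  have Ta: "T a = (c - 1) *\<^sub>R a - l *\<^sub>R b"
    using a b by (simp add: T_def reflect_def B_simps lm[symmetric] l_def m_def B_sym[of b a] algebra_simps
      flip: scaleR_add_left) (simp add: field_simps scaleR_2)
  have Tb: "T b = m *\<^sub>R a - b"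
    using a b by (simp add: T_def reflect_def B_simps m_def B_sym[of b a] scaleR_2)
  have Tx: "\<exists>p q. T x = x - p *\<^sub>R a - q *\<^sub>R b" for x
    by (intro exI[of _ "2 * B x a / B a a - 2 * B x b / B b b * m"] exI[of _ "2 * B x b / B b b"])
      (use a b in \<open>simp add: T_def reflect_def B_simps m_def B_sym[of b a] field_simps\<close>)
  note T_lin = linear_add[OF lin] linear_diff[OF lin] linear_scale[OF lin] linear_neg[OF lin]
  show ?thesis
  proof (cases "c = 0")
    case True
    then have "B a b = 0" using c a b by auto
    then have "l = 0" "m = 0" by (auto simp: l_def m_def)
    then have "T (T x) = x" for x using Tx[of x] Ta Tb True by (auto simp: T_lin)
    then have "(T ^^ 2) = id" by (auto simp: numeral_2_eq_2)
    then show ?thesis using True unfolding T_def order_bound_def by (intro exI[of _ 2]) auto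
  next
    case False
    have cubic: "T (T (T x)) = (c - 1) *\<^sub>R T (T x) - (c - 1) *\<^sub>R T x + x" for x
    proof -
      obtain p q where pq: "T x = x - p *\<^sub>R a - q *\<^sub>R b" using Tx by blast
      show ?thesis
        by (simp add: pq T_lin Ta Tb lm[symmetric] algebra_simps)
    qed
    consider "c = 1" | "c = 2" | "c = 3" using c False by auto
    then show ?thesis
    proof cases
      case 1
      then have "(T ^^ 3) = id" using cubic by (auto simp: numeral_3_eq_3)
      then show ?thesis using 1 unfolding T_def order_bound_def by (intro exI[of _ 3]) auto
    next
      case 2
      then have "T (T (T (T x))) = x" for x by (simp add: cubic T_lin)
      then have "(T ^^ 4) = id" by (auto simp: eval_nat_numeral)
      then show ?thesis using 2 unfolding T_def order_bound_def by (intro exI[of _ 4]) auto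
    next
      case 3
      then have "T (T (T (T (T (T x))))) = x" for x
        by (simp add: cubic T_lin algebra_simps scaleR_2 flip: scaleR_add_left)
      then have "(T ^^ 6) = id" by (auto simp: eval_nat_numeral)
      then show ?thesis using 3 unfolding T_def order_bound_def by (intro exI[of _ 6]) auto
    qed
  qed
qed

end

text \<open>Stated for any set \<open>S\<close> of letters because it is applied both to all simple
  roots and to the first four, which fix \<open>(1, 0, 0, 0, 0)\<close>.\<close>

lemma (in refl_rep) move_into_chamber:
  assumes S: "S \<subseteq> {..<n}" and p: "\<And>i. i \<in> S \<Longrightarrow> B p (\<alpha> i) < 0"
    and fin: "\<And>K. finite {q. (\<exists>w. set w \<subseteq> S \<and> q = rho w p) \<and> - B v q \<le> K}"
  shows "\<exists>w. set w \<subseteq> S \<and> (\<forall>i\<in>S. B (rho w v) (\<alpha> i) \<le> 0)"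
proof -
  have rn: "B (\<alpha> i) (\<alpha> i) \<noteq> 0" if "i \<in> S" for i using root_pos[of i] S that by auto
  \<comment> \<open>The word is carried over from \<open>v\<close> to \<open>p\<close>, whose orbit
    is discrete; therefore only finitely many values lie below \<open>f []\<close> and a minimum
    exists.\<close>
  define f where "f w = - B v (rho (rev w) p)" for w
  have f: "f w = - B (rho w v) p" if "set w \<subseteq> S" for w
    using B_refl_word[of w \<alpha> v "rho (rev w) p"] refl_word_rev[of "rev w" \<alpha> p] that rn
    by (auto simp: f_def subset_iff)
  let ?A = "{f w | w. set w \<subseteq> S \<and> f w \<le> f []}"
  have "?A \<subseteq> (\<lambda>q. - B v q) ` {q. (\<exists>w. set w \<subseteq> S \<and> q = rho w p)
    \<and> - B v q \<le> f []}"
  proof clarify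
    fix w assume "set w \<subseteq> S" "f w \<le> f []"
    then show "f w \<in> (\<lambda>q. - B v q) ` {q. (\<exists>w. set w \<subseteq> S \<and> q = rho w p)
      \<and> - B v q \<le> f []}"
      by (intro image_eqI[of _ _ "rho (rev w) p"]) (auto simp: f_def intro!: exI[of _ "rev w"])
  qed
  then have fA: "finite ?A" using fin finite_surj by blast
  have neA: "?A \<noteq> {}" by (auto intro: exI[of _ "[]"])
  obtain w where w: "set w \<subseteq> S" "Min ?A = f w" "f w \<le> f []" using Min_in[OF fA neA] by auto
  have min: "f w \<le> f u" if "set u \<subseteq> S" for u
    using Min_le[OF fA, of "f u"] w that by (cases "f u \<le> f []") auto
  have "B (rho w v) (\<alpha> i) \<le> 0" if i: "i \<in> S" for i
  proof (rule ccontr)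
    assume "\<not> ?thesis"
    then have "2 * B (rho w v) (\<alpha> i) / B (\<alpha> i) (\<alpha> i) * B p (\<alpha> i) < 0"
      using p[OF i] root_pos[of i] S i by (intro mult_pos_neg divide_pos_pos) auto
    moreover have "f (i # w) = f w + 2 * B (rho w v) (\<alpha> i) / B (\<alpha> i) (\<alpha> i) * B p
      (\<alpha> i)"
      using f[of w] f[of "i # w"] w(1) i by (simp add: reflect_def B_simps B_sym[of p])
    ultimately show False using min[of "i # w"] w(1) i by auto
  qed
  then show ?thesis using w(1) by blast
qed

section \<open>The integral Lorentzian forms\<close>

type_synonym r5 = "real \<times> real \<times> real \<times> real \<times> real"

text \<open>\<open>\<Lambda>\<^sub>j \<otimes> \<real>\<close> is identified with
  \<open>\<real>\<^sup>5\<close> by dividing the last \<open>j\<close> coordinates by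
  \<open>\<theta>\<close>, so that \<open>\<Lambda>\<^sub>j\<close>
  becomes \<open>\<int>\<^sup>5\<close> and these coordinates get weight \<open>3\<close> in the form.\<close>

definition wt :: "nat \<Rightarrow> nat \<Rightarrow> real" where
  "wt j i = (if 5 \<le> i + j then 3 else 1)"

fun bf :: "nat \<Rightarrow> r5 \<Rightarrow> r5 \<Rightarrow> real" where
  "bf j (x0, x1, x2, x3, x4) (y0, y1, y2, y3, y4) =
    - x0 * y0 + wt j 1 * x1 * y1 + wt j 2 * x2 * y2 + wt j 3 * x3 * y3 + wt j 4 * x4 * y4"

fun integral5 :: "r5 \<Rightarrow> bool" where
  "integral5 (x0, x1, x2, x3, x4) \<longleftrightarrow> x0 \<in> \<int> \<and> x1 \<in> \<int> \<and> x2
    \<in> \<int> \<and> x3 \<in> \<int> \<and> x4 \<in> \<int>"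

definition future :: "nat \<Rightarrow> r5 \<Rightarrow> bool" where
  "future j x \<longleftrightarrow> bf j x x < 0 \<and> 0 < fst x"

lemma wt_ge_1: "1 \<le> wt j i" by (simp add: wt_def)

global_interpretation bf: bilin "bf j" for j
  by unfold_locales (auto simp: algebra_simps)

text \<open>Lagrange's identity: the difference of the two sides is a weighted sum of squared
  minors.\<close>

lemma bf_cauchy_schwarz:
  fixes x1 x2 x3 x4 y1 y2 y3 y4 :: real
  shows "(wt j 1 * x1 * y1 + wt j 2 * x2 * y2 + wt j 3 * x3 * y3 + wt j 4 * x4 * y4)\<^sup>2
    \<le> (wt j 1 * x1\<^sup>2 + wt j 2 * x2\<^sup>2 + wt j 3 * x3\<^sup>2 + wt j 4 * x4\<^sup>2) *
      (wt j 1 * y1\<^sup>2 + wt j 2 * y2\<^sup>2 + wt j 3 * y3\<^sup>2 + wt j 4 * y4\<^sup>2)"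
proof -
  have nn: "0 \<le> wt j i * wt j k * z\<^sup>2" for i k z using wt_ge_1[of j i] wt_ge_1[of j k] by simp
  have "(wt j 1 * x1\<^sup>2 + wt j 2 * x2\<^sup>2 + wt j 3 * x3\<^sup>2 + wt j 4 * x4\<^sup>2) *
      (wt j 1 * y1\<^sup>2 + wt j 2 * y2\<^sup>2 + wt j 3 * y3\<^sup>2 + wt j 4 * y4\<^sup>2) -
    (wt j 1 * x1 * y1 + wt j 2 * x2 * y2 + wt j 3 * x3 * y3 + wt j 4 * x4 * y4)\<^sup>2 =
    wt j 1 * wt j 2 * (x1 * y2 - x2 * y1)\<^sup>2 + wt j 1 * wt j 3 * (x1 * y3 - x3 * y1)\<^sup>2 +
    wt j 1 * wt j 4 * (x1 * y4 - x4 * y1)\<^sup>2 + wt j 2 * wt j 3 * (x2 * y3 - x3 * y2)\<^sup>2 +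
    wt j 2 * wt j 4 * (x2 * y4 - x4 * y2)\<^sup>2 + wt j 3 * wt j 4 * (x3 * y4 - x4 * y3)\<^sup>2"
    by algebra
  moreover have "0 \<le> \<dots>" by (intro add_nonneg_nonneg nn)
  ultimately show ?thesis by linarith
qed

text \<open>By Cauchy-Schwarz the spatial part of the product is smaller in absolute value than the
  product of the time coordinates, which therefore decides the sign.\<close>

lemma negative_same_sign:
  assumes "bf j x x < 0" "bf j y y < 0"
  shows "bf j x y < 0 \<longleftrightarrow> 0 < fst x * fst y"
proof -
  obtain x0 x1 x2 x3 x4 where x: "x = (x0, x1, x2, x3, x4)" by (cases x) auto
  obtain y0 y1 y2 y3 y4 where y: "y = (y0, y1, y2, y3, y4)" by (cases y) auto
  let ?X = "wt j 1 * x1\<^sup>2 + wt j 2 * x2\<^sup>2 + wt j 3 * x3\<^sup>2 + wt j 4 * x4\<^sup>2"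
  let ?Y = "wt j 1 * y1\<^sup>2 + wt j 2 * y2\<^sup>2 + wt j 3 * y3\<^sup>2 + wt j 4 * y4\<^sup>2"
  let ?S = "wt j 1 * x1 * y1 + wt j 2 * x2 * y2 + wt j 3 * x3 * y3 + wt j 4 * x4 * y4"
  have X: "?X < x0\<^sup>2" and Y: "?Y < y0\<^sup>2" using assms by (auto simp: x y power2_eq_square
    algebra_simps)
  have "0 \<le> ?X" "0 \<le> ?Y" using wt_ge_1[of j] by (auto intro!: add_nonneg_nonneg mult_nonneg_nonneg
    intro: order_trans[of 0 1])
  then have "?X * ?Y < x0\<^sup>2 * y0\<^sup>2" using X Y by (intro mult_strict_mono) auto
  then have "?S\<^sup>2 < (x0 * y0)\<^sup>2" using bf_cauchy_schwarz[of j x1 y1 x2 y2 x3 y3 x4 y4]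
    by (simp add: power_mult_distrib)
  then have S: "\<bar>?S\<bar> < \<bar>x0 * y0\<bar>" using power2_less_imp_less[of "\<bar>?S\<bar>"
    "\<bar>x0 * y0\<bar>"] by simp
  have "bf j x y = ?S - x0 * y0" by (simp add: x y)
  then show ?thesis using S by (auto simp: x y)
qed

lemma future_bf: "future j x \<Longrightarrow> future j y \<Longrightarrow> bf j x y < 0"
  using negative_same_sign[of j x y] by (simp add: future_def)

text \<open>The product of \<open>x\<close> with its reflection is the norm of \<open>x\<close>
  minus a nonnegative term, hence negative, so both lie in the same half of the cone.\<close>

lemma future_refl:
  assumes "0 < bf j r r" "future j x"
  shows "future j (reflect (bf j) r x)"
proof -
  have neg: "bf j (reflect (bf j) r x) (reflect (bf j) r x) < 0"
    using assms bf.B_refl[of j r x x] by (simp add: future_def)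
  have "bf j (reflect (bf j) r x) x = bf j x x - 2 * (bf j x r)\<^sup>2 / bf j r r"
    by (simp add: reflect_def bf.B_simps bf.B_sym[of j r x] power2_eq_square)
  moreover have "0 \<le> 2 * (bf j x r)\<^sup>2 / bf j r r" using assms by simp
  ultimately have "bf j (reflect (bf j) r x) x < 0" using assms(2) unfolding future_def by linarith
  then show ?thesis using negative_same_sign[OF neg, of x] assms neg
    by (simp add: future_def zero_less_mult_iff)
qed

lemma future_refl_word:
  "(\<And>i. i \<in> set w \<Longrightarrow> 0 < bf j (\<alpha> i) (\<alpha> i)) \<Longrightarrow> future j
    x \<Longrightarrow> future j (refl_word (bf j) \<alpha> w x)"
  by (induction w) (auto intro: future_refl)

text \<open>With \<open>sqrt X\<close> the spatial length of \<open>v\<close>, Cauchy-Schwarz gives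
  \<open>q0 * (v0 - sqrt X) \<le> - bf j v q\<close>. This bounds the time coordinate of
  \<open>q\<close>, and the time coordinate bounds the spatial ones.\<close>

lemma finite_integral_future:
  assumes v: "future j v"
  shows "finite {q. integral5 q \<and> future j q \<and> - bf j v q \<le> K}"
proof -
  obtain v0 v1 v2 v3 v4 where v': "v = (v0, v1, v2, v3, v4)" by (cases v) auto
  define X where "X = wt j 1 * v1\<^sup>2 + wt j 2 * v2\<^sup>2 + wt j 3 * v3\<^sup>2 + wt j 4 * v4\<^sup>2"
  have X0: "0 \<le> X" unfolding X_def using wt_ge_1[of j] by (auto intro!: add_nonneg_nonneg
    mult_nonneg_nonneg intro: order_trans[of 0 1])
  have v0: "0 < v0" "X < v0\<^sup>2" using v by (auto simp: v' future_def X_def power2_eq_square algebra_simps)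
  then have sX: "sqrt X < v0" using real_sqrt_less_mono[of X "v0\<^sup>2"] by simp
  define N where "N = \<lceil>\<bar>K / (v0 - sqrt X)\<bar>\<rceil>"
  let ?I = "real_of_int ` {-N..N}"
  have "{q. integral5 q \<and> future j q \<and> - bf j v q \<le> K} \<subseteq> ?I \<times> ?I \<times> ?I
    \<times> ?I \<times> ?I"
  proof clarify
    fix q0 q1 q2 q3 q4
    assume q: "integral5 (q0, q1, q2, q3, q4)" "future j (q0, q1, q2, q3, q4)"
      "- bf j v (q0, q1, q2, q3, q4) \<le> K"
    let ?Q = "wt j 1 * q1\<^sup>2 + wt j 2 * q2\<^sup>2 + wt j 3 * q3\<^sup>2 + wt j 4 * q4\<^sup>2"
    let ?S = "wt j 1 * v1 * q1 + wt j 2 * v2 * q2 + wt j 3 * v3 * q3 + wt j 4 * v4 * q4"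
    have q0: "0 < q0" "?Q < q0\<^sup>2" using q(2) by (auto simp: future_def power2_eq_square algebra_simps)
    have "?S\<^sup>2 \<le> X * ?Q" using bf_cauchy_schwarz unfolding X_def by blast
    also have "\<dots> \<le> X * q0\<^sup>2" using X0 q0 by (intro mult_left_mono) auto
    also have "\<dots> = (sqrt X * q0)\<^sup>2" using X0 by (simp add: power_mult_distrib)
    finally have "?S \<le> sqrt X * q0" using power2_le_imp_le[of ?S "sqrt X * q0"] X0 q0 by simp
    then have "q0 * (v0 - sqrt X) \<le> K" using q(3) by (simp add: v' algebra_simps)
    then have "q0 \<le> K / (v0 - sqrt X)" using sX by (simp add: pos_le_divide_eq)
    also have "\<dots> \<le> real_of_int N" unfolding N_def by linarith
    finally have q0N: "q0 \<le> real_of_int N" .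
    have sq: "z\<^sup>2 \<le> wt j i * z\<^sup>2" "0 \<le> wt j i * z\<^sup>2" for z i
      using wt_ge_1[of j i] mult_right_mono[of 1 "wt j i" "z\<^sup>2"] by auto
    have "q1\<^sup>2 \<le> q0\<^sup>2 \<and> q2\<^sup>2 \<le> q0\<^sup>2 \<and> q3\<^sup>2 \<le> q0\<^sup>2
      \<and> q4\<^sup>2 \<le> q0\<^sup>2"
      using sq(1)[of q1 1] sq(1)[of q2 2] sq(1)[of q3 3] sq(1)[of q4 4]
        sq(2)[of 1 q1] sq(2)[of 2 q2] sq(2)[of 3 q3] sq(2)[of 4 q4] q0(2)
      by linarith
    then have "\<bar>q1\<bar> \<le> q0 \<and> \<bar>q2\<bar> \<le> q0 \<and> \<bar>q3\<bar> \<le> q0 \<and>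
      \<bar>q4\<bar> \<le> q0"
      using q0(1) by (simp flip: abs_le_square_iff)
    moreover have "z \<in> ?I" if z: "z \<in> \<int>" "\<bar>z\<bar> \<le> q0" for z
    proof -
      obtain m where m: "z = of_int m" using Ints_cases[OF z(1)] by blast
      then have "m \<in> {-N..N}" using z(2) q0N by auto
      then show ?thesis using m by blast
    qed
    ultimately show "q0 \<in> ?I \<and> (q1, q2, q3, q4) \<in> ?I \<times> ?I \<times> ?I \<times> ?I"
      using q(1) q0 by simp
  qed
  then show ?thesis by (rule finite_subset) (intro finite_cartesian_product finite_imageI
    finite_atLeastAtMost_int)
qed

section \<open>Integral vectors of norm -1 in the chambers\<close>

lemma mult_nonneg_le_1_int:
  fixes a b :: int
  assumes "0 \<le> a" "0 \<le> b" "a * b \<le> 1"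
  shows "a * b = 0 \<and> (a = 0 \<or> b = 0) \<or> a * b = 1 \<and> a = 1 \<and> b = 1"
proof -
  have "a * b = 0 \<or> a * b = 1" using assms mult_nonneg_nonneg[of a b] by linarith
  then show ?thesis using assms by (auto simp: pos_zmult_eq_1_iff_lemma zmult_eq_1_iff)
qed

text \<open>In each case \<open>x0\<^sup>2 - \<Sum>k\<^sub>i y\<^sub>i\<^sup>2\<close> is a nonnegative
  combination of products of pairs of the linear
  forms defining the chamber; the combinations were found by linear programming.\<close>

lemma norm_minus_1_chamber_0:
  fixes x y1 y2 y3 y4 :: int
  assumes "y2 \<le> y1" "y3 \<le> y2" "y4 \<le> y3" "0 \<le> y4" "y1 + y2 + y3 \<le> x"
    and "x * x - (y1 * y1 + y2 * y2 + y3 * y3 + y4 * y4) = 1"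
  shows "x = 1 \<and> y1 = 0 \<and> y2 = 0 \<and> y3 = 0 \<and> y4 = 0"
proof -
  \<comment> \<open>Up to positive factors these are minus the products with the simple roots, where
    the \<open>y\<close> are the negated spatial coordinates; the other chambers are treated in the
    same way.\<close>
  define a b c d e where l: "a = y1 - y2" "b = y2 - y3" "c = y3 - y4" "d = y4" "e = x - y1 - y2 - y3"
  have nn: "0 \<le> a" "0 \<le> b" "0 \<le> c" "0 \<le> d" "0 \<le> e"
    using assms by (auto simp: l)
  have eq: "2 * (a * b) + 4 * (a * c) + 4 * (a * d) + 2 * (a * e) + 2 * (b * b) + 8 * (b * c) + 8 * (b * d)
    + 4 * (b * e) + 6 * (c * c) + 12 * (c * d) + 6 * (c * e) + 5 * (d * d) + 6 * (d * e) + (e * e) = 1"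
    using assms unfolding l by (simp add: algebra_simps)
  have p: "0 \<le> a * b" "0 \<le> a * c" "0 \<le> a * d" "0 \<le> a * e" "0 \<le> b * b" "0 \<le> b * c"
    "0 \<le> b * d" "0 \<le> b * e" "0 \<le> c * c" "0 \<le> c * d" "0 \<le> c * e" "0 \<le> d * d"
    "0 \<le> d * e" "0 \<le> e * e"
    using nn by simp_all
  have "a * b = 0" "a * c = 0" "a * d = 0" "a * e = 0" "b * b = 0" "b * c = 0" "b * d = 0" "b * e = 0"
    "c * c = 0" "c * d = 0" "c * e = 0" "d * d = 0" "d * e = 0"
    using eq p by linarith+
  then have z': "a = 0 \<or> b = 0" "a = 0 \<or> c = 0" "a = 0 \<or> d = 0" "a = 0 \<or> e = 0" "b = 0"
    "b = 0 \<or> c = 0" "b = 0 \<or> d = 0" "b = 0 \<or> e = 0" "c = 0" "c = 0 \<or> d = 0"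
    "c = 0 \<or> e = 0" "d = 0" "d = 0 \<or> e = 0"
    by simp_all
  have o: "e * e \<le> 1"
    using eq p by linarith+
  note o' = mult_nonneg_le_1_int[OF nn(5) nn(5) o(1)]
  show ?thesis using z' o' eq unfolding l by auto
qed

lemma norm_minus_1_chamber_1:
  fixes x y1 y2 y3 y4 :: int
  assumes "y2 \<le> y1" "y3 \<le> y2" "0 \<le> y3" "0 \<le> y4" "3 * y4 \<le> x" "y1 + y2 + y3 \<le> x"
    "y1 + y4 \<le> x"
    and "x * x - (y1 * y1 + y2 * y2 + y3 * y3 + 3 * (y4 * y4)) = 1"
  shows "x = 1 \<and> y1 = 0 \<and> y2 = 0 \<and> y3 = 0 \<and> y4 = 0 \<or> x = 3 \<and> y1 = 2 \<and> y2
    = 1 \<and> y3 = 0 \<and> y4 = 1"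
proof -
  define a b c d e f g where l: "a = y1 - y2" "b = y2 - y3" "c = y3" "d = y4" "e = x - 3 * y4"
    "f = x - y1 - y2 - y3" "g = x - y1 - y4"
  have nn: "0 \<le> a" "0 \<le> b" "0 \<le> c" "0 \<le> d" "0 \<le> e" "0 \<le> f" "0 \<le> g"
    using assms by (auto simp: l)
  \<comment> \<open>Three times the norm equation, which clears the denominators of the
    combination.\<close>
  have eq: "(a * b) + 3 * (a * c) + 3 * (a * g) + 2 * (b * b) + 12 * (b * c) + 2 * (b * e) + 4 * (b * f) +
    9 * (c * c) + 3 * (c * e) + 6 * (c * f) + 3 * (d * e) + 6 * (d * f) + 3 * (e * f) = 3"
    using assms unfolding l by (simp add: algebra_simps)
  have p: "0 \<le> a * b" "0 \<le> a * c" "0 \<le> a * g" "0 \<le> b * b" "0 \<le> b * c" "0 \<le> b * e"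
    "0 \<le> b * f" "0 \<le> c * c" "0 \<le> c * e" "0 \<le> c * f" "0 \<le> d * e" "0 \<le> d * f"
    "0 \<le> e * f"
    using nn by simp_all
  have "b * c = 0" "b * f = 0" "c * c = 0" "c * f = 0" "d * f = 0"
    using eq p by linarith+
  then have z': "b = 0 \<or> c = 0" "b = 0 \<or> f = 0" "c = 0" "c = 0 \<or> f = 0" "d = 0 \<or> f = 0"
    by simp_all
  have o: "a * c \<le> 1" "a * g \<le> 1" "b * b \<le> 1" "b * e \<le> 1" "c * e \<le> 1" "d * e \<le> 1"
    "e * f \<le> 1"
    using eq p by linarith+
  note o' = mult_nonneg_le_1_int[OF nn(1) nn(3) o(1)]
    mult_nonneg_le_1_int[OF nn(1) nn(7) o(2)]
    mult_nonneg_le_1_int[OF nn(2) nn(2) o(3)]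
    mult_nonneg_le_1_int[OF nn(2) nn(5) o(4)]
    mult_nonneg_le_1_int[OF nn(3) nn(5) o(5)]
    mult_nonneg_le_1_int[OF nn(4) nn(5) o(6)]
    mult_nonneg_le_1_int[OF nn(5) nn(6) o(7)]
  \<comment> \<open>Seven linear forms in five variables satisfy two linear relations; these exclude
    the combinations of zeros and ones that the products alone would admit.\<close>
  have fg: "f = e + 3 * d - a - 2 * b - 3 * c" "g = e + 2 * d - a - b - c" unfolding l by auto
  have "a = 0 \<and> b = 0 \<and> c = 0 \<and> d = 0 \<and> e = 1 \<or> a = 1 \<and> b = 1 \<and> c = 0
    \<and> d = 1 \<and> e = 0"
  proof (cases "b = 0")
    case True
    then have "a * g + d * e + e * f = 1" using eq z' by auto
    then show ?thesis using o'(2,6,7) z'(3,5) nn fg True by (elim disjE conjE) simp_all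
  next
    case False
    then have b: "b = 1" using o'(3) by auto
    then have f: "f = 0" using z' by auto
    have eq': "a + 3 * (a * g) + 2 * e + 3 * (d * e) = 1" using eq b f z' by auto
    then have "e = 0" "a * g \<le> 0" using p nn by linarith+
    then have "a * g = 0" using p by linarith
    then show ?thesis using eq' \<open>e = 0\<close> b f fg z'(3) by auto
  qed
  then show ?thesis unfolding l by auto
qed

text \<open>The second solution is the image of the first under \<open>dg\<close>, up to the sign
  convention. The third cannot be removed by inequalities;
  \<open>characteristic_vector_excluded\<close> shows that it is not equivalent to the
  first.\<close>

lemma norm_minus_1_chamber_2:
  fixes x y1 y2 y3 y4 :: int
  assumes "y2 \<le> y1" "0 \<le> y2" "y3 \<le> y4" "0 \<le> y3" "3 * y4 \<le> x" "y1 + y2 \<le> x"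
    "y1 + y3 + y4 \<le> x"
    and "x * x - (y1 * y1 + y2 * y2 + 3 * (y3 * y3) + 3 * (y4 * y4)) = 1"
  shows "x = 1 \<and> y1 = 0 \<and> y2 = 0 \<and> y3 = 0 \<and> y4 = 0 \<or> x = 3 \<and> y1 = 2 \<and> y2
    = 1 \<and> y3 = 0 \<and> y4 = 1 \<or>
    x = 3 \<and> y1 = 1 \<and> y2 = 1 \<and> y3 = 1 \<and> y4 = 1"
proof -
  define a b c d e f g where l: "a = y1 - y2" "b = y2" "c = y4 - y3" "d = y3" "e = x - 3 * y4"
    "f = x - y1 - y2" "g = x - y1 - y3 - y4"
  have nn: "0 \<le> a" "0 \<le> b" "0 \<le> c" "0 \<le> d" "0 \<le> e" "0 \<le> f" "0 \<le> g"
    using assms by (auto simp: l)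
  have eq: "(a * b) + (a * g) + 2 * (b * g) + 3 * (c * d) + (c * e) + 2 * (c * f) + 2 * (d * e) + (d * f) +
    (e * f) = 1"
    using assms unfolding l by (simp add: algebra_simps)
  have p: "0 \<le> a * b" "0 \<le> a * g" "0 \<le> b * g" "0 \<le> c * d" "0 \<le> c * e" "0 \<le> c * f"
    "0 \<le> d * e" "0 \<le> d * f" "0 \<le> e * f"
    using nn by simp_all
  have "b * g = 0" "c * d = 0" "c * f = 0" "d * e = 0"
    using eq p by linarith+
  then have z': "b = 0 \<or> g = 0" "c = 0 \<or> d = 0" "c = 0 \<or> f = 0" "d = 0 \<or> e = 0"
    by simp_all
  have o: "a * b \<le> 1" "a * g \<le> 1" "c * e \<le> 1" "d * f \<le> 1" "e * f \<le> 1"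
    using eq p by linarith+
  note o' = mult_nonneg_le_1_int[OF nn(1) nn(2) o(1)]
    mult_nonneg_le_1_int[OF nn(1) nn(7) o(2)]
    mult_nonneg_le_1_int[OF nn(3) nn(5) o(3)]
    mult_nonneg_le_1_int[OF nn(4) nn(6) o(4)]
    mult_nonneg_le_1_int[OF nn(5) nn(6) o(5)]
  have fg: "f = e + 3 * (c + d) - a - 2 * b" "g = e + 2 * c + d - a - b" unfolding l by auto
  have "a = 0 \<and> b = 0 \<and> c = 0 \<and> d = 0 \<and> e = 1 \<or> a = 1 \<and> b = 1 \<and> c = 1
    \<and> d = 0 \<and> e = 0 \<or>
      a = 0 \<and> b = 1 \<and> c = 0 \<and> d = 1 \<and> e = 0"
  proof -
    consider "d = 0" "f = 0" | "c = 0" "e = 0" | "c = 0" "d = 0" using z' by auto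
    then show ?thesis
    proof cases
      case 1
      then have "a * b + a * g + c * e = 1" using eq z' by auto
      then show ?thesis using o'(1,2,3) z'(1) nn fg 1 by (elim disjE conjE) simp_all
    next
      case 2
      then have "a * b + a * g + d * f = 1" using eq z' by auto
      then show ?thesis using o'(1,2,4) z'(1) nn fg 2 by (elim disjE conjE) simp_all
    next
      case 3
      then have "a * b + a * g + e * f = 1" using eq z' by auto
      then show ?thesis using o'(1,2,5) z'(1) nn fg 3 by (elim disjE conjE) simp_all
    qed
  qed
  then show ?thesis unfolding l by auto
qed

lemma norm_minus_1_chamber_3:
  fixes x y1 y2 y3 y4 :: int
  assumes "0 \<le> y1" "y3 \<le> y4" "y2 \<le> y3" "0 \<le> y2" "3 * y4 \<le> x" "y1 + y3 + y4 \<le> x"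
    "y1 + 3 * y2 + 3 * y3 + 3 * y4 \<le> 3 * x"
    and "x * x - (y1 * y1 + 3 * (y2 * y2) + 3 * (y3 * y3) + 3 * (y4 * y4)) = 1"
  shows "x = 1 \<and> y1 = 0 \<and> y2 = 0 \<and> y3 = 0 \<and> y4 = 0"
proof -
  define a b c d e f g where l: "a = y1" "b = y4 - y3" "c = y3 - y2" "d = y2" "e = x - 3 * y4"
    "f = x - y1 - y3 - y4" "g = 3 * x - y1 - 3 * y2 - 3 * y3 - 3 * y4"
  have nn: "0 \<le> a" "0 \<le> b" "0 \<le> c" "0 \<le> d" "0 \<le> e" "0 \<le> f" "0 \<le> g"
    using assms by (auto simp: l)
  have eq: "(a * b) + 2 * (a * c) + (a * f) + 3 * (b * c) + 3 * (b * d) + (b * e) + 3 * (b * f) + 2 * (c *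
    e) + 3 * (c * f) + 2 * (d * e) + (d * g) + (e * f) = 1"
    using assms unfolding l by (simp add: algebra_simps)
  have p: "0 \<le> a * b" "0 \<le> a * c" "0 \<le> a * f" "0 \<le> b * c" "0 \<le> b * d" "0 \<le> b * e"
    "0 \<le> b * f" "0 \<le> c * e" "0 \<le> c * f" "0 \<le> d * e" "0 \<le> d * g" "0 \<le> e * f"
    using nn by simp_all
  have "a * c = 0" "b * c = 0" "b * d = 0" "b * f = 0" "c * e = 0" "c * f = 0" "d * e = 0"
    using eq p by linarith+
  then have z': "a = 0 \<or> c = 0" "b = 0 \<or> c = 0" "b = 0 \<or> d = 0" "b = 0 \<or> f = 0"
    "c = 0 \<or> e = 0" "c = 0 \<or> f = 0" "d = 0 \<or> e = 0"
    by simp_all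
  have o: "a * b \<le> 1" "a * f \<le> 1" "b * e \<le> 1" "d * g \<le> 1" "e * f \<le> 1"
    using eq p by linarith+
  note o' = mult_nonneg_le_1_int[OF nn(1) nn(2) o(1)]
    mult_nonneg_le_1_int[OF nn(1) nn(6) o(2)]
    mult_nonneg_le_1_int[OF nn(2) nn(5) o(3)]
    mult_nonneg_le_1_int[OF nn(4) nn(7) o(4)]
    mult_nonneg_le_1_int[OF nn(5) nn(6) o(5)]
  have fg: "f = e + 2 * b + c + d - a" "g = 3 * e + 6 * b + 3 * c - a" unfolding l by auto
  have "a = 0 \<and> b = 0 \<and> c = 0 \<and> d = 0 \<and> e = 1"
  proof -
    consider "c = 0" "d = 0" "f = 0" | "b = 0" "c = 0" "d = 0" | "b = 0" "e = 0" "c = 0"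
      | "b = 0" "e = 0" "a = 0" "f = 0" using z' by auto
    then show ?thesis
    proof cases
      case 1
      then have "a * b + b * e = 1" using eq by simp
      then show ?thesis using o'(1,3) nn fg 1 by (elim disjE conjE) simp_all
    next
      case 2
      then have "a * f + e * f = 1" using eq by simp
      then show ?thesis using o'(2,5) nn fg 2 by (elim disjE conjE) simp_all
    next
      case 3
      then have "a = 0" using nn fg by simp
      then show ?thesis using eq fg 3 by simp
    next
      case 4
      then have "d = 0" using nn fg by linarith
      then show ?thesis using eq 4 by simp
    qed
  qed
  then show ?thesis unfolding l by auto
qed

lemma norm_minus_1_chamber_4:
  fixes x y1 y2 y3 y4 :: int
  assumes "y3 \<le> y4" "y2 \<le> y3" "y1 \<le> y2" "0 \<le> y1" "3 * y4 \<le> x" "y1 + y2 + y3 + y4 \<le> x"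
    and "x * x - (3 * (y1 * y1) + 3 * (y2 * y2) + 3 * (y3 * y3) + 3 * (y4 * y4)) = 1"
  shows "x = 1 \<and> y1 = 0 \<and> y2 = 0 \<and> y3 = 0 \<and> y4 = 0"
proof -
  define a b c d e f where l: "a = y4 - y3" "b = y3 - y2" "c = y2 - y1" "d = y1" "e = x - 3 * y4"
    "f = x - y1 - y2 - y3 - y4"
  have nn: "0 \<le> a" "0 \<le> b" "0 \<le> c" "0 \<le> d" "0 \<le> e" "0 \<le> f"
    using assms by (auto simp: l)
  have eq: "6 * (a * a) + 12 * (a * b) + 12 * (a * c) + 6 * (a * e) + 3 * (b * b) + 6 * (b * c) + 6 * (b *
    e) + 6 * (c * e) + 3 * (d * d) + 6 * (d * f) + (e * e) = 1"
    using assms unfolding l by (simp add: algebra_simps)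
  have p: "0 \<le> a * a" "0 \<le> a * b" "0 \<le> a * c" "0 \<le> a * e" "0 \<le> b * b" "0 \<le> b * c"
    "0 \<le> b * e" "0 \<le> c * e" "0 \<le> d * d" "0 \<le> d * f" "0 \<le> e * e"
    using nn by simp_all
  have "a * a = 0" "a * b = 0" "a * c = 0" "a * e = 0" "b * b = 0" "b * c = 0" "b * e = 0" "c * e = 0"
    "d * d = 0" "d * f = 0"
    using eq p by linarith+
  then have z': "a = 0" "a = 0 \<or> b = 0" "a = 0 \<or> c = 0" "a = 0 \<or> e = 0" "b = 0"
    "b = 0 \<or> c = 0" "b = 0 \<or> e = 0" "c = 0 \<or> e = 0" "d = 0" "d = 0 \<or> f = 0"
    by simp_all
  have o: "e * e \<le> 1"
    using eq p by linarith+
  note o' = mult_nonneg_le_1_int[OF nn(5) nn(5) o(1)]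
  show ?thesis using z' o' eq unfolding l by auto
qed


section \<open>Signed permutation matrices over the integers\<close>

lemma unit_vector_int:
  fixes a b c d :: int
  assumes "a * a + b * b + c * c + d * d = 1"
  shows "(\<bar>a\<bar>, \<bar>b\<bar>, \<bar>c\<bar>, \<bar>d\<bar>) \<in> {(1, 0, 0, 0), (0, 1, 0, 0),
    (0, 0, 1, 0), (0, 0, 0, 1)}"
proof -
  have "\<bar>z\<bar> = 0 \<and> z * z = 0 \<or> \<bar>z\<bar> = 1 \<and> z * z = 1 \<or> 4 \<le> z * z"
    for z :: int
  proof -
    consider "z = 0" | "z = 1" | "z = -1" | "2 \<le> \<bar>z\<bar>" by linarith
    then show ?thesis using mult_mono[of 2 "\<bar>z\<bar>" 2 "\<bar>z\<bar>"] by cases auto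
  qed
  from this[of a] this[of b] this[of c] this[of d] show ?thesis
    using assms by (elim disjE conjE) (simp_all del: abs_eq_0)
qed

lemma orthogonal_unit_vectors_int:
  fixes a1 a2 a3 a4 b1 b2 b3 b4 :: int
  assumes "a1 * a1 + a2 * a2 + a3 * a3 + a4 * a4 = 1" "a1 * b1 + a2 * b2 + a3 * b3 + a4 * b4 = 0"
  shows "(a1 = 0 \<or> b1 = 0) \<and> (a2 = 0 \<or> b2 = 0) \<and> (a3 = 0 \<or> b3 = 0) \<and> (a4 = 0
    \<or> b4 = 0)"
  using unit_vector_int[OF assms(1)] assms(2) by (auto simp: abs_eq_iff')

text \<open>The columns \<open>a\<close>, \<open>b\<close>, \<open>c\<close>, \<open>d\<close> form
  a signed permutation matrix, and the sorted quantities are its values on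
  \<open>(4, 3, 2, 1)\<close>. As these entries are distinct and positive, only the identity leaves
  them in decreasing order and nonnegative. Up to sign, \<open>(4, 3, 2, 1)\<close> is the spatial
  part of \<open>p5 0\<close>.\<close>

lemma signed_permutation_sorted:
  fixes a1 a2 a3 a4 b1 b2 b3 b4 c1 c2 c3 c4 d1 d2 d3 d4 :: int
  assumes unit: "a1 * a1 + a2 * a2 + a3 * a3 + a4 * a4 = 1" "b1 * b1 + b2 * b2 + b3 * b3 + b4 * b4 = 1"
      "c1 * c1 + c2 * c2 + c3 * c3 + c4 * c4 = 1" "d1 * d1 + d2 * d2 + d3 * d3 + d4 * d4 = 1"
    and orth: "a1 * b1 + a2 * b2 + a3 * b3 + a4 * b4 = 0" "a1 * c1 + a2 * c2 + a3 * c3 + a4 * c4 = 0"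
      "a1 * d1 + a2 * d2 + a3 * d3 + a4 * d4 = 0" "b1 * c1 + b2 * c2 + b3 * c3 + b4 * c4 = 0"
      "b1 * d1 + b2 * d2 + b3 * d3 + b4 * d4 = 0" "c1 * d1 + c2 * d2 + c3 * d3 + c4 * d4 = 0"
    and sorted: "4 * a2 + 3 * b2 + 2 * c2 + d2 \<le> 4 * a1 + 3 * b1 + 2 * c1 + d1"
      "4 * a3 + 3 * b3 + 2 * c3 + d3 \<le> 4 * a2 + 3 * b2 + 2 * c2 + d2"
      "4 * a4 + 3 * b4 + 2 * c4 + d4 \<le> 4 * a3 + 3 * b3 + 2 * c3 + d3"
      "0 \<le> 4 * a4 + 3 * b4 + 2 * c4 + d4"
  shows "(a1, a2, a3, a4) = (1, 0, 0, 0) \<and> (b1, b2, b3, b4) = (0, 1, 0, 0) \<and>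
    (c1, c2, c3, c4) = (0, 0, 1, 0) \<and> (d1, d2, d3, d4) = (0, 0, 0, 1)"
proof -
  note u = unit_vector_int[OF unit(1)] unit_vector_int[OF unit(2)] unit_vector_int[OF unit(3)]
    unit_vector_int[OF unit(4)]
  note o = orthogonal_unit_vectors_int[OF unit(1) orth(1)] orthogonal_unit_vectors_int[OF unit(1) orth(2)]
    orthogonal_unit_vectors_int[OF unit(1) orth(3)] orthogonal_unit_vectors_int[OF unit(2) orth(4)]
    orthogonal_unit_vectors_int[OF unit(2) orth(5)] orthogonal_unit_vectors_int[OF unit(3) orth(6)]
  note u' = u[unfolded insert_iff empty_iff prod.inject]
  have "\<bar>3 * b1 + 2 * c1 + d1\<bar> \<le> 3" using o(4,5,6) u' by (smt (verit))
  with u'(1) o(1,2,3) sorted have a: "a1 = 1 \<and> a2 = 0 \<and> a3 = 0 \<and> a4 = 0" by (smt (verit))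
  then have 1: "b1 = 0 \<and> c1 = 0 \<and> d1 = 0" using o(1,2,3) by simp
  have "\<bar>2 * c2 + d2\<bar> \<le> 2" using o(6) u'(3,4) by (smt (verit))
  with u'(2) o(4,5) sorted a 1 have b: "b2 = 1 \<and> b3 = 0 \<and> b4 = 0" by (smt (verit))
  then have 2: "c2 = 0 \<and> d2 = 0" using o(4,5) by simp
  have "\<bar>d3\<bar> \<le> 1" using u'(4) by (smt (verit))
  with u'(3) o(6) sorted a b 1 2 have c: "c3 = 1 \<and> c4 = 0" by (smt (verit))
  then have 3: "d3 = 0" using o(6) by simp
  with u'(4) sorted a b c 1 2 have d: "d4 = 1" by (smt (verit))
  show ?thesis using a b c d 1 2 3 by simp
qed

text \<open>A fixed coordinate of value 4 is put in front; the bound 4 on the next entry keeps the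
  whole sequence sorted.\<close>

lemma signed_permutation_sorted_3:
  fixes b2 b3 b4 c2 c3 c4 d2 d3 d4 :: int
  assumes unit: "b2 * b2 + b3 * b3 + b4 * b4 = 1" "c2 * c2 + c3 * c3 + c4 * c4 = 1"
      "d2 * d2 + d3 * d3 + d4 * d4 = 1"
    and orth: "b2 * c2 + b3 * c3 + b4 * c4 = 0" "b2 * d2 + b3 * d3 + b4 * d4 = 0"
      "c2 * d2 + c3 * d3 + c4 * d4 = 0"
    and sorted: "3 * b3 + 2 * c3 + d3 \<le> 3 * b2 + 2 * c2 + d2"
      "3 * b4 + 2 * c4 + d4 \<le> 3 * b3 + 2 * c3 + d3"
      "0 \<le> 3 * b4 + 2 * c4 + d4"
  shows "(b2, b3, b4) = (1, 0, 0) \<and> (c2, c3, c4) = (0, 1, 0) \<and> (d2, d3, d4) = (0, 0, 1)"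
proof -
  have u: "b2 * b2 + b3 * b3 + b4 * b4 + 0 * 0 = 1" "c2 * c2 + c3 * c3 + c4 * c4 + 0 * 0 = 1"
      "d2 * d2 + d3 * d3 + d4 * d4 + 0 * 0 = 1" using unit by auto
  have "b2 = 0 \<or> c2 = 0" "b2 = 0 \<or> d2 = 0" "c2 = 0 \<or> d2 = 0"
    using orthogonal_unit_vectors_int[OF u(1), of c2 c3 c4 0] orthogonal_unit_vectors_int[OF u(1), of d2 d3
      d4 0]
      orthogonal_unit_vectors_int[OF u(2), of d2 d3 d4 0] orth by auto
  moreover have "\<bar>b2\<bar> \<le> 1" "\<bar>c2\<bar> \<le> 1" "\<bar>d2\<bar> \<le> 1"
    using unit_vector_int[OF u(1)] unit_vector_int[OF u(2)] unit_vector_int[OF u(3)] by auto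
  ultimately have "3 * b2 + 2 * c2 + d2 \<le> 4" by linarith
  then show ?thesis
    using signed_permutation_sorted[of 1 0 0 0 0 b2 b3 b4 0 c2 c3 c4 0 d2 d3 d4] assms by simp
qed

lemma signed_permutation_sorted_2:
  fixes c3 c4 d3 d4 :: int
  assumes unit: "c3 * c3 + c4 * c4 = 1" "d3 * d3 + d4 * d4 = 1"
    and orth: "c3 * d3 + c4 * d4 = 0"
    and sorted: "2 * c4 + d4 \<le> 2 * c3 + d3" "0 \<le> 2 * c4 + d4"
  shows "(c3, c4) = (1, 0) \<and> (d3, d4) = (0, 1)"
proof -
  have u: "c3 * c3 + c4 * c4 + 0 * 0 + 0 * 0 = 1" "d3 * d3 + d4 * d4 + 0 * 0 + 0 * 0 = 1"
    using unit by auto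
  have "\<bar>c3\<bar> \<le> 1" "\<bar>d3\<bar> \<le> 1" using unit_vector_int[OF u(1)] unit_vector_int[OF
    u(2)] by auto
  then have "2 * c3 + d3 \<le> 3" by linarith
  then show ?thesis
    using signed_permutation_sorted_3[of 1 0 0 0 c3 c4 0 d3 d4] assms by simp
qed

text \<open>Three orthonormal integral vectors are the coordinate vectors up to sign and order. This
  clears the entries of the columns of norm 3 in the coordinates of weight 1.\<close>

lemma orthonormal_complete_int:
  fixes a1 a2 a3 b1 b2 b3 c1 c2 c3 d1 d2 d3 :: int
  assumes unit: "a1 * a1 + a2 * a2 + a3 * a3 = 1" "b1 * b1 + b2 * b2 + b3 * b3 = 1"
    "c1 * c1 + c2 * c2 + c3 * c3 = 1"
    and orth: "a1 * b1 + a2 * b2 + a3 * b3 = 0" "a1 * c1 + a2 * c2 + a3 * c3 = 0"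
      "b1 * c1 + b2 * c2 + b3 * c3 = 0"
    and d: "a1 * d1 + a2 * d2 + a3 * d3 = 0" "b1 * d1 + b2 * d2 + b3 * d3 = 0" "c1 * d1 + c2 * d2 + c3 * d3 = 0"
  shows "d1 = 0 \<and> d2 = 0 \<and> d3 = 0"
proof -
  have u: "a1 * a1 + a2 * a2 + a3 * a3 + 0 * 0 = 1" "b1 * b1 + b2 * b2 + b3 * b3 + 0 * 0 = 1"
    "c1 * c1 + c2 * c2 + c3 * c3 + 0 * 0 = 1" using unit by auto
  have o: "a1 = 0 \<or> b1 = 0" "a2 = 0 \<or> b2 = 0" "a3 = 0 \<or> b3 = 0" "a1 = 0 \<or> c1 = 0"
    "a2 = 0 \<or> c2 = 0"
    "a3 = 0 \<or> c3 = 0" "b1 = 0 \<or> c1 = 0" "b2 = 0 \<or> c2 = 0" "b3 = 0 \<or> c3 = 0"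
    using orthogonal_unit_vectors_int[OF u(1), of b1 b2 b3 0] orthogonal_unit_vectors_int[OF u(1), of c1 c2
      c3 0]
      orthogonal_unit_vectors_int[OF u(2), of c1 c2 c3 0] orth by auto
  have e: "(a1 = 0 \<or> d1 = 0) \<and> (a2 = 0 \<or> d2 = 0) \<and> (a3 = 0 \<or> d3 = 0)"
    "(b1 = 0 \<or> d1 = 0) \<and> (b2 = 0 \<or> d2 = 0) \<and> (b3 = 0 \<or> d3 = 0)"
    "(c1 = 0 \<or> d1 = 0) \<and> (c2 = 0 \<or> d2 = 0) \<and> (c3 = 0 \<or> d3 = 0)"
    using orthogonal_unit_vectors_int[OF u(1), of d1 d2 d3 0] orthogonal_unit_vectors_int[OF u(2), of d1 d2
      d3 0]
      orthogonal_unit_vectors_int[OF u(3), of d1 d2 d3 0] d by auto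
  show ?thesis
    using o e unit_vector_int[OF u(1)] unit_vector_int[OF u(2)] unit_vector_int[OF u(3)]
    unfolding insert_iff empty_iff prod.inject by (smt (verit))
qed

section \<open>The simple roots in real coordinates\<close>

definition rts :: "nat \<Rightarrow> r5 list" where
  "rts j = (if j = 0 then
     [(0, 1, - 1, 0, 0), (0, 0, 1, - 1, 0), (0, 0, 0, 1, - 1), (0, 0, 0, 0, 1), 
      (1, - 1, - 1, - 1, 0)]
   else if j = 1 then
     [(0, 1, - 1, 0, 0), (0, 0, 1, - 1, 0), (0, 0, 0, 1, 0), (0, 0, 0, 0, 1), 
      (1, 0, 0, 0, - 1), (1, - 1, - 1, - 1, 0), (3, - 3, 0, 0, - 1)]
   else if j = 2 then
     [(0, 1, - 1, 0, 0), (0, 0, 1, 0, 0), (0, 0, 0, - 1, 1), (0, 0, 0, 1, 0), 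
      (1, 0, 0, 0, - 1), (1, - 1, - 1, 0, 0), (3, - 3, 0, - 1, - 1)]
   else if j = 3 then
     [(0, 1, 0, 0, 0), (0, 0, 0, - 1, 1), (0, 0, - 1, 1, 0), (0, 0, 1, 0, 0), 
      (1, 0, 0, 0, - 1), (3, - 3, 0, - 1, - 1), (3, - 1, - 1, - 1, - 1)]
   else
     [(0, 0, 0, - 1, 1), (0, 0, - 1, 1, 0), (0, - 1, 1, 0, 0), (0, 1, 0, 0, 0), 
      (1, 0, 0, 0, - 1), (3, - 1, - 1, - 1, - 1)])"

abbreviation "alpha j i \<equiv> rts j ! i"

text \<open>An integral vector in the interior of the chamber.\<close>

definition p5 :: "nat \<Rightarrow> r5" where
  "p5 j = (if j = 0 then (10, - 4, - 3, - 2, - 1) else if j = 1 then (7, - 3, - 2, - 1, - 1) else if j = 2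
    then (7, - 2, - 1, - 1, - 2) else if j = 3 then (10, - 1, - 1, - 2, - 3) else (13, - 1, - 2, - 3, - 4))"

text \<open>The diagram automorphism for \<open>j = 1\<close> and for \<open>j = 2\<close>; it is given by
  the same matrix in both cases.\<close>

fun dg :: "r5 \<Rightarrow> r5" where
  "dg (x0, x1, x2, x3, x4) = (3 * x0 + 2 * x1 + x2 + 3 * x4, - 2 * x0 - x1 - x2 - 3 * x4,
     - x0 - x1 - x2, x3, - x0 - x1 - x4)"

lemma le_4_cases:
  assumes "(j::nat) \<le> 4"
  obtains "j = 0" | "j = 1" | "j = 2" | "j = 3" | "j = 4"
  using assms by linarith

lemma length_rts: "4 \<le> length (rts j)"
  by (simp add: rts_def)

lemma rts_norm:
  assumes "j \<le> 4" "r \<in> set (rts j)"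
  shows "bf j r r \<in> {1, 2, 3, 6}"
  using assms by (cases rule: le_4_cases) (auto simp: rts_def wt_def)

lemma alpha_norm:
  assumes "j \<le> 4" "i < length (rts j)"
  shows "0 < bf j (alpha j i) (alpha j i)"
  using rts_norm[OF assms(1), of "alpha j i"] assms(2) by auto

lemma alpha_pair:
  assumes "j \<le> 4" "i < length (rts j)" "k < length (rts j)" "i \<noteq> k"
  defines "c \<equiv> cartan_product (bf j) (alpha j i) (alpha j k)"
  shows "bf j (alpha j i) (alpha j k) \<le> 0" "c \<in> {0, 1, 2, 3} \<or> 4 \<le> c"
proof -
  define P where "P a b \<longleftrightarrow> bf j a b \<le> 0 \<and>
    (cartan_product (bf j) a b \<in> {0, 1, 2, 3} \<or> 4 \<le> cartan_product (bf j) a b)" for a b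
  have "sorted_wrt P (rts j)"
    using assms(1) by (cases rule: le_4_cases) (simp_all add: rts_def P_def wt_def)
  then have lt: "P (alpha j a) (alpha j b)" if "a < b" "b < length (rts j)" for a b
    using that by (auto simp: sorted_wrt_iff_nth_less)
  have "P a b \<Longrightarrow> P b a" for a b
    by (simp add: P_def bf.B_sym[of j b a] mult.commute)
  then have "P (alpha j i) (alpha j k)" using lt[of i k] lt[of k i] assms by (cases i k rule:
    linorder_cases) auto
  then show "bf j (alpha j i) (alpha j k) \<le> 0" "c \<in> {0, 1, 2, 3} \<or> 4 \<le> c" by (auto simp:
    P_def c_def)
qed

lemma p5_alpha: "j \<le> 4 \<Longrightarrow> r \<in> set (rts j) \<Longrightarrow> bf j (p5 j) r < 0"
  by (erule le_4_cases) (auto simp: rts_def wt_def p5_def)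

lemma p5_integral: "integral5 (p5 j)"
  by (simp add: p5_def)

lemma p5_future: "j \<le> 4 \<Longrightarrow> future j (p5 j)"
  by (erule le_4_cases) (auto simp: future_def wt_def p5_def)

text \<open>The roots of norm 3 and 6 have all their products with integral vectors divisible by 3,
  so the coefficient of the root is always an integer.\<close>

lemma integral_refl:
  assumes "j \<le> 4" "r \<in> set (rts j)" "integral5 x"
  shows "integral5 (reflect (bf j) r x)"
proof -
  obtain x0 x1 x2 x3 x4 where x: "x = (x0, x1, x2, x3, x4)" by (cases x) auto
  show ?thesis using assms
    by (cases rule: le_4_cases)
      (auto simp: x rts_def wt_def reflect_def diff_divide_distrib add_divide_distrib algebra_simps
        intro!: Ints_add Ints_diff Ints_mult)
qed

lemma linear_dg: "linear dg"
  by (rule linearI) (auto simp: algebra_simps)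

lemma dg_dg [simp]: "dg (dg x) = x"
  by (cases x) (auto simp: algebra_simps)

lemma bf_dg: "j = 1 \<or> j = 2 \<Longrightarrow> bf j (dg x) (dg y) = bf j x y"
  by (cases x; cases y) (auto simp: wt_def algebra_simps)

text \<open>Counting from one, \<open>dg\<close> exchanges the roots 1 and 5, 2 and 6, 4 and 7 and
  fixes the third if \<open>j = 1\<close>; it exchanges 1 and 5, 2 and 6, 3 and 7 and fixes the
  fourth if \<open>j = 2\<close>.\<close>

lemma dg_rts: "j = 1 \<or> j = 2 \<Longrightarrow> r \<in> set (rts j) \<Longrightarrow> dg r \<in> set (rts j)"
  by (auto simp: rts_def)

lemma integral_dg: "integral5 x \<Longrightarrow> integral5 (dg x)"
  by (cases x) auto

lemma future_dg:
  assumes "j = 1 \<or> j = 2" "future j x"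
  shows "future j (dg x)"
proof -
  let ?e = "(1, 0, 0, 0, 0) :: r5"
  have neg: "bf j (dg x) (dg x) < 0" "bf j (dg ?e) (dg ?e) < 0" using assms
    by (auto simp: bf_dg future_def simp del: dg.simps)
  have "bf j (dg x) (dg ?e) < 0" using assms future_bf[of j x ?e] by (simp add: bf_dg future_def del: dg.simps)
  then have "0 < fst (dg x) * fst (dg ?e)" using negative_same_sign[OF neg] by blast
  then show ?thesis using neg by (simp add: future_def)
qed

lemma norm_minus_1_chamber:
  assumes "j \<le> 4" "integral5 v" "bf j v v = -1" and le: "\<And>r. r \<in> set (rts j) \<Longrightarrow>
    bf j v r \<le> 0"
  shows "v = (1, 0, 0, 0, 0) \<or> (j = 1 \<or> j = 2) \<and> v = dg (1, 0, 0, 0, 0) \<or> j = 2 \<and> v =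
    (3, - 1, - 1, - 1, - 1)"
proof -
  obtain v0 v1 v2 v3 v4 where v: "v = (v0, v1, v2, v3, v4)" by (cases v) auto
  then have "v0 \<in> \<int>" "- v1 \<in> \<int>" "- v2 \<in> \<int>" "- v3 \<in> \<int>"
    "- v4 \<in> \<int>" using assms by auto
  then obtain x y1 y2 y3 y4 where "v0 = real_of_int x" "- v1 = real_of_int y1" "- v2 = real_of_int y2"
      "- v3 = real_of_int y3" "- v4 = real_of_int y4"
    unfolding Ints_def by blast
  then have vi: "v = (real_of_int x, - of_int y1, - of_int y2, - of_int y3, - of_int y4)"
    by (auto simp: v minus_equation_iff)
  have L: "\<forall>r\<in>set (rts j). bf j v r \<le> 0" using le by blast
  show ?thesis using assms(1)
  proof (cases rule: le_4_cases)
    case 1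
    have "real_of_int (y2) \<le> of_int (y1)"
      "real_of_int (y3) \<le> of_int (y2)"
      "real_of_int (y4) \<le> of_int (y3)"
      "real_of_int (0) \<le> of_int (y4)"
      "real_of_int (y1 + y2 + y3) \<le> of_int (x)"
      using L by (simp_all add: vi \<open>j = 0\<close> rts_def wt_def)
    moreover have "real_of_int (x * x - (y1 * y1 + y2 * y2 + y3 * y3 + y4 * y4)) = real_of_int 1"
      using assms(3) by (simp add: vi \<open>j = 0\<close> wt_def)
    ultimately show ?thesis unfolding of_int_le_iff of_int_eq_iff
      using norm_minus_1_chamber_0[of y2 y1 y3 y4 x] by (auto simp: vi \<open>j = 0\<close>)
  next
    case 2
    have "real_of_int (y2) \<le> of_int (y1)"
      "real_of_int (y3) \<le> of_int (y2)"
      "real_of_int (0) \<le> of_int (y3)"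
      "real_of_int (0) \<le> of_int (y4)"
      "real_of_int (3 * y4) \<le> of_int (x)"
      "real_of_int (y1 + y2 + y3) \<le> of_int (x)"
      "real_of_int (y1 + y4) \<le> of_int (x)"
      using L by (simp_all add: vi \<open>j = 1\<close> rts_def wt_def)
    moreover have "real_of_int (x * x - (y1 * y1 + y2 * y2 + y3 * y3 + 3 * (y4 * y4))) = real_of_int 1"
      using assms(3) by (simp add: vi \<open>j = 1\<close> wt_def)
    ultimately show ?thesis unfolding of_int_le_iff of_int_eq_iff
      using norm_minus_1_chamber_1[of y2 y1 y3 y4 x] by (auto simp: vi \<open>j = 1\<close>)
  next
    case 3
    have "real_of_int (y2) \<le> of_int (y1)"
      "real_of_int (0) \<le> of_int (y2)"
      "real_of_int (y3) \<le> of_int (y4)"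
      "real_of_int (0) \<le> of_int (y3)"
      "real_of_int (3 * y4) \<le> of_int (x)"
      "real_of_int (y1 + y2) \<le> of_int (x)"
      "real_of_int (y1 + y3 + y4) \<le> of_int (x)"
      using L by (simp_all add: vi \<open>j = 2\<close> rts_def wt_def)
    moreover have "real_of_int (x * x - (y1 * y1 + y2 * y2 + 3 * (y3 * y3) + 3 * (y4 * y4))) = real_of_int 1"
      using assms(3) by (simp add: vi \<open>j = 2\<close> wt_def)
    ultimately show ?thesis unfolding of_int_le_iff of_int_eq_iff
      using norm_minus_1_chamber_2[of y2 y1 y3 y4 x] by (auto simp: vi \<open>j = 2\<close>)
  next
    case 4
    have "real_of_int (0) \<le> of_int (y1)"
      "real_of_int (y3) \<le> of_int (y4)"
      "real_of_int (y2) \<le> of_int (y3)"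
      "real_of_int (0) \<le> of_int (y2)"
      "real_of_int (3 * y4) \<le> of_int (x)"
      "real_of_int (y1 + y3 + y4) \<le> of_int (x)"
      "real_of_int (y1 + 3 * y2 + 3 * y3 + 3 * y4) \<le> of_int (3 * x)"
      using L by (simp_all add: vi \<open>j = 3\<close> rts_def wt_def)
    moreover have "real_of_int (x * x - (y1 * y1 + 3 * (y2 * y2) + 3 * (y3 * y3) + 3 * (y4 * y4))) =
      real_of_int 1"
      using assms(3) by (simp add: vi \<open>j = 3\<close> wt_def)
    ultimately show ?thesis unfolding of_int_le_iff of_int_eq_iff
      using norm_minus_1_chamber_3[of y1 y3 y4 y2 x] by (auto simp: vi \<open>j = 3\<close>)
  next
    case 5
    have "real_of_int (y3) \<le> of_int (y4)"
      "real_of_int (y2) \<le> of_int (y3)"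
      "real_of_int (y1) \<le> of_int (y2)"
      "real_of_int (0) \<le> of_int (y1)"
      "real_of_int (3 * y4) \<le> of_int (x)"
      "real_of_int (y1 + y2 + y3 + y4) \<le> of_int (x)"
      using L by (simp_all add: vi \<open>j = 4\<close> rts_def wt_def)
    moreover have "real_of_int (x * x - (3 * (y1 * y1) + 3 * (y2 * y2) + 3 * (y3 * y3) + 3 * (y4 * y4))) =
      real_of_int 1"
      using assms(3) by (simp add: vi \<open>j = 4\<close> wt_def)
    ultimately show ?thesis unfolding of_int_le_iff of_int_eq_iff
      using norm_minus_1_chamber_4[of y3 y4 y2 y1 x] by (auto simp: vi \<open>j = 4\<close>)
  qed
qed

text \<open>The extra vector is characteristic modulo 2, so its orthogonal complement is an even
  lattice.\<close>

lemma characteristic_vector_excluded: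
  assumes "integral5 z" "bf 2 z (3, - 1, - 1, - 1, - 1) = 0"
  shows "bf 2 z z \<noteq> 1"
proof
  assume 1: "bf 2 z z = 1"
  obtain v0 v1 v2 v3 v4 where v: "z = (v0, v1, v2, v3, v4)" by (cases z) auto
  then have "v0 \<in> \<int>" "v1 \<in> \<int>" "v2 \<in> \<int>" "v3 \<in> \<int>"
    "v4 \<in> \<int>" using assms by auto
  then obtain a b c d e where i: "v0 = real_of_int a" "v1 = real_of_int b" "v2 = real_of_int c"
      "v3 = real_of_int d" "v4 = real_of_int e"
    unfolding Ints_def by blast
  have "real_of_int (b * b + c * c + 3 * (d * d) + 3 * (e * e) - a * a) = real_of_int 1"
    using 1 by (simp add: v i wt_def)
  then have s: "b * b + c * c + 3 * (d * d) + 3 * (e * e) - a * a = 1" unfolding of_int_eq_iff .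
  have "real_of_int (3 * a + b + c + 3 * d + 3 * e) = real_of_int 0"
    using assms(2) by (simp add: v i wt_def)
  then have t: "3 * a + b + c + 3 * d + 3 * e = 0" unfolding of_int_eq_iff .
  have "even (b * b + c * c + 3 * (d * d) + 3 * (e * e) - a * a) = even (3 * a + b + c + 3 * d + 3 * e)"
    by auto
  then show False unfolding s t by simp
qed

text \<open>The lattice automorphisms fixing \<open>(1, 0, 0, 0, 0)\<close> are signed permutations of the
  remaining coordinates.\<close>

lemma stabilizer_trivial:
  assumes j: "j \<le> 4" and lin: "linear G" and iso: "\<And>x y. bf j (G x) (G y) = bf j x y"
    and int: "\<And>x. integral5 x \<Longrightarrow> integral5 (G x)" and Ge0:
      "G (1, 0, 0, 0, 0) = (1, 0, 0, 0, 0)"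
    and sorted: "\<And>i. i < 4 \<Longrightarrow> bf j (G (p5 j)) (alpha j i) \<le> 0"
  shows "G = id"
proof -
  have col: "\<exists>a1 a2 a3 a4. G x = (0, of_int a1, of_int a2, of_int a3, of_int a4)"
    if "integral5 x" "bf j x (1, 0, 0, 0, 0) = 0" for x
  proof -
    obtain v0 v1 v2 v3 v4 where v: "G x = (v0, v1, v2, v3, v4)" by (cases "G x") auto
    then have "v1 \<in> \<int>" "v2 \<in> \<int>" "v3 \<in> \<int>"
      "v4 \<in> \<int>" using int[OF that(1)] by auto
    moreover have "v0 = 0" using iso[of x "(1, 0, 0, 0, 0)"] that(2) Ge0 v by simp
    ultimately show ?thesis using v unfolding Ints_def by blast
  qed
  obtain a1 a2 a3 a4 where a: "G (0, 1, 0, 0, 0) = (0, of_int a1, of_int a2, of_int a3, of_int a4)"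
    using col[of "(0, 1, 0, 0, 0)"] by auto
  obtain b1 b2 b3 b4 where b: "G (0, 0, 1, 0, 0) = (0, of_int b1, of_int b2, of_int b3, of_int b4)"
    using col[of "(0, 0, 1, 0, 0)"] by auto
  obtain c1 c2 c3 c4 where c: "G (0, 0, 0, 1, 0) = (0, of_int c1, of_int c2, of_int c3, of_int c4)"
    using col[of "(0, 0, 0, 1, 0)"] by auto
  obtain d1 d2 d3 d4 where d: "G (0, 0, 0, 0, 1) = (0, of_int d1, of_int d2, of_int d3, of_int d4)"
    using col[of "(0, 0, 0, 0, 1)"] by auto
  have Gx: "G (x0, x1, x2, x3, x4) =
      x0 *\<^sub>R (1, 0, 0, 0, 0) + x1 *\<^sub>R (0, of_int a1, of_int a2, of_int a3, of_int a4) +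
      x2 *\<^sub>R (0, of_int b1, of_int b2, of_int b3, of_int b4) +
      x3 *\<^sub>R (0, of_int c1, of_int c2, of_int c3, of_int c4) +
      x4 *\<^sub>R (0, of_int d1, of_int d2, of_int d3, of_int d4)" for x0 x1 x2 x3 x4
  proof -
    have "(x0, x1, x2, x3, x4) = x0 *\<^sub>R (1, 0, 0, 0, 0) + x1 *\<^sub>R (0, 1, 0, 0, 0) + x2 *\<^sub>R
      (0, 0, 1, 0, 0) +
      x3 *\<^sub>R (0, 0, 0, 1, 0) + x4 *\<^sub>R (0, 0, 0, 0, 1 :: real)" by simp
    then show ?thesis
      by (simp only: linear_add[OF lin] linear_scale[OF lin] a b c d Ge0)
  qed
  define k :: "nat \<Rightarrow> int" where "k i = (if 5 \<le> i + j then 3 else 1)" for i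
  have wk: "wt j i = of_int (k i)" for i by (simp add: wt_def k_def)
  have gram: "real_of_int (k 1 * (a1 * a1) + k 2 * (a2 * a2) + k 3 * (a3 * a3) + k 4 * (a4 * a4)) = of_int
    (k 1)"
    "real_of_int (k 1 * (a1 * b1) + k 2 * (a2 * b2) + k 3 * (a3 * b3) + k 4 * (a4 * b4)) = of_int 0"
    "real_of_int (k 1 * (a1 * c1) + k 2 * (a2 * c2) + k 3 * (a3 * c3) + k 4 * (a4 * c4)) = of_int 0"
    "real_of_int (k 1 * (a1 * d1) + k 2 * (a2 * d2) + k 3 * (a3 * d3) + k 4 * (a4 * d4)) = of_int 0"
    "real_of_int (k 1 * (b1 * b1) + k 2 * (b2 * b2) + k 3 * (b3 * b3) + k 4 * (b4 * b4)) = of_int (k 2)"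
    "real_of_int (k 1 * (b1 * c1) + k 2 * (b2 * c2) + k 3 * (b3 * c3) + k 4 * (b4 * c4)) = of_int 0"
    "real_of_int (k 1 * (b1 * d1) + k 2 * (b2 * d2) + k 3 * (b3 * d3) + k 4 * (b4 * d4)) = of_int 0"
    "real_of_int (k 1 * (c1 * c1) + k 2 * (c2 * c2) + k 3 * (c3 * c3) + k 4 * (c4 * c4)) = of_int (k 3)"
    "real_of_int (k 1 * (c1 * d1) + k 2 * (c2 * d2) + k 3 * (c3 * d3) + k 4 * (c4 * d4)) = of_int 0"
    "real_of_int (k 1 * (d1 * d1) + k 2 * (d2 * d2) + k 3 * (d3 * d3) + k 4 * (d4 * d4)) = of_int (k 4)"
    using iso[of "(0, 1, 0, 0, 0)" "(0, 1, 0, 0, 0)"]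
      iso[of "(0, 1, 0, 0, 0)" "(0, 0, 1, 0, 0)"]
      iso[of "(0, 1, 0, 0, 0)" "(0, 0, 0, 1, 0)"]
      iso[of "(0, 1, 0, 0, 0)" "(0, 0, 0, 0, 1)"]
      iso[of "(0, 0, 1, 0, 0)" "(0, 0, 1, 0, 0)"]
      iso[of "(0, 0, 1, 0, 0)" "(0, 0, 0, 1, 0)"]
      iso[of "(0, 0, 1, 0, 0)" "(0, 0, 0, 0, 1)"]
      iso[of "(0, 0, 0, 1, 0)" "(0, 0, 0, 1, 0)"]
      iso[of "(0, 0, 0, 1, 0)" "(0, 0, 0, 0, 1)"]
      iso[of "(0, 0, 0, 0, 1)" "(0, 0, 0, 0, 1)"]
    by (simp_all add: a b c d wk)
  note gram = gram[unfolded of_int_eq_iff]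
  have sq: "z = 0 \<or> 1 \<le> z * z" for z :: int
    using mult_mono[of 1 "\<bar>z\<bar>" 1 "\<bar>z\<bar>"] by (cases "z = 0") auto
  have nn: "0 \<le> z * z" for z :: int by simp
  note srt = sorted[of 0] sorted[of 1] sorted[of 2] sorted[of 3]
  have "(a1, a2, a3, a4) = (1, 0, 0, 0) \<and> (b1, b2, b3, b4) = (0, 1, 0, 0) \<and>
    (c1, c2, c3, c4) = (0, 0, 1, 0) \<and> (d1, d2, d3, d4) = (0, 0, 0, 1)"
    using j
  proof (cases rule: le_4_cases)
    case 1
    have k: "k 1 = 1" "k 2 = 1" "k 3 = 1" "k 4 = 1" using \<open>j = 0\<close> by (simp_all add: k_def)
    note G = gram[unfolded k]
    have "real_of_int (4 * a2 + 3 * b2 + 2 * c2 + d2) \<le> of_int (4 * a1 + 3 * b1 + 2 * c1 + d1)"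
      "real_of_int (4 * a3 + 3 * b3 + 2 * c3 + d3) \<le> of_int (4 * a2 + 3 * b2 + 2 * c2 + d2)"
      "real_of_int (4 * a4 + 3 * b4 + 2 * c4 + d4) \<le> of_int (4 * a3 + 3 * b3 + 2 * c3 + d3)"
      "real_of_int (0) \<le> of_int (4 * a4 + 3 * b4 + 2 * c4 + d4)"
      using srt by (simp_all add: Gx \<open>j = 0\<close> rts_def wt_def p5_def)
    note s = this[unfolded of_int_le_iff]
    show ?thesis using signed_permutation_sorted[of a1 a2 a3 a4 b1 b2 b3 b4 c1 c2 c3 c4 d1 d2 d3 d4] G s by simp
  next
    case 2
    have k: "k 1 = 1" "k 2 = 1" "k 3 = 1" "k 4 = 3" using \<open>j = 1\<close> by (simp_all add: k_def)
    note G = gram[unfolded k]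
    have "real_of_int (3 * a2 + 2 * b2 + c2 + d2) \<le> of_int (3 * a1 + 2 * b1 + c1 + d1)"
      "real_of_int (3 * a3 + 2 * b3 + c3 + d3) \<le> of_int (3 * a2 + 2 * b2 + c2 + d2)"
      "real_of_int (0) \<le> of_int (3 * a3 + 2 * b3 + c3 + d3)"
      "real_of_int (0) \<le> of_int (3 * a4 + 2 * b4 + c4 + d4)"
      using srt by (simp_all add: Gx \<open>j = 1\<close> rts_def wt_def p5_def)
    note s = this[unfolded of_int_le_iff]
    \<comment> \<open>A column of norm 1 has no room for a component in the coordinate of weight
      3.\<close>
    have z: "a4 = 0" "b4 = 0" "c4 = 0"
      using G(1,5,8) sq[of a4] sq[of b4] sq[of c4] nn[of a1] nn[of a2] nn[of a3] nn[of b1] nn[of b2] nn[of b3]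
        nn[of c1] nn[of c2] nn[of c3] by linarith+
    have d: "d1 = 0" "d2 = 0" "d3 = 0"
      using orthonormal_complete_int[of a1 a2 a3 b1 b2 b3 c1 c2 c3 d1 d2 d3] G z by simp_all
    have abc: "(a1, a2, a3) = (1, 0, 0) \<and> (b1, b2, b3) = (0, 1, 0) \<and> (c1, c2, c3) = (0, 0, 1)"
      using signed_permutation_sorted_3[of a1 a2 a3 b1 b2 b3 c1 c2 c3] G s z d by simp
    then have "d4 * d4 = 1" using G d by simp
    then show ?thesis using abc d z s by (auto simp: zmult_eq_1_iff)
  next
    case 3
    have k: "k 1 = 1" "k 2 = 1" "k 3 = 3" "k 4 = 3" using \<open>j = 2\<close> by (simp_all add: k_def)
    note G = gram[unfolded k]
    have "real_of_int (2 * a2 + b2 + c2 + 2 * d2) \<le> of_int (2 * a1 + b1 + c1 + 2 * d1)"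
      "real_of_int (0) \<le> of_int (2 * a2 + b2 + c2 + 2 * d2)"
      "real_of_int (2 * a3 + b3 + c3 + 2 * d3) \<le> of_int (2 * a4 + b4 + c4 + 2 * d4)"
      "real_of_int (0) \<le> of_int (2 * a3 + b3 + c3 + 2 * d3)"
      using srt by (simp_all add: Gx \<open>j = 2\<close> rts_def wt_def p5_def)
    note s = this[unfolded of_int_le_iff]
    have z: "a3 = 0" "a4 = 0" "b3 = 0" "b4 = 0"
      using G(1,5) sq[of a4] sq[of b4] sq[of a3] sq[of b3] nn[of a1] nn[of a2] nn[of b1] nn[of b2]
        nn[of a3] nn[of a4] nn[of b3] nn[of b4] by linarith+
    have cd: "c1 = 0" "c2 = 0" "d1 = 0" "d2 = 0"
      using orthonormal_complete_int[of 1 0 0 0 a1 a2 0 b1 b2 0 c1 c2]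
        orthonormal_complete_int[of 1 0 0 0 a1 a2 0 b1 b2 0 d1 d2] G z by simp_all
    have ab: "(a1, a2) = (1, 0) \<and> (b1, b2) = (0, 1)"
      using signed_permutation_sorted_2[of a1 a2 b1 b2] G s z cd by simp
    \<comment> \<open>Among the coordinates of weight 3 the chamber puts the largest entry last, so
      rows and columns are read backwards.\<close>
    moreover have "(d4, d3) = (1, 0) \<and> (c4, c3) = (0, 1)"
      using signed_permutation_sorted_2[of d4 d3 c4 c3] G s z cd by (simp add: algebra_simps)
    ultimately show ?thesis using z cd by simp
  next
    case 4
    have k: "k 1 = 1" "k 2 = 3" "k 3 = 3" "k 4 = 3" using \<open>j = 3\<close> by (simp_all add: k_def)
    note G = gram[unfolded k]
    have "real_of_int (0) \<le> of_int (a1 + b1 + 2 * c1 + 3 * d1)"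
      "real_of_int (a3 + b3 + 2 * c3 + 3 * d3) \<le> of_int (a4 + b4 + 2 * c4 + 3 * d4)"
      "real_of_int (a2 + b2 + 2 * c2 + 3 * d2) \<le> of_int (a3 + b3 + 2 * c3 + 3 * d3)"
      "real_of_int (0) \<le> of_int (a2 + b2 + 2 * c2 + 3 * d2)"
      using srt by (simp_all add: Gx \<open>j = 3\<close> rts_def wt_def p5_def)
    note s = this[unfolded of_int_le_iff]
    have z: "a2 = 0" "a3 = 0" "a4 = 0"
      using G(1) sq[of a2] sq[of a3] sq[of a4] nn[of a1] nn[of a2] nn[of a3] nn[of a4] by linarith+
    then have a: "a1 * a1 = 1" "b1 = 0" "c1 = 0" "d1 = 0" using G by auto
    then have "a1 = 1" using s by (auto simp: zmult_eq_1_iff)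
    moreover have "(d4, d3, d2) = (1, 0, 0) \<and> (c4, c3, c2) = (0, 1, 0) \<and> (b4, b3, b2) = (0, 0, 1)"
      using signed_permutation_sorted_3[of d4 d3 d2 c4 c3 c2 b4 b3 b2] G s z a by (simp add: algebra_simps)
    ultimately show ?thesis using z a by simp
  next
    case 5
    have k: "k 1 = 3" "k 2 = 3" "k 3 = 3" "k 4 = 3" using \<open>j = 4\<close> by (simp_all add: k_def)
    note G = gram[unfolded k]
    have "real_of_int (a3 + 2 * b3 + 3 * c3 + 4 * d3) \<le> of_int (a4 + 2 * b4 + 3 * c4 + 4 * d4)"
      "real_of_int (a2 + 2 * b2 + 3 * c2 + 4 * d2) \<le> of_int (a3 + 2 * b3 + 3 * c3 + 4 * d3)"
      "real_of_int (a1 + 2 * b1 + 3 * c1 + 4 * d1) \<le> of_int (a2 + 2 * b2 + 3 * c2 + 4 * d2)"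
      "real_of_int (0) \<le> of_int (a1 + 2 * b1 + 3 * c1 + 4 * d1)"
      using srt by (simp_all add: Gx \<open>j = 4\<close> rts_def wt_def p5_def)
    note s = this[unfolded of_int_le_iff]
    show ?thesis using signed_permutation_sorted[of d4 d3 d2 d1 c4 c3 c2 c1 b4 b3 b2 b1 a4 a3 a2 a1] G s
      by (simp add: algebra_simps)
  qed
  then show ?thesis by (auto simp: Gx)
qed

section \<open>Automorphisms of the integral Lorentzian lattices\<close>

lemma bf_inner: "bf j x y = (- fst y, wt j 1 * fst (snd y), wt j 2 * fst (snd (snd y)),
    wt j 3 * fst (snd (snd (snd y))), wt j 4 * snd (snd (snd (snd y)))) \<bullet> x"
  by (cases x; cases y) (simp add: inner_prod_def algebra_simps)

lemma negligible_orthogonal: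
  assumes "y \<noteq> 0"
  shows "negligible {x. bf j x y = 0}"
proof -
  have "(- fst y, wt j 1 * fst (snd y), wt j 2 * fst (snd (snd y)),
    wt j 3 * fst (snd (snd (snd y))), wt j 4 * snd (snd (snd (snd y)))) \<noteq> 0"
    using assms by (cases y) (auto simp: wt_def zero_prod_def)
  then show ?thesis unfolding bf_inner by (intro negligible_hyperplane) blast
qed

lemma continuous_bf:
  "continuous_on UNIV f \<Longrightarrow> continuous_on UNIV g \<Longrightarrow> continuous_on UNIV
    (\<lambda>x. bf j (f x) (g x))"
  unfolding bf_inner by (intro continuous_intros)

text \<open>Applied with \<open>C\<close> the set of all translates of simple roots: a mirror that is not
  one of their mirrors
  contains a point in the interior of a chamber.\<close>

lemma generic_orthogonal_vector:
  assumes b: "0 < bf j b b" and "countable C" and C: "\<And>c t. c \<in> C \<Longrightarrow> c \<noteq> t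
    *\<^sub>R b"
  shows "\<exists>v. future j v \<and> bf j v b = 0 \<and> (\<forall>c\<in>C. bf j v c \<noteq> 0)"
proof -
  define pr where "pr x = x - (bf j x b / bf j b b) *\<^sub>R b" for x
  have prb: "bf j (pr x) b = 0" for x using b by (simp add: pr_def bf.B_simps)
  have adj: "bf j (pr x) c = bf j x (pr c)" for x c
    by (simp add: pr_def bf.B_simps bf.B_sym[of j b c])
  \<comment> \<open>The hyperplane orthogonal to \<open>b\<close> is itself a null set, so
    genericity is argued in the whole space: \<open>x\<close> varies in an open set and its
    projection \<open>pr x\<close> is the candidate.\<close>
  define U where "U = {x. bf j (pr x) (pr x) < 0}"
  have cpr: "continuous_on UNIV pr" unfolding pr_def divide_inverse
    by (intro continuous_intros continuous_bf)
  have "open U" unfolding U_def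
    by (intro open_Collect_less continuous_bf cpr continuous_intros)
  \<comment> \<open>This makes \<open>U\<close> nonempty: projecting away a vector of positive norm
    does not raise the norm.\<close>
  moreover have "bf j (pr (1, 0, 0, 0, 0)) (pr (1, 0, 0, 0, 0)) = - 1 - (bf j (1, 0, 0, 0, 0) b)\<^sup>2 /
    bf j b b"
  proof -
    have "bf j (1, 0, 0, 0, 0) (1, 0, 0, 0, 0) = - 1" by simp
    then show ?thesis unfolding adj using b
      by (simp add: pr_def bf.B_simps power2_eq_square bf.B_sym[of j b "(1, 0, 0, 0, 0)"] del: bf.simps)
  qed
  then have "bf j (pr (1, 0, 0, 0, 0)) (pr (1, 0, 0, 0, 0)) < 0"
    using b by (smt (verit) divide_nonneg_pos zero_le_power2)
  then have "(1, 0, 0, 0, 0) \<in> U" unfolding U_def by blast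
  ultimately have "\<not> negligible U" using open_not_negligible by blast
  moreover have "negligible (\<Union>c\<in>C. {x. bf j x (pr c) = 0})"
  proof (intro negligible_countable_Union)
    fix S assume "S \<in> (\<lambda>c. {x. bf j x (pr c) = 0}) ` C"
    then obtain c where c: "c \<in> C" "S = {x. bf j x (pr c) = 0}" by blast
    then have "pr c \<noteq> 0" using C[of c "bf j c b / bf j b b"] by (auto simp: pr_def)
    then show "negligible S" using c negligible_orthogonal by blast
  qed (use assms in auto)
  ultimately have "\<not> U \<subseteq> (\<Union>c\<in>C. {x. bf j x (pr c) = 0})"
    by (metis negligible_subset)
  then obtain x where x: "x \<in> U" "\<And>c. c \<in> C \<Longrightarrow> bf j x (pr c) \<noteq> 0"
    unfolding subset_iff UN_iff mem_Collect_eq by metis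
  define v where "v = (if 0 < fst (pr x) then pr x else - pr x)"
  have neg: "bf j (pr x) (pr x) < 0" using x by (simp add: U_def)
  then have "fst (pr x) \<noteq> 0"
    using negative_same_sign[OF neg neg] by auto
  then have "future j v" using neg by (auto simp: future_def v_def bf.B_simps)
  moreover have "bf j v b = 0" "\<forall>c\<in>C. bf j v c \<noteq> 0"
    using prb x(2) by (auto simp: v_def bf.B_simps adj)
  ultimately show ?thesis by blast
qed

text \<open>A reflection moves all vectors along one line, whereas \<open>dg\<close> moves
  \<open>(0, 0, 1, 0, 0)\<close> and \<open>(0, 0, 0, 0, 1)\<close> in independent
  directions.\<close>

lemma dg_not_refl: "dg \<noteq> reflect (bf j) b"
proof
  assume eq: "dg = reflect (bf j) b"
  obtain b0 b1 b2 b3 b4 where b: "b = (b0, b1, b2, b3, b4)" by (cases b) auto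
  have "\<exists>t. dg x = x - t *\<^sub>R b" for x unfolding eq reflect_def by blast
  from this[of "(0, 0, 1, 0, 0)"] this[of "(0, 0, 0, 0, 1)"] show False by (auto simp: b)
qed

section \<open>Automorphisms of the lattice as words in the simple reflections\<close>

locale chamber_rep =
  fixes j :: nat and R :: "nat list set"
  assumes j: "j \<le> 4" and rep: "refl_rep (length (rts j)) R (bf j) ((!) (rts j))"
begin

sublocale refl_rep "length (rts j)" R "bf j" "(!) (rts j)" by (rule rep)

abbreviation nr where "nr \<equiv> length (rts j)"

lemma norm_pos: "set w \<subseteq> {..<nr} \<Longrightarrow> i \<in> set w \<Longrightarrow> 0 < bf j
  (alpha j i) (alpha j i)"
  using alpha_norm[OF j, of i] by auto

lemma norm_nz: "set w \<subseteq> {..<nr} \<Longrightarrow> i \<in> set w \<Longrightarrow> bf j (alpha j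
  i) (alpha j i) \<noteq> 0"
  using norm_pos[of w i] by auto

lemma future_rho: "set w \<subseteq> {..<nr} \<Longrightarrow> future j x \<Longrightarrow> future j (rho w x)"
  by (rule future_refl_word) (auto intro: norm_pos)

lemma bf_rho: "set w \<subseteq> {..<nr} \<Longrightarrow> bf j (rho w x) (rho w y) = bf j x y"
  by (rule bf.B_refl_word) (auto dest: norm_nz)

lemma rho_rev: "set w \<subseteq> {..<nr} \<Longrightarrow> rho (rev w) (rho w x) = x"
  by (rule bf.refl_word_rev) (auto dest: norm_nz)

lemma rho_rev': "set w \<subseteq> {..<nr} \<Longrightarrow> rho w (rho (rev w) x) = x"
  using rho_rev[of "rev w" x] by simp

lemma bf_rho_adjoint: "set w \<subseteq> {..<nr} \<Longrightarrow> bf j (rho w x) y = bf j x (rho (rev w) y)"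
  using bf_rho[of w x "rho (rev w) y"] rho_rev' by simp

lemma integral_rho: "set w \<subseteq> {..<nr} \<Longrightarrow> integral5 x \<Longrightarrow> integral5
  (rho w x)"
  by (induction w) (auto intro: integral_refl[OF j])

lemma move_into_subchamber:
  assumes v: "future j v" and S: "S \<subseteq> {..<nr}"
  shows "\<exists>w. set w \<subseteq> S \<and> (\<forall>i\<in>S. bf j (rho w v) (alpha j i) \<le> 0)"
proof (rule move_into_chamber[OF S])
  show "bf j (p5 j) (alpha j i) < 0" if "i \<in> S" for i
    using p5_alpha[OF j, of "alpha j i"] that S by auto
  show "finite {q. (\<exists>w. set w \<subseteq> S \<and> q = rho w (p5 j)) \<and> - bf j v q \<le> K}" for K
  proof (rule finite_subset[OF subsetI finite_integral_future[OF v, of K]])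
    fix q assume "q \<in> {q. (\<exists>w. set w \<subseteq> S \<and> q = rho w (p5 j)) \<and> - bf j v q
      \<le> K}"
    then obtain w where w: "set w \<subseteq> {..<nr}" "q = rho w (p5 j)" "- bf j v q \<le> K" using S by blast
    then show "q \<in> {q. integral5 q \<and> future j q \<and> - bf j v q \<le> K}"
      using integral_rho[OF w(1) p5_integral] future_rho[OF w(1) p5_future[OF j]] by simp
  qed
qed

lemma exists_in_chamber: "future j v \<Longrightarrow> \<exists>w. set w \<subseteq> {..<nr} \<and> rho w v
  \<in> chamber"
  using move_into_subchamber[of v "{..<nr}"] by (auto simp: chamber_def)

lemma in_chamber_iff: "v \<in> chamber \<longleftrightarrow> (\<forall>r\<in>set (rts j). bf j v r \<le> 0)"
  unfolding chamber_def all_set_conv_all_nth by simp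

lemma dg_rho_commute:
  assumes d: "j = 1 \<or> j = 2" and w: "set w \<subseteq> {..<nr}"
  shows "\<exists>w'. set w' \<subseteq> {..<nr} \<and> (\<forall>x. dg (rho w x) = rho w' (dg x))"
  using w
proof (induction w)
  case Nil
  then show ?case by (intro exI[of _ "[]"]) simp
next
  case (Cons i w)
  then obtain w' where w': "set w' \<subseteq> {..<nr}" "\<And>x. dg (rho w x) = rho w' (dg x)" by auto
  have "dg (alpha j i) \<in> set (rts j)" using dg_rts[OF d, of "alpha j i"] Cons by auto
  then obtain k where k: "k < nr" "alpha j k = dg (alpha j i)" by (metis in_set_conv_nth)
  have "dg (reflect (bf j) (alpha j i) x) = reflect (bf j) (alpha j k) (dg x)" for x
    using bf.refl_conj[OF linear_dg linear_dg bf_dg[OF d] dg_dg, of "alpha j i" "dg x"] k by simp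
  then show ?case using w' k by (intro exI[of _ "k # w'"]) auto
qed

theorem lattice_automorphism:
  assumes lin: "linear G" and iso: "\<And>x y. bf j (G x) (G y) = bf j x y"
    and int: "\<And>x. integral5 x \<Longrightarrow> integral5 (G x)" and fut:
      "\<And>x. future j x \<Longrightarrow> future j (G x)"
  shows "\<exists>w. set w \<subseteq> {..<nr} \<and> (G = rho w \<or> (j = 1 \<or> j = 2) \<and> G = rho w
    \<circ> dg)"
proof -
  let ?e = "(1, 0, 0, 0, 0) :: r5"
  have e: "future j ?e" "integral5 ?e" "bf j ?e ?e = -1" by (auto simp: future_def)
  obtain w1 where w1: "set w1 \<subseteq> {..<nr}" "rho w1 (G ?e) \<in> chamber"
    using exists_in_chamber[OF fut[OF e(1)]] by blast
  \<comment> \<open>The first four roots are orthogonal to \<open>?e\<close>. Moving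
    \<open>H (p5 j)\<close> into their chamber therefore keeps \<open>?e\<close> fixed, and
    \<open>stabilizer_trivial\<close> applies to the composition.\<close>
  have *: "\<exists>w. set w \<subseteq> {..<nr} \<and> (\<forall>x. H x = rho w x)"
    if lin: "linear H" and iso: "\<And>x y. bf j (H x) (H y) = bf j x y"
      and int: "\<And>x. integral5 x \<Longrightarrow> integral5 (H x)" and fut:
        "\<And>x. future j x \<Longrightarrow> future j (H x)"
      and He: "H ?e = ?e" for H
  proof -
    have four: "{..<4} \<subseteq> {..<nr}" using length_rts[of j] by auto
    obtain w where w: "set w \<subseteq> {..<4}" "\<forall>i\<in>{..<4}. bf j (rho w (H (p5 j))) (alpha j
      i) \<le> 0"
      using move_into_subchamber[OF fut[OF p5_future[OF j]] four] by blast
    have wn: "set w \<subseteq> {..<nr}" using w four by auto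
    have "bf j ?e (alpha j i) = 0" if "i < 4" for i
    proof -
      have "i = 0 \<or> i = 1 \<or> i = 2 \<or> i = 3" using that by linarith
      with j show ?thesis by (cases rule: le_4_cases) (auto simp: rts_def)
    qed
    then have "reflect (bf j) (alpha j i) ?e = ?e" if "i < 4" for i using that by (simp add: reflect_def)
    then have we: "rho w ?e = ?e" using w(1) by (induction w) auto
    have "rho w \<circ> H = id"
    proof (rule stabilizer_trivial[OF j])
      show "linear (rho w \<circ> H)" by (intro linear_compose lin bf.linear_refl_word)
    qed (use iso int He wn we w(2) in \<open>auto simp: bf_rho integral_rho\<close>)
    then have "rho w (H x) = x" for x by (metis comp_apply id_apply)
    then have "H x = rho (rev w) x" for x using rho_rev[OF wn, of "H x"] by simp
    then show ?thesis using wn by (intro exI[of _ "rev w"]) auto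
  qed
  have chm: "rho w1 (G ?e) = ?e \<or> (j = 1 \<or> j = 2) \<and> rho w1 (G ?e) = dg ?e"
  proof -
    have "rho w1 (G ?e) \<noteq> (3, - 1, - 1, - 1, - 1)" if "j = 2"
    proof
      assume a: "rho w1 (G ?e) = (3, - 1, - 1, - 1, - 1)"
      \<comment> \<open>The vector \<open>(0, 1, 0, 0, 0)\<close> has norm 1 and is orthogonal to
        \<open>?e\<close>; its image would be an odd vector in the even lattice orthogonal to the
        characteristic vector.\<close>
      let ?z = "rho w1 (G (0, 1, 0, 0, 0))"
      have "integral5 ?z" by (intro integral_rho w1 int) simp
      moreover have "bf j ?z (3, - 1, - 1, - 1, - 1) = 0" "bf j ?z ?z = 1"
        unfolding a[symmetric] bf_rho[OF w1(1)] iso using that by (auto simp: wt_def)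
      ultimately show False using characteristic_vector_excluded[of ?z] that by blast
    qed
    moreover have "integral5 (rho w1 (G ?e))" by (intro integral_rho w1 int e)
    moreover have "bf j (rho w1 (G ?e)) (rho w1 (G ?e)) = -1" using e by (simp only: bf_rho[OF w1(1)] iso)
    ultimately show ?thesis
      using norm_minus_1_chamber[OF j, of "rho w1 (G ?e)"] w1(2) by (auto simp only: in_chamber_iff)
  qed
  note w1r = rho_rev[OF w1(1)]
  have lin1: "linear (rho w1 \<circ> G)" by (intro linear_compose lin bf.linear_refl_word)
  show ?thesis
  proof (rule disjE[OF chm])
    assume c: "rho w1 (G ?e) = ?e"
    have "\<exists>w. set w \<subseteq> {..<nr} \<and> (\<forall>x. (rho w1 \<circ> G) x = rho w x)"
      by (rule *[OF lin1]) (use c in \<open>auto simp only: o_def bf_rho[OF w1(1)] iso intro: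
        integral_rho[OF w1(1)] int future_rho[OF w1(1)] fut\<close>)
    then obtain w where w: "set w \<subseteq> {..<nr}" "\<And>x. rho w1 (G x) = rho w x" by auto
    have "G x = rho (rev w1 @ w) x" for x using w1r[of "G x"] w(2) by simp
    then have "G = rho (rev w1 @ w)" by (rule ext)
    then show ?thesis using w w1 by (intro exI[of _ "rev w1 @ w"]) simp
  next
    \<comment> \<open>Composition with \<open>dg\<close> brings the image back to \<open>?e\<close>;
      afterwards \<open>dg\<close> is moved to the right of the word, which it permutes letter by
      letter.\<close>
    assume dc: "(j = 1 \<or> j = 2) \<and> rho w1 (G ?e) = dg ?e"
    note d = conjunct1[OF dc] and c = conjunct2[OF dc]
    have "\<exists>w. set w \<subseteq> {..<nr} \<and> (\<forall>x. (dg \<circ> (rho w1 \<circ> G)) x = rho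
      w x)"
    proof (rule *)
      show "linear (dg \<circ> (rho w1 \<circ> G))" by (rule linear_compose[OF lin1 linear_dg])
      show "bf j ((dg \<circ> (rho w1 \<circ> G)) x) ((dg \<circ> (rho w1 \<circ> G)) y) = bf j x y" for x y
        by (simp only: o_def bf_dg[OF d] bf_rho[OF w1(1)] iso)
      show "integral5 ((dg \<circ> (rho w1 \<circ> G)) x)" if "integral5 x" for x
        unfolding o_def by (intro integral_dg integral_rho w1 int that)
      show "future j ((dg \<circ> (rho w1 \<circ> G)) x)" if "future j x" for x
        unfolding o_def by (intro future_dg d future_rho w1 fut that)
      show "(dg \<circ> (rho w1 \<circ> G)) ?e = ?e" by (simp only: o_def c dg_dg)
    qed
    then obtain w where w: "set w \<subseteq> {..<nr}" "\<And>x. dg (rho w1 (G x)) = rho w x" by auto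
    obtain w' where w': "set w' \<subseteq> {..<nr}" "\<And>x. dg (rho w x) = rho w' (dg x)"
      using dg_rho_commute[OF d w(1)] by blast
    have "G x = rho (rev w1 @ w') (dg x)" for x
    proof -
      have "rho w1 (G x) = dg (rho w x)" using w(2)[of x] dg_dg by metis
      then show ?thesis using w1r[of "G x"] w'(2) by simp
    qed
    then have "G = rho (rev w1 @ w') \<circ> dg" by auto
    then show ?thesis using w' w1 d by (intro exI[of _ "rev w1 @ w'"]) simp
  qed
qed

theorem reflection_in_rho:
  assumes b: "0 < bf j b b" and d: "j = 1 \<or> j = 2" and w: "set w \<subseteq> {..<nr}"
    and s: "reflect (bf j) b = rho w \<circ> dg"
  shows "\<exists>w. set w \<subseteq> {..<nr} \<and> reflect (bf j) b = rho w"
proof -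
  let ?C = "{rho w (alpha j k) | w k. set w \<subseteq> {..<nr} \<and> k < nr}"
  have "?C = (\<lambda>(w, k). rho w (alpha j k)) ` ({w. set w \<subseteq> {..<nr}} \<times> {..<nr})" by auto
  then have cC: "countable ?C" by simp
  show ?thesis
  proof (cases "\<exists>w k t. set w \<subseteq> {..<nr} \<and> k < nr \<and> rho w (alpha j k) = t
    *\<^sub>R b")
    case True
    then obtain w k t where wk: "set w \<subseteq> {..<nr}" "k < nr"
      "rho w (alpha j k) = t *\<^sub>R b" by blast
    have "bf j (t *\<^sub>R b) (t *\<^sub>R b) \<noteq> 0" using bf_rho[OF wk(1), of "alpha j k"
      "alpha j k"] wk alpha_norm[OF j wk(2)] by simp
    then have "t \<noteq> 0" by (auto simp: bf.B_simps)
    then have "reflect (bf j) b = reflect (bf j) (rho w (alpha j k))" using bf.refl_scale[of t j b] wk by simp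
    moreover have "reflect (bf j) (rho w (alpha j k)) x = rho (w @ [k] @ rev w) x" for x
      using bf.refl_conj[OF bf.linear_refl_word bf.linear_refl_word bf_rho[OF wk(1)] rho_rev'[OF wk(1)], of
        "alpha j k" x] by simp
    ultimately show ?thesis using wk by (intro exI[of _ "w @ [k] @ rev w"]) auto
  next
    case False
    then have nc: "c \<noteq> t *\<^sub>R b" if "c \<in> ?C" for c t using that by (auto simp only:
      mem_Collect_eq)
    obtain v where v': "future j v \<and> bf j v b = 0 \<and> (\<forall>c\<in>?C. bf j v c \<noteq> 0)"
      using generic_orthogonal_vector[OF b cC nc] by (rule exE)
    note v = v'[THEN conjunct1] v'[THEN conjunct2, THEN conjunct1] v'[THEN conjunct2, THEN conjunct2,
      rule_format]
    obtain w1 where w1: "set w1 \<subseteq> {..<nr}" "rho w1 v \<in> chamber" using exists_in_chamber[OF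
      v(1)] by blast
    have int: "bf j (rho w1 v) (alpha j i) < 0" if "i < nr" for i
    proof -
      have "bf j v (rho (rev w1) (alpha j i)) \<noteq> 0" using w1 that by (intro v(3)) (auto intro!:
        exI[of _ "rev w1"])
      then have "bf j (rho w1 v) (alpha j i) \<noteq> 0" using bf_rho_adjoint[OF w1(1)] by simp
      then show ?thesis using w1(2) that by (force simp: chamber_def)
    qed
    obtain w' where w': "set w' \<subseteq> {..<nr}" "\<And>x. dg (rho (rev w1) x) = rho w' (dg x)"
      using dg_rho_commute[OF d, of "rev w1"] w1 by auto
    have conj: "reflect (bf j) (rho w1 b) x = rho (w1 @ w @ w') (dg x)" for x
      using bf.refl_conj[OF bf.linear_refl_word bf.linear_refl_word bf_rho[OF w1(1)] rho_rev'[OF w1(1)], of b x]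
      by (simp add: s w')
    have w2: "set (w1 @ w @ w') \<subseteq> {..<nr}" using w w1 w' by auto
    have "reflect (bf j) (rho w1 b) (rho w1 v) = rho w1 v"
      using v(2) by (simp add: reflect_def bf_rho[OF w1(1)])
    \<comment> \<open>The conjugated reflection fixes the interior vector \<open>rho w1 v\<close>,
      so the word maps the interior vector \<open>dg (rho w1 v)\<close> into the chamber. It is then
      trivial, and \<open>dg\<close> itself would be a reflection.\<close>
    then have fixed: "rho (w1 @ w @ w') (dg (rho w1 v)) = rho w1 v" using conj by simp
    have "bf j (dg (rho w1 v)) (alpha j i) < 0" if i: "i < nr" for i
    proof -
      have "dg (alpha j i) \<in> set (rts j)" using dg_rts[OF d, of "alpha j i"] i by auto
      then obtain k where k: "k < nr" "alpha j k = dg (alpha j i)" by (metis in_set_conv_nth)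
      have "bf j (dg (rho w1 v)) (alpha j i) = bf j (rho w1 v) (dg (alpha j i))"
        using bf_dg[OF d, of "rho w1 v" "dg (alpha j i)"] by simp
      then show ?thesis using int k by metis
    qed
    then have "cox_eq R (w1 @ w @ w') []"
      using chamber_trivial_word[OF w2, of "dg (rho w1 v)"] fixed w1(2) by simp
    then have "rho (w1 @ w @ w') = rho []" by (rule rho_cong)
    then have "dg = reflect (bf j) (rho w1 b)" using conj by (simp add: fun_eq_iff)
    then show ?thesis using dg_not_refl by blast
  qed
qed

end

section \<open>Eisenstein integers\<close>

lemma theta_sq: "theta * theta = -3"
  by (simp add: theta_def complex_eq_iff)

lemma cnj_theta [simp]: "cnj theta = - theta"
  by (simp add: theta_def complex_eq_iff)

lemma theta_nz [simp]: "theta \<noteq> 0"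
  using theta_sq by auto

lemma omega_theta: "omega = (theta - 1) / 2"
proof -
  have "omega = cis (2 * pi / 3)" by (simp add: omega_def cis_conv_exp mult.commute)
  then show ?thesis by (simp add: complex_eq_iff theta_def cos_120 sin_120)
qed

lemma omega_sq: "omega * omega = - 1 - omega"
  using theta_sq by (simp add: omega_theta field_simps)

lemma cnj_omega: "cnj omega = - 1 - omega"
  by (simp add: omega_theta field_simps)

lemma EisI: "of_int a + of_int b * omega \<in> Eis"
  unfolding Eis_def by blast

lemma Eis_of_int: "of_int a \<in> Eis" using EisI[of a 0] by simp
lemma Eis_0 [simp]: "0 \<in> Eis" using Eis_of_int[of 0] by simp
lemma Eis_1 [simp]: "1 \<in> Eis" using Eis_of_int[of 1] by simp
lemma Eis_numeral [simp]: "numeral n \<in> Eis" using Eis_of_int[of "numeral n"] by simp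
lemma Eis_omega: "omega \<in> Eis" using EisI[of 0 1] by simp

lemma theta_omega: "theta = 1 + 2 * omega" by (simp add: omega_theta field_simps)

lemma Eis_add: assumes "x \<in> Eis" "y \<in> Eis" shows "x + y \<in> Eis"
proof -
  from assms obtain a b c d where "x = of_int a + of_int b * omega" "y = of_int c + of_int d * omega"
    unfolding Eis_def by blast
  then have "x + y = of_int (a + c) + of_int (b + d) * omega" by (simp add: algebra_simps)
  then show ?thesis using EisI by metis
qed

lemma Eis_mult: assumes "x \<in> Eis" "y \<in> Eis" shows "x * y \<in> Eis"
proof -
  from assms obtain a b c d where xy: "x = of_int a + of_int b * omega" "y = of_int c + of_int d * omega"
    unfolding Eis_def by blast
  have "x * y = of_int a * of_int c + (of_int a * of_int d + of_int b * of_int c) * omega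
      + of_int b * of_int d * (omega * omega)" by (simp add: xy algebra_simps)
  also have "\<dots> = of_int (a * c - b * d) + of_int (a * d + b * c - b * d) * omega"
    unfolding omega_sq by (simp add: algebra_simps)
  finally show ?thesis using EisI by metis
qed

lemma Eis_minus [simp]: "- x \<in> Eis \<longleftrightarrow> x \<in> Eis"
proof -
  have *: "- x \<in> Eis" if "x \<in> Eis" for x using Eis_mult[OF Eis_of_int[of "-1"] that] by simp
  show ?thesis using *[of x] *[of "- x"] by auto
qed

lemma Eis_diff: "x \<in> Eis \<Longrightarrow> y \<in> Eis \<Longrightarrow> x - y \<in> Eis"
  using Eis_add[of x "- y"] by simp

lemma Eis_theta [simp]: "theta \<in> Eis"
  unfolding theta_omega by (intro Eis_add Eis_mult) (simp_all add: Eis_omega)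

lemma Eis_cnj: assumes "x \<in> Eis" shows "cnj x \<in> Eis"
proof -
  from assms obtain a b where x: "x = of_int a + of_int b * omega" unfolding Eis_def by blast
  show ?thesis unfolding x complex_cnj_add complex_cnj_mult cnj_omega complex_cnj_of_int
    by (intro Eis_add Eis_mult Eis_diff Eis_of_int) (simp_all add: Eis_omega)
qed

lemma Eis_sum: "(\<And>i. i \<in> A \<Longrightarrow> f i \<in> Eis) \<Longrightarrow> sum f A \<in> Eis"
  by (induction A rule: infinite_finite_induct) (auto intro: Eis_add)

lemma Eis_prod: "(\<And>i. i \<in> A \<Longrightarrow> f i \<in> Eis) \<Longrightarrow> prod f A \<in> Eis"
  by (induction A rule: infinite_finite_induct) (auto intro: Eis_mult)

lemma Eis_norm: assumes "x \<in> Eis" obtains m :: int where "x * cnj x = of_int m" "0 \<le> m"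
proof -
  from assms obtain a b where x: "x = of_int a + of_int b * omega" unfolding Eis_def by blast
  have "x * cnj x = of_int a * of_int a - of_int a * of_int b
      - of_int b * of_int b * omega - of_int b * of_int b * (omega * omega)"
    by (simp add: x cnj_omega algebra_simps)
  also have "\<dots> = of_int (a * a - a * b + b * b)" unfolding omega_sq by (simp add: algebra_simps)
  finally have 1: "x * cnj x = of_int (a * a - a * b + b * b)" .
  have "0 \<le> (2 * a - b)\<^sup>2 + 3 * b\<^sup>2" by simp
  also have "\<dots> = 4 * (a * a - a * b + b * b)" by (simp add: power2_eq_square algebra_simps)
  finally have "0 \<le> a * a - a * b + b * b" unfolding zero_le_mult_iff by auto
  then show ?thesis using that[OF 1] by simp
qed

lemma Eis_imaginary: assumes "x \<in> Eis" "cnj x = - x" obtains a :: int where "x = theta * of_int a"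
proof -
  from assms obtain a b where x: "x = of_int a + of_int b * omega" unfolding Eis_def by blast
  have "of_int (2 * a) = (of_int b :: complex)" using assms(2) by (simp add: x cnj_omega algebra_simps)
  then have "b = 2 * a" by (metis of_int_eq_iff)
  then have "x = theta * of_int a" by (simp add: x theta_omega algebra_simps)
  then show ?thesis using that by blast
qed

lemma Eis_of_real [simp]: "of_real x \<in> Eis \<longleftrightarrow> x \<in> \<int>"
proof
  assume "complex_of_real x \<in> Eis"
  then obtain a b where x: "of_real x = of_int a + of_int b * omega" unfolding Eis_def by blast
  have "cnj (of_real x) = complex_of_real x" by simp
  then have "of_int b * theta = 0" unfolding x by (simp add: cnj_omega theta_omega algebra_simps)
  then have "complex_of_real x = of_real (of_int a)" using x by simp
  then show "x \<in> \<int>" unfolding of_real_eq_iff by simp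
next
  assume "x \<in> \<int>"
  then show "complex_of_real x \<in> Eis" by (metis Eis_of_int Ints_cases of_real_of_int_eq)
qed

lemma Eis_theta_of_real [simp]: "theta * of_real x \<in> Eis \<longleftrightarrow> x \<in> \<int>"
proof
  assume "theta * of_real x \<in> Eis"
  then obtain a :: int where "theta * of_real x = theta * of_int a"
    by (rule Eis_imaginary) simp
  then have "complex_of_real x = of_real (of_int a)" by simp
  then show "x \<in> \<int>" unfolding of_real_eq_iff by simp
next
  assume "x \<in> \<int>"
  then show "theta * of_real x \<in> Eis" by (intro Eis_mult) auto
qed

lemma EisUnits_norm: assumes "u \<in> EisUnits" shows "u * cnj u = 1"
proof -
  from assms obtain v where v: "u \<in> Eis" "v \<in> Eis" "u * v = 1" unfolding EisUnits_def by blast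
  obtain m where m: "u * cnj u = of_int m" "0 \<le> m" using Eis_norm[OF v(1)] by blast
  obtain k where k: "v * cnj v = of_int k" "0 \<le> k" using Eis_norm[OF v(2)] by blast
  have "(u * cnj u) * (v * cnj v) = (u * v) * cnj (u * v)" by (simp add: algebra_simps)
  then have "of_int (m * k) = (of_int 1 :: complex)" using m k v by simp
  then have "m * k = 1" unfolding of_int_eq_iff .
  then have "m = 1" using m(2) by (auto simp: zmult_eq_1_iff)
  then show ?thesis using m by simp
qed

lemma EisUnitsI: "u \<in> Eis \<Longrightarrow> u * cnj u = 1 \<Longrightarrow> u \<in> EisUnits"
  unfolding EisUnits_def using Eis_cnj by blast

lemma EisUnits_Eis: "u \<in> EisUnits \<Longrightarrow> u \<in> Eis"
  unfolding EisUnits_def by blast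

lemma EisUnits_nz: "u \<in> EisUnits \<Longrightarrow> u \<noteq> 0"
  unfolding EisUnits_def by auto

lemma EisUnits_1 [simp]: "1 \<in> EisUnits" by (rule EisUnitsI) auto

lemma EisUnits_minus: "u \<in> EisUnits \<Longrightarrow> - u \<in> EisUnits"
  by (rule EisUnitsI) (auto dest: EisUnits_norm EisUnits_Eis)

lemma EisUnits_mult: "u \<in> EisUnits \<Longrightarrow> v \<in> EisUnits \<Longrightarrow> u * v \<in>
  EisUnits"
  using EisUnits_norm[of u] EisUnits_norm[of v]
  by (intro EisUnitsI Eis_mult) (auto simp: EisUnits_Eis algebra_simps)

lemma EisUnits_cnj: "u \<in> EisUnits \<Longrightarrow> cnj u \<in> EisUnits"
  using EisUnits_norm[of u] by (intro EisUnitsI Eis_cnj) (auto simp: EisUnits_Eis algebra_simps)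

text \<open>The units are \<open>\<plusminus> \<omega>\<^sup>k\<close>, and \<open>cnj
  (\<omega>\<^sup>k)\<^sup>2 = \<omega>\<^sup>k\<close>.\<close>

lemma EisUnits_square_root:
  assumes "l \<in> EisUnits"
  obtains u s where "u \<in> EisUnits" "s \<in> {1, -1}" "l * u * u = s"
proof -
  have om: "omega \<in> EisUnits"
    by (rule EisUnitsI[OF Eis_omega]) (simp add: cnj_omega algebra_simps omega_sq)
  have om3: "omega * omega * omega = 1" by (simp add: omega_sq algebra_simps)
  obtain a b where l: "l = of_int a + of_int b * omega" using EisUnits_Eis[OF assms] unfolding Eis_def by blast
  have "l * cnj l = of_int a * of_int a - of_int a * of_int b
      - of_int b * of_int b * omega - of_int b * of_int b * (omega * omega)"
    by (simp add: l cnj_omega algebra_simps)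
  also have "\<dots> = of_int (a * a - a * b + b * b)" unfolding omega_sq by (simp add: algebra_simps)
  finally have "of_int (a * a - a * b + b * b) = (of_int 1 :: complex)" using EisUnits_norm[OF assms] by simp
  then have n: "a * a - a * b + b * b = 1" unfolding of_int_eq_iff .
  have "(2 * a - b)\<^sup>2 + 3 * b\<^sup>2 = 4" "(2 * b - a)\<^sup>2 + 3 * a\<^sup>2 = 4"
    using n by (simp_all add: power2_eq_square algebra_simps)
  then have "b\<^sup>2 < 4" "a\<^sup>2 < 4" using zero_le_power2[of "2 * a - b"] zero_le_power2[of
    "2 * b - a"] by linarith+
  then have "\<bar>a\<bar> < 2" "\<bar>b\<bar> < 2" using power2_less_imp_less[of
    "\<bar>a\<bar>" 2] power2_less_imp_less[of "\<bar>b\<bar>" 2] by simp_all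
  then have "a = -1 \<or> a = 0 \<or> a = 1" "b = -1 \<or> b = 0 \<or> b = 1" by linarith+
  then consider "a = 1" "b = 0" | "a = -1" "b = 0" | "a = 0" "b = 1" | "a = 0" "b = -1" | "a = 1"
    "b = 1" | "a = -1" "b = -1"
    using n by auto
  then show ?thesis
  proof cases
    case 1 then show ?thesis using that[of 1 1] l by simp
  next
    case 2 then show ?thesis using that[of 1 "-1"] l by simp
  next
    case 3 then show ?thesis using that[of omega 1] l om by (simp add: omega_sq algebra_simps)
  next
    case 4 then show ?thesis using that[of omega "-1"] l om by (simp add: omega_sq algebra_simps)
  next
    case 5
    then have "l = - (omega * omega)" using l by (simp add: omega_sq)
    then have "l * (omega * omega) * (omega * omega) = - ((omega * omega * omega) * (omega * omega *
      omega))" by simp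
    then show ?thesis using that[of "omega * omega" "-1"] EisUnits_mult[OF om om] om3 by simp
  next
    case 6
    then have "l = omega * omega" using l by (simp add: omega_sq)
    then have "l * (omega * omega) * (omega * omega) = (omega * omega * omega) * (omega * omega * omega)"
      by simp
    then show ?thesis using that[of "omega * omega" 1] EisUnits_mult[OF om om] om3 by simp
  qed
qed

section \<open>Real coordinates on the fixed vectors of \<open>\<xi>\<^sub>j\<close>\<close>

lemma exhaust_5: fixes x :: 5 shows "x = 0 \<or> x = 1 \<or> x = 2 \<or> x = 3 \<or> x = 4"
proof (induct x)
  case (of_int z)
  then have "0 \<le> z" "z < 5" by simp_all
  then have "z = 0 \<or> z = 1 \<or> z = 2 \<or> z = 3 \<or> z = 4" by arith
  then show ?case by auto
qed

lemma forall_5: "(\<forall>i::5. P i) \<longleftrightarrow> P 0 \<and> P 1 \<and> P 2 \<and> P 3 \<and> P 4"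
  by (metis exhaust_5)

lemma UNIV_5: "UNIV = {0, 1, 2, 3, 4 :: 5}"
  using exhaust_5 by auto

lemma sum_5: "sum f (UNIV :: 5 set) = f 0 + f 1 + f 2 + f 3 + f 4"
  unfolding UNIV_5 by (simp add: ac_simps)

lemma vec5_nth [simp]: "vec5 a b c d e $ 0 = a" "vec5 a b c d e $ 1 = b" "vec5 a b c d e $ 2 = c"
    "vec5 a b c d e $ 3 = d" "vec5 a b c d e $ 4 = e"
  by (simp_all add: vec5_def)

lemma hform_expand: "hform x y = - x $ 0 * cnj (y $ 0) + x $ 1 * cnj (y $ 1) + x $ 2 * cnj (y $ 2)
    + x $ 3 * cnj (y $ 3) + x $ 4 * cnj (y $ 4)"
  by (simp add: hform_def sum_5)

lemma hform_add: "hform (x + y) z = hform x z + hform y z"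
  and hform_add_right: "hform z (x + y) = hform z x + hform z y"
  and hform_diff: "hform (x - y) z = hform x z - hform y z"
  and hform_diff_right: "hform z (x - y) = hform z x - hform z y"
  and hform_scale: "hform (c *s x) z = c * hform x z"
  and hform_scale_right: "hform z (c *s x) = cnj c * hform z x"
  and hform_cnj: "cnj (hform x z) = hform z x"
  by (simp_all add: hform_expand algebra_simps)

lemmas hform_simps = hform_add hform_add_right hform_diff hform_diff_right hform_scale hform_scale_right

lemma hform_self_real: "hform r r = of_real (Re (hform r r))"
proof -
  have "hform r r \<in> \<real>" using hform_cnj[of r r] by (simp add: Reals_cnj_iff)
  then show ?thesis by simp
qed

definition tt :: "nat \<Rightarrow> nat \<Rightarrow> complex" where
  "tt j i = (if 5 \<le> i + j then theta else 1)"

fun iota :: "nat \<Rightarrow> r5 \<Rightarrow> cvec" where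
  "iota j (x0, x1, x2, x3, x4) = vec5 (of_real x0) (tt j 1 * of_real x1) (tt j 2 * of_real x2)
     (tt j 3 * of_real x3) (tt j 4 * of_real x4)"

definition ro :: "nat \<Rightarrow> cvec \<Rightarrow> r5" where
  "ro j v = (Re (v $ 0), Re (v $ 1 / tt j 1), Re (v $ 2 / tt j 2), Re (v $ 3 / tt j 3), Re (v $ 4 / tt j 4))"

lemma tt_nz [simp]: "tt j i \<noteq> 0"
  by (simp add: tt_def)

lemma tt_norm: "tt j i * cnj (tt j i) = of_real (wt j i)"
  using theta_sq by (simp add: tt_def wt_def)

lemma ro_iota [simp]: "ro j (iota j x) = x"
  by (cases x) (simp add: ro_def)

lemma iota_inj: "iota j x = iota j y \<longleftrightarrow> x = y"
  using ro_iota by metis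

lemma iota_add: "iota j (x + y) = iota j x + iota j y"
  by (cases x; cases y) (simp add: vec_eq_iff forall_5 algebra_simps)

lemma iota_diff: "iota j (x - y) = iota j x - iota j y"
  by (cases x; cases y) (simp add: vec_eq_iff forall_5 algebra_simps)

lemma iota_scaleR: "iota j (c *\<^sub>R x) = of_real c *s iota j x"
  by (cases x) (simp add: vec_eq_iff forall_5 algebra_simps)

lemma iota_minus: "iota j (- x) = - iota j x"
  by (cases x) (simp add: vec_eq_iff forall_5)

lemma iota_0: "iota j 0 = 0"
  by (simp add: zero_prod_def vec_eq_iff forall_5)

lemma ro_add: "ro j (v + w) = ro j v + ro j w"
  by (simp add: ro_def add_divide_distrib)

lemma ro_scaleR: "ro j (of_real c *s v) = c *\<^sub>R ro j v"
  by (simp add: ro_def flip: times_divide_eq_right)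

lemma hform_iota: "hform (iota j x) (iota j y) = of_real (bf j x y)"
proof -
  have t: "tt j i * of_real a * cnj (tt j i * of_real b) = of_real (wt j i * a * b)" for i a b
    using tt_norm[of j i] by (simp add: algebra_simps)
  show ?thesis by (cases x; cases y) (simp add: hform_expand t del: complex_cnj_mult)
qed

lemma Eis_tt [simp]: "tt j i \<in> Eis"
  by (simp add: tt_def)

lemma iota_Lam: "iota j x \<in> Lam \<longleftrightarrow> integral5 x"
proof -
  have "tt j i * of_real a \<in> Eis \<longleftrightarrow> a \<in> \<int>" for i a by (simp add: tt_def)
  then show ?thesis by (cases x) (simp add: Lam_def forall_5)
qed

definition sg :: "nat \<Rightarrow> 5 \<Rightarrow> complex" where
  "sg j i = (if neg_coord j i then -1 else 1)"

lemma xi_nth: "xi j v $ i = sg j i * cnj (v $ i)"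
  by (simp add: xi_def sg_def)

lemma sg_sq: "sg j i * sg j i = 1" "cnj (sg j i) = sg j i"
  by (simp_all add: sg_def)

lemma xi_xi: "xi j (xi j v) = v"
  by (simp add: vec_eq_iff xi_nth sg_sq flip: mult.assoc)

lemma xi_scale: "xi j (c *s v) = cnj c *s xi j v"
  by (simp add: vec_eq_iff xi_nth)

lemma sg_simps:
  assumes "j \<le> 4"
  shows "sg j 0 = 1" "sg j 1 = (if 4 \<le> j then -1 else 1)" "sg j 2 = (if 3 \<le> j then -1 else 1)"
    "sg j 3 = (if 2 \<le> j then -1 else 1)" "sg j 4 = (if 1 \<le> j then -1 else 1)"
  using assms by (auto simp: sg_def neg_coord_def)

lemma xi_iota:
  assumes "j \<le> 4"
  shows "xi j (iota j x) = iota j x"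
  by (cases x) (auto simp: vec_eq_iff forall_5 xi_nth sg_simps[OF assms] tt_def)

lemma iota_ro:
  assumes "j \<le> 4" "xi j v = v"
  shows "iota j (ro j v) = v"
proof -
  have *: "z = (if c then theta else 1) * of_real (Re (z / (if c then theta else 1)))"
    if "(if c then -1 else 1) * cnj z = z" for z c
  proof (cases c)
    case True
    then have "cnj z = - z" using that by (simp add: minus_equation_iff)
    then have "z / theta \<in> \<real>" by (simp add: Reals_cnj_iff)
    then show ?thesis using True by simp
  next
    case False
    then have "z \<in> \<real>" using that by (simp add: Reals_cnj_iff)
    then show ?thesis using False by simp
  qed
  have "sg j i * cnj (v $ i) = v $ i" for i using assms(2) xi_nth by metis
  note e = this[of 0] this[of 1] this[of 2] this[of 3] this[of 4]
  show ?thesis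
    using *[of False "v $ 0"] *[of "4 \<le> j" "v $ 1"] *[of "3 \<le> j" "v $ 2"] *[of "2 \<le> j"
      "v $ 3"] *[of "1 \<le> j" "v $ 4"] e
    by (auto simp: vec_eq_iff forall_5 ro_def tt_def sg_simps[OF assms(1)] split: if_splits)
qed

lemma Vreal_iota:
  assumes "j \<le> 4"
  shows "v \<in> Vreal j \<longleftrightarrow> (\<exists>x. v = iota j x)"
proof (rule iffI)
  assume "v \<in> Vreal j"
  then have "v = iota j (ro j v)" using iota_ro[OF assms] by (simp add: Vreal_def)
  then show "\<exists>x. v = iota j x" by (rule exI)
next
  assume "\<exists>x. v = iota j x"
  then obtain x where "v = iota j x" by (rule exE)
  then show "v \<in> Vreal j" using xi_iota[OF assms, of x] by (simp add: Vreal_def del: iota.simps)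
qed

lemma iota_decomp: "v = v $ 0 *s iota j (1, 0, 0, 0, 0) + (v $ 1 / tt j 1) *s iota j (0, 1, 0, 0, 0)
    + (v $ 2 / tt j 2) *s iota j (0, 0, 1, 0, 0) + (v $ 3 / tt j 3) *s iota j (0, 0, 0, 1, 0)
    + (v $ 4 / tt j 4) *s iota j (0, 0, 0, 0, 1)"
  by (simp add: vec_eq_iff forall_5)

lemma matrix_eqI_iota:
  fixes g h :: cmat
  assumes "\<And>x. g *v iota j x = h *v iota j x"
  shows "g = h"
proof -
  have "g *v v = h *v v" for v
    by (subst (1 2) iota_decomp[of v j])
      (simp only: matrix_vector_right_distrib vector_scalar_commute assms)
  then show ?thesis by (simp add: matrix_eq)
qed

text \<open>Sesquilinearity reduces the claim to five basis vectors. These are integral, so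
  invariance of the form on \<open>Lam\<close> is enough to apply it.\<close>

lemma hform_preserving_ext:
  fixes g :: cmat
  assumes "\<And>x y. integral5 x \<Longrightarrow> integral5 y \<Longrightarrow> hform (g *v iota j x) (g
    *v iota j y) = hform (iota j x) (iota j y)"
  shows "hform (g *v v) (g *v w) = hform v w"
proof -
  have 1: "hform (g *v v) (g *v iota j y) = hform v (iota j y)" if "integral5 y" for v y
    by (subst (1 2) iota_decomp[of v j])
      (simp only: matrix_vector_right_distrib vector_scalar_commute hform_simps assms integral5.simps
        Ints_0 Ints_1 that)
  show ?thesis
    by (subst (1 2) iota_decomp[of w j])
      (simp only: matrix_vector_right_distrib vector_scalar_commute hform_simps 1 integral5.simps Ints_0 Ints_1)
qed

section \<open>The group of isometries\<close>

lemma mat_mult_vec: "(mat u :: cmat) *v v = u *s v"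
  by (simp add: vec_eq_iff matrix_vector_mult_def mat_def if_distrib if_distribR cong: if_cong)

lemma Lam_mult:
  fixes g :: cmat
  assumes "\<And>i k. g $ i $ k \<in> Eis" "v \<in> Lam"
  shows "g *v v \<in> Lam"
  using assms by (auto simp: Lam_def matrix_vector_mult_def intro!: Eis_sum Eis_mult)

lemma GamI:
  fixes g h :: cmat
  assumes g: "\<And>i k. g $ i $ k \<in> Eis" and h: "\<And>i k. h $ i $ k \<in> Eis" and gh: "g ** h = mat 1"
    and form: "\<And>v w. hform (g *v v) (g *v w) = hform v w"
  shows "g \<in> Gam"
proof -
  have "v \<in> (\<lambda>x. g *v x) ` Lam" if "v \<in> Lam" for v
  proof -
    have "g *v (h *v v) = v" by (simp add: matrix_vector_mul_assoc gh)
    then show ?thesis using Lam_mult[OF h that] by (metis image_eqI)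
  qed
  then have "(\<lambda>x. g *v x) ` Lam = Lam" using Lam_mult[OF g] by auto
  then show ?thesis using g form by (simp add: Gam_def)
qed

lemma Gam_Eis: "g \<in> Gam \<Longrightarrow> g $ i $ k \<in> Eis"
  by (simp add: Gam_def)

lemma Gam_Lam: "g \<in> Gam \<Longrightarrow> v \<in> Lam \<Longrightarrow> g *v v \<in> Lam"
  by (rule Lam_mult) (auto simp: Gam_Eis)

lemma Gam_hform:
  assumes "g \<in> Gam"
  shows "hform (g *v v) (g *v w) = hform v w"
  by (rule hform_preserving_ext[of g 0]) (use assms in \<open>auto simp: Gam_def iota_Lam\<close>)

text \<open>Surjectivity on \<open>Lam\<close> provides integral preimages of the standard basis,
  and these are the columns of the inverse.\<close>

lemma Gam_inverse:
  assumes g: "g \<in> Gam"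
  obtains h where "h \<in> Gam" "g ** h = mat 1" "h ** g = mat 1"
proof -
  have "\<exists>x\<in>Lam. g *v x = axis k 1" for k
  proof -
    have "axis k 1 \<in> Lam" by (auto simp: Lam_def axis_def)
    then have "axis k 1 \<in> (\<lambda>x. g *v x) ` Lam" using g by (simp add: Gam_def)
    then show ?thesis by auto
  qed
  then obtain X where X: "\<And>k. X k \<in> Lam" "\<And>k. g *v X k = axis k 1" by metis
  define h :: cmat where "h = (\<chi> a k. X k $ a)"
  have "(g ** h) $ a $ k = (g *v X k) $ a" for a k
    by (simp add: matrix_matrix_mult_def matrix_vector_mult_def h_def)
  then have gh: "g ** h = mat 1" by (simp add: vec_eq_iff X mat_def axis_def)
  then have hg: "h ** g = mat 1" using matrix_left_right_inverse by blast
  have hE: "h $ i $ k \<in> Eis" for i k using X by (simp add: h_def Lam_def)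
  have "hform (h *v v) (h *v w) = hform v w" for v w
    using Gam_hform[OF g, of "h *v v" "h *v w"] by (simp add: matrix_vector_mul_assoc gh)
  then have "h \<in> Gam" using GamI[OF hE Gam_Eis[OF g] hg] by blast
  then show ?thesis using that gh hg by blast
qed

lemma Gam_mult:
  assumes "g \<in> Gam" "h \<in> Gam"
  shows "g ** h \<in> Gam"
proof -
  have "(\<lambda>x. (g ** h) *v x) ` Lam = (\<lambda>x. g *v x) ` (\<lambda>x. h *v x) ` Lam"
    by (simp add: image_image matrix_vector_mul_assoc)
  then have "(\<lambda>x. (g ** h) *v x) ` Lam = Lam" using assms by (simp add: Gam_def)
  moreover have "(g ** h) $ i $ k \<in> Eis" for i k
    using assms by (auto simp: matrix_matrix_mult_def Gam_def intro!: Eis_sum Eis_mult)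
  ultimately show ?thesis using assms by (simp add: Gam_def Gam_hform[OF assms(1)] Gam_hform[OF assms(2)]
    flip: matrix_vector_mul_assoc)
qed

lemma Gam_scalar:
  assumes "u \<in> EisUnits"
  shows "mat u \<in> Gam"
proof (rule GamI[of _ "mat (cnj u)"])
  have "u * cnj u = 1" using EisUnits_norm[OF assms] .
  then show "mat u ** mat (cnj u) = (mat 1 :: cmat)"
    by (simp add: matrix_eq mat_mult_vec vec_eq_iff flip: matrix_vector_mul_assoc mult.assoc)
  show "hform (mat u *v v) (mat u *v w) = hform v w" for v w
    using EisUnits_norm[OF assms] by (simp add: mat_mult_vec hform_simps mult.commute[of
      "cnj u"] flip: mult.assoc)
qed (use assms in \<open>auto simp: mat_def EisUnits_Eis Eis_cnj\<close>)

lemma matrix_inv_eqI: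
  fixes g h :: cmat
  assumes "g ** h = mat 1"
  shows "matrix_inv g = h"
proof -
  have hg: "h ** g = mat 1" using assms matrix_left_right_inverse by blast
  have "g ** matrix_inv g = mat 1 \<and> matrix_inv g ** g = mat 1"
    unfolding matrix_inv_def by (rule someI[of _ h]) (use assms hg in auto)
  then have "h ** (g ** matrix_inv g) = h" by simp
  then show ?thesis by (simp add: matrix_mul_assoc hg)
qed

lemma reflm_vec: "reflm r *v x = x - (2 * hform x r / hform r r) *s r"
proof -
  have "(\<Sum>b\<in>UNIV. (if a = b then 1 else 0) * x $ b) = x $ a" for a
    by (simp add: if_distribR if_distrib cong: if_cong)
  then have "(reflm r *v x) $ a = x $ a - (\<Sum>b\<in>UNIV. 2 * r $ a * (if b = 0 then -1 else 1) * cnj (r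
    $ b) / hform r r * x $ b)" for a
    by (simp add: matrix_vector_mult_def reflm_def left_diff_distrib sum_subtractf)
  moreover have "(\<Sum>b\<in>UNIV. 2 * r $ a * (if b = 0 then -1 else 1) * cnj (r $ b) / hform r r * x $ b)
      = 2 * hform x r / hform r r * r $ a" for a
    unfolding hform_def[of x] sum_distrib_left sum_divide_distrib sum_distrib_right
    by (rule sum.cong) auto
  ultimately show ?thesis by (simp add: vec_eq_iff)
qed

lemma reflm_iota: "reflm (iota j r) *v iota j x = iota j (reflect (bf j) r x)"
  by (simp add: reflm_vec reflect_def iota_diff iota_scaleR hform_iota del: iota.simps)

lemma reflm_scale: "c \<noteq> 0 \<Longrightarrow> reflm (c *s r) = reflm r"
  by (simp add: matrix_eq reflm_vec hform_simps vec_eq_iff)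

lemma reflm_reflm: "hform r r \<noteq> 0 \<Longrightarrow> reflm r ** reflm r = mat 1"
  by (simp add: matrix_eq reflm_vec hform_simps mat_mult_vec vec_eq_iff field_simps flip:
    matrix_vector_mul_assoc)

lemma roots_iota: "j \<le> 4 \<Longrightarrow> roots j = map (iota j) (rts j)"
  by (erule le_4_cases) (simp_all add: roots_def rts_def tt_def)

section \<open>Stabilizers of the real hyperbolic spaces\<close>

text \<open>Separates the unit ambiguity of \<open>P Gamma\<close> from the action on real vectors:
  computations in the stabilizer become computations with the real map \<open>G\<close>.\<close>

definition rep :: "nat \<Rightarrow> cmat \<Rightarrow> complex \<Rightarrow> (r5 \<Rightarrow> r5)
  \<Rightarrow> bool" where
  "rep j g u G \<longleftrightarrow> (\<forall>x. g *v iota j x = u *s iota j (G x))"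

lemma repD: "rep j g u G \<Longrightarrow> g *v iota j x = u *s iota j (G x)"
  by (simp only: rep_def)

lemma rep_mult:
  assumes "rep j g u G" "rep j h v H"
  shows "rep j (g ** h) (u * v) (G \<circ> H)"
  unfolding rep_def
proof
  fix x
  have "(g ** h) *v iota j x = g *v (v *s iota j (H x))"
    by (simp only: repD[OF assms(2)] flip: matrix_vector_mul_assoc)
  also have "\<dots> = (u * v) *s iota j ((G \<circ> H) x)"
    by (simp only: vector_scalar_commute repD[OF assms(1)] vector_smult_assoc mult.commute o_apply)
  finally show "(g ** h) *v iota j x = (u * v) *s iota j ((G \<circ> H) x)" .
qed

lemma rep_mat: "rep j (mat u) u id"
  by (simp add: rep_def mat_mult_vec)

lemma rep_eqI: "rep j g u G \<Longrightarrow> rep j h u G \<Longrightarrow> g = h"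
  by (rule matrix_eqI_iota[of _ j]) (simp only: rep_def)

lemma rep_reflm: "rep j (reflm (iota j r)) 1 (reflect (bf j) r)"
  by (simp add: rep_def reflm_iota del: iota.simps)

text \<open>The pairs \<open>(u, G)\<close> and \<open>(- u, - G)\<close> represent the same matrix.
  Preserving the time orientation at one vector forces \<open>u * cnj v\<close> to be a positive
  real number of modulus 1.\<close>

lemma rep_unique:
  assumes "rep j g u G" "rep j g v H" "u \<in> EisUnits" "v \<in> EisUnits"
    and x: "future j (G x)" "future j (H x)"
  shows "u = v \<and> G = H"
proof -
  have e: "u *s iota j (G y) = v *s iota j (H y)" for y using assms(1,2) by (simp only: rep_def)
  have "hform (u *s iota j (G x)) (v *s iota j (H x)) = hform (v *s iota j (H x)) (v *s iota j (H x))"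
    by (simp only: e)
  then have "u * cnj v * of_real (bf j (G x) (H x)) = v * cnj v * of_real (bf j (H x) (H x))"
    by (simp add: hform_simps hform_iota del: iota.simps)
  then have 1: "u * cnj v * of_real (bf j (G x) (H x)) = of_real (bf j (H x) (H x))"
    using EisUnits_norm[OF assms(4)] by simp
  have neg: "bf j (G x) (H x) < 0" "bf j (H x) (H x) < 0" using x by (auto intro: future_bf)
  define t where "t = bf j (H x) (H x) / bf j (G x) (H x)"
  have t: "u * cnj v = of_real t" "0 < t" using 1 neg by (auto simp: t_def field_simps divide_neg_neg)
  have "of_real (t * t) = (u * cnj u) * (v * cnj v)" using t(1) by (metis (no_types, opaque_lifting)
      complex_cnj_cnj complex_cnj_complex_of_real complex_cnj_mult mult.assoc mult.commute of_real_mult)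
  also have "\<dots> = 1" using EisUnits_norm assms by simp
  finally have "t * t = 1" by (metis of_real_eq_1_iff)
  then have "t = 1" using t(2) by (metis abs_of_pos abs_mult_self_eq mult_cancel_left1 real_sqrt_abs2
    real_sqrt_one)
  then have "u * cnj v = 1" using t by simp
  then have "u * (cnj v * v) = v" by (simp flip: mult.assoc)
  then have uv: "u = v" using EisUnits_norm[OF assms(4)] by (simp add: mult.commute)
  have "iota j (G y) = iota j (H y)" for y
    using e[of y] EisUnits_nz[OF assms(4)] unfolding uv by (metis vector_mul_lcancel)
  then have "G = H" by (simp only: iota_inj) (rule ext)
  then show ?thesis using uv by simp
qed

section \<open>Negative lines and their real representatives\<close>

lemma cline_self: "v \<in> cline v"
  unfolding cline_def by (metis rangeI vector_smult_lid)

lemma cline_scale: assumes "u \<noteq> 0" shows "cline (u *s v) = cline v"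
proof -
  have "c *s v \<in> cline (u *s v)" for c
    unfolding cline_def by (rule range_eqI[of _ _ "c / u"]) (use assms in \<open>simp add:
      vector_smult_assoc\<close>)
  then show ?thesis by (auto simp: cline_def vector_smult_assoc)
qed

lemma cline_memD: "w \<in> cline v \<Longrightarrow> \<exists>c. w = c *s v"
  unfolding cline_def by blast

lemma act_cline: "act g (cline v) = cline (g *v v)"
  by (simp add: act_def cline_def image_image vector_scalar_commute)

lemma act_rep:
  assumes "rep j g u G" "u \<noteq> 0"
  shows "act g (cline (iota j x)) = cline (iota j (G x))"
  unfolding act_cline repD[OF assms(1)] by (rule cline_scale[OF assms(2)])

lemma cline_iota_eq:
  assumes "future j x" "future j y" "cline (iota j x) = cline (iota j y)"
  shows "\<exists>c>0. y = c *\<^sub>R x"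
proof -
  have "iota j y \<in> cline (iota j x)" unfolding assms(3) by (rule cline_self)
  then obtain c where c: "iota j y = c *s iota j x" using cline_memD by blast
  have "of_real (bf j y x) = c * of_real (bf j x x)"
    unfolding hform_iota[symmetric] c hform_scale ..
  then have cr: "c = of_real (bf j y x / bf j x x)" using assms(1) by (simp add: future_def field_simps)
  have "y = (bf j y x / bf j x x) *\<^sub>R x" using c unfolding cr iota_scaleR[symmetric] iota_inj .
  moreover have "0 < bf j y x / bf j x x" using assms future_bf by (intro divide_neg_neg) auto
  ultimately show ?thesis by blast
qed

lemma real_line_future:
  assumes "bf j x x < 0"
  obtains y where "future j y" "y = x \<or> y = - x" "cline (iota j x) = cline (iota j y)"
proof -
  have nz: "fst x \<noteq> 0" using negative_same_sign[OF assms assms] assms by auto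
  show ?thesis
  proof (cases "0 < fst x")
    case True then show ?thesis using that[of x] assms by (simp add: future_def)
  next
    case False
    have "cline (iota j (- x)) = cline (iota j x)"
      using cline_scale[of "-1" "iota j x"] by (simp add: iota_minus del: iota.simps)
    then show ?thesis using that[of "- x"] assms nz False by (simp add: future_def bf.B_simps)
  qed
qed

text \<open>If \<open>xi j\<close> multiplies \<open>v\<close> by \<open>c\<close>, then
  \<open>c\<close> has modulus 1, and a square root \<open>d\<close> of \<open>c\<close> turns
  \<open>v\<close> into the fixed vector \<open>d *s v\<close>: Hilbert 90 for complex
  conjugation.\<close>

lemma H4_iota:
  assumes j: "j \<le> 4"
  shows "H4 j = {cline (iota j x) | x. future j x}"
proof (intro equalityI subsetI)
  fix L assume "L \<in> H4 j"
  then obtain v where v: "L = cline v" "Re (hform v v) < 0" "xi j ` L = L"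
    unfolding H4_def CH4_def by blast
  have "xi j v \<in> cline v" using v(1,3) cline_self[of v] by blast
  then obtain c where c: "xi j v = c *s v" using cline_memD by blast
  have "v = cnj c *s (c *s v)" using xi_xi[of j v] by (simp add: c xi_scale)
  moreover have "v \<noteq> 0" using v(2) by (auto simp: hform_expand)
  ultimately have cc: "cnj c * c = 1" by (simp add: vector_smult_assoc) (metis vector_mul_rcancel
    vector_smult_lid)
  define d where "d = csqrt c"
  have d: "d * d = c" by (simp add: d_def flip: power2_eq_square)
  have "cmod c = 1" using cc by (metis complex_mod_mult_cnj complex_mod_cnj mult.commute norm_one norm_mult
    power2_eq_square power2_eq_1_iff norm_ge_zero
        abs_of_nonneg abs_square_eq_1)
  then have "cmod d * cmod d = 1" using d by (metis norm_mult)
  then have "cmod d = 1" by (metis abs_norm_cancel abs_square_eq_1 power2_eq_square)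
  then have dd: "d * cnj d = 1" by (simp add: complex_norm_square[symmetric] flip: of_real_power)
  have dn: "d \<noteq> 0" using dd by auto
  have "xi j (d *s v) = (cnj d * (d * d)) *s v" by (simp add: xi_scale c d vector_smult_assoc)
  also have "cnj d * (d * d) = d" using dd by (simp add: mult.assoc[symmetric] mult.commute)
  finally have fx: "iota j (ro j (d *s v)) = d *s v" by (rule iota_ro[OF j])
  define x where "x = ro j (d *s v)"
  have "complex_of_real (bf j x x) = hform (d *s v) (d *s v)" unfolding hform_iota[symmetric] x_def fx ..
  also have "\<dots> = (d * cnj d) * hform v v" by (simp add: hform_simps)
  finally have "complex_of_real (bf j x x) = hform v v" using dd by simp
  then have "bf j x x < 0" using v(2) by (metis Re_complex_of_real)
  moreover have "L = cline (iota j x)" unfolding v(1) x_def fx by (simp only: cline_scale[OF dn])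
  ultimately show "L \<in> {cline (iota j x) | x. future j x}" using real_line_future[of j x] by blast
next
  fix L assume "L \<in> {cline (iota j x) | x. future j x}"
  then obtain x where x: "L = cline (iota j x)" "future j x" by blast
  have "Re (hform (iota j x) (iota j x)) < 0" using x(2) by (simp add: hform_iota future_def del: iota.simps)
  then have "L \<in> CH4" unfolding CH4_def x(1) by blast
  moreover have "xi j ` L = L"
  proof -
    have "xi j ` L = range (\<lambda>c. cnj c *s iota j x)"
      unfolding x(1) cline_def image_image xi_scale xi_iota[OF j] ..
    also have "\<dots> = (\<lambda>c. c *s iota j x) ` range cnj" by (simp add: image_image)
    also have "range cnj = UNIV" by (metis complex_cnj_cnj surjI)
    finally show ?thesis unfolding x(1) cline_def .
  qed
  ultimately show "L \<in> H4 j" unfolding H4_def by blast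
qed

lemma Stab_I:
  assumes j: "j \<le> 4" and g: "g \<in> Gam" and r: "rep j g u G" and u: "u \<noteq> 0"
    and G: "\<And>x. future j x \<Longrightarrow> future j (G x)" and H:
      "\<And>x. future j x \<Longrightarrow> future j (H x)" "\<And>x. G (H x) = x"
  shows "g \<in> Stab j"
proof -
  have "act g ` H4 j = {cline (iota j (G x)) | x. future j x}"
  proof -
    have "act g ` H4 j = {act g (cline (iota j x)) | x. future j x}" unfolding H4_iota[OF j] by blast
    then show ?thesis unfolding act_rep[OF r u] .
  qed
  also have "\<dots> = H4 j" unfolding H4_iota[OF j] using G H by (intro Collect_cong) metis
  finally show ?thesis using g by (simp add: Stab_def)
qed

section \<open>Reduction modulo theta\<close>

definition theta_multiple :: "complex set" where
  "theta_multiple = {theta * z | z. z \<in> Eis}"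

lemma theta_multiple_sum: "(\<And>i. i \<in> A \<Longrightarrow> f i \<in> theta_multiple)
  \<Longrightarrow> sum f A \<in> theta_multiple"
proof (induction A rule: infinite_finite_induct)
  case (insert x A)
  then obtain y z where "f x = theta * y" "y \<in> Eis" "sum f A = theta * z" "z \<in> Eis"
    unfolding theta_multiple_def by blast
  then have "sum f (insert x A) = theta * (y + z)" "y + z \<in> Eis"
    using insert by (auto simp: algebra_simps intro: Eis_add)
  then show ?case unfolding theta_multiple_def by blast
qed (auto simp: theta_multiple_def intro!: exI[of _ 0])

lemma theta_multiple_mult: "x \<in> theta_multiple \<Longrightarrow> y \<in> Eis \<Longrightarrow> x * y
  \<in> theta_multiple"
  unfolding theta_multiple_def by (auto intro: Eis_mult simp: mult.assoc)

lemma one_not_theta_multiple: "1 \<notin> theta_multiple"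
proof
  assume "1 \<in> theta_multiple"
  then obtain z where z: "theta * z = 1" "z \<in> Eis" unfolding theta_multiple_def by force
  obtain m where m: "z * cnj z = of_int m" using Eis_norm[OF z(2)] by blast
  have "(theta * z) * cnj (theta * z) = - (theta * theta) * (z * cnj z)" by (simp add: algebra_simps)
  then have "(theta * z) * cnj (theta * z) = 3 * (z * cnj z)" unfolding theta_sq by simp
  then have "of_int (3 * m) = (of_int 1 :: complex)" using z m by simp
  then have "3 * m = 1" unfolding of_int_eq_iff .
  then show False by presburger
qed

text \<open>The two diagonal blocks have sizes \<open>5 - j \<noteq> j\<close>, so every permutation of the
  indices meets them.\<close>

lemma no_antisymmetric_isometry:
  assumes k: "k \<in> Gam" and anti: "\<And>a b. sg j a * sg j b * cnj (k $ a $ b) = - k $ a $ b"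
  shows False
proof -
  \<comment> \<open>Between indices of equal sign the entries are purely imaginary, and purely
    imaginary Eisenstein integers are multiples of \<open>theta\<close>.\<close>
  have block: "k $ a $ b \<in> theta_multiple" if "sg j a = sg j b" for a b
  proof -
    have "cnj (k $ a $ b) = - k $ a $ b" using anti[of a b] that by (simp add: sg_sq)
    then obtain m :: int where "k $ a $ b = theta * of_int m" using Eis_imaginary[OF Gam_Eis[OF k]] by blast
    then show ?thesis unfolding theta_multiple_def using Eis_of_int by blast
  qed
  have meets: "\<exists>a. sg j a = sg j (p a)" if "p permutes (UNIV :: 5 set)" for p
  proof (rule ccontr)
    assume n: "\<not> ?thesis"
    let ?N = "{a. sg j a = 1}"
    have pm: "sg j a = 1 \<or> sg j a = -1" for a by (simp add: sg_def)
    have bij: "bij p" using that by (simp add: permutes_bij)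
    have "p ` ?N = - ?N"
    proof (intro equalityI subsetI)
      fix b assume "b \<in> - ?N"
      moreover obtain a where "b = p a" using bij by (metis bij_pointE)
      ultimately show "b \<in> p ` ?N" using n pm by (metis (mono_tags, lifting) ComplD image_eqI
        mem_Collect_eq)
    next
      fix b assume "b \<in> p ` ?N"
      then obtain a where "b = p a" "sg j a = 1" by blast
      then show "b \<in> - ?N" using n by (metis (mono_tags, lifting) ComplI mem_Collect_eq)
    qed
    then have "card (- ?N) = card ?N" using bij by (metis bij_is_inj card_image inj_on_subset subset_UNIV)
    moreover have "card ?N + card (- ?N) = 5"
      using card_Un_disjoint[of ?N "- ?N"] by (simp add: Compl_partition)
    ultimately show False by presburger
  qed
  have "det k \<in> theta_multiple" unfolding det_def
  proof (rule theta_multiple_sum)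
    fix p assume "p \<in> {p. p permutes (UNIV :: 5 set)}"
    then obtain a where a: "sg j a = sg j (p a)" using meets by blast
    have "(\<Prod>i\<in>UNIV. k $ i $ p i) = k $ a $ p a * (\<Prod>i\<in>UNIV - {a}. k $ i $ p i)"
      by (rule prod.remove) auto
    moreover have "(\<Prod>i\<in>UNIV - {a}. k $ i $ p i) \<in> Eis" by (intro Eis_prod Gam_Eis k)
    ultimately have "(\<Prod>i\<in>UNIV. k $ i $ p i) \<in> theta_multiple" using block[OF a]
      theta_multiple_mult by simp
    then show "of_int (sign p) * (\<Prod>i\<in>UNIV. k $ i $ p i) \<in> theta_multiple"
      using theta_multiple_mult[OF _ Eis_of_int] unfolding mult.commute[of "of_int (sign p)"] by blast
  qed
  moreover obtain h where h: "h \<in> Gam" "k ** h = mat 1" using Gam_inverse[OF k] by blast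
  have "det h \<in> Eis" unfolding det_def by (intro Eis_sum Eis_mult Eis_prod Eis_of_int Gam_Eis h)
  ultimately have "det k * det h \<in> theta_multiple" by (rule theta_multiple_mult)
  then show False using one_not_theta_multiple by (simp add: h(2) flip: det_mul)
qed

lemma matrix_eqI_basis:
  fixes g h :: cmat
  assumes "\<And>x. x \<in> {(1, 0, 0, 0, 0), (0, 1, 0, 0, 0), (0, 0, 1, 0, 0), (0, 0, 0, 1, 0), (0, 0, 0,
    0, 1)}
    \<Longrightarrow> g *v iota j x = h *v iota j x"
  shows "g = h"
proof -
  have "g *v v = h *v v" for v
    by (subst (1 2) iota_decomp[of v j])
      (simp only: matrix_vector_right_distrib vector_scalar_commute assms insert_iff simp_thms)
  then show ?thesis by (simp add: matrix_eq)
qed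


theorem Stab_rep:
  assumes j: "j \<le> 4" and g: "g \<in> Stab j"
  obtains u G where "u \<in> EisUnits" "rep j g u G" "linear G" "\<And>x y. bf j (G x) (G y) = bf j x y"
    "\<And>x. integral5 x \<Longrightarrow> integral5 (G x)"
      "\<And>x. future j x \<Longrightarrow> future j (G x)"
proof -
  let ?e = "(1, 0, 0, 0, 0) :: r5"
  have gG: "g \<in> Gam" and gH: "act g ` H4 j = H4 j" using g by (auto simp: Stab_def)
  have fe: "future j ?e" by (simp add: future_def)
  have H1: "\<exists>c y. c \<noteq> 0 \<and> g *v iota j x = c *s iota j y" if "future j x" for x
  proof -
    have "act g (cline (iota j x)) \<in> H4 j" using that gH unfolding H4_iota[OF j] by blast
    then obtain y where y: "act g (cline (iota j x)) = cline (iota j y)" unfolding H4_iota[OF j] by blast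
    have "g *v iota j x \<in> cline (iota j y)" unfolding y[symmetric] act_cline by (rule cline_self)
    then obtain c where c: "g *v iota j x = c *s iota j y" using cline_memD by blast
    have "hform (g *v iota j x) (g *v iota j x) \<noteq> 0"
      using that by (simp add: Gam_hform[OF gG] hform_iota future_def del: iota.simps)
    then have "c \<noteq> 0" unfolding c hform_scale by auto
    then show ?thesis using c by blast
  qed
  \<comment> \<open>\<open>g'\<close> is \<open>\<xi>\<^sub>j g \<xi>\<^sub>j\<close>; each negative real
    vector is an eigenvector of \<open>g\<inverse> g'\<close>, which is therefore a scalar
    \<open>l\<close>.\<close>
  define g' :: cmat where "g' = (\<chi> a b. sg j a * sg j b * cnj (g $ a $ b))"
  have g'_xi: "g' *v xi j v = xi j (g *v v)" for v
  proof -
    have "sg j a * sg j b * cnj (g $ a $ b) * (sg j b * cnj (v $ b)) = sg j a * (cnj (g $ a $ b) * cnj (v $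
      b))" for a b
      using sg_sq(1)[of j b] by (simp add: algebra_simps)
    then show ?thesis
      unfolding vec_eq_iff matrix_vector_mult_def g'_def xi_nth vec_lambda_beta cnj_sum complex_cnj_mult
        sum_distrib_left by (simp only: simp_thms)
  qed
  have H2: "\<exists>l. l * cnj l = 1 \<and> g' *v iota j x = l *s (g *v iota j x)" if fx: "future j x" for x
  proof -
    obtain c y where c: "c \<noteq> 0" "g *v iota j x = c *s iota j y" using H1[OF fx] by blast
    have "g' *v iota j x = xi j (g *v iota j x)" using g'_xi[of "iota j x"] by (simp only: xi_iota[OF j])
    also have "\<dots> = (cnj c / c) *s (c *s iota j y)" using c(1) by (simp add: c(2) xi_scale xi_iota[OF
      j] vector_smult_assoc del: iota.simps)
    finally have "g' *v iota j x = (cnj c / c) *s (g *v iota j x)" by (simp only: c(2))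
    then show ?thesis using c(1) by (intro exI[of _ "cnj c / c"]) simp
  qed
  obtain l where l: "l * cnj l = 1" "g' *v iota j ?e = l *s (g *v iota j ?e)" using H2[OF fe] by blast
  \<comment> \<open>The vector \<open>b\<close> has positive norm in the application, so it is
    reached through the negative vectors \<open>2 *\<^sub>R ?e + b\<close> and
    \<open>2 *\<^sub>R ?e - b\<close>; the factor 2 suffices because weights are at most 3. Adding
    their two eigenvector equations and using that \<open>?P\<close> and \<open>?Q\<close> are
    orthogonal makes all eigenvalues equal to \<open>l\<close>.\<close>
  have basis: "g' *v iota j b = l *s (g *v iota j b)"
    if b: "bf j b ?e = 0" "bf j b b \<noteq> 0" "future j (2 *\<^sub>R ?e + b)"
      "future j (2 *\<^sub>R ?e - b)" for b
  proof -
    let ?P = "g *v iota j ?e" and ?Q = "g *v iota j b"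
    obtain m where m: "g' *v iota j (2 *\<^sub>R ?e + b) = m *s (g *v iota j (2 *\<^sub>R ?e + b))" using
      H2[OF b(3)] by blast
    obtain n where n: "g' *v iota j (2 *\<^sub>R ?e - b) = n *s (g *v iota j (2 *\<^sub>R ?e - b))" using
      H2[OF b(4)] by blast
    have two: "iota j (2 *\<^sub>R ?e + b) = 2 *s iota j ?e + iota j b"
      "iota j (2 *\<^sub>R ?e - b) = 2 *s iota j ?e - iota j b"
      by (simp_all only: iota_add iota_diff iota_scaleR of_real_numeral)
    have m': "2 *s (l *s ?P) + g' *v iota j b = m *s (2 *s ?P + ?Q)"
      using m unfolding two matrix_vector_right_distrib vector_scalar_commute l(2) .
    have n': "2 *s (l *s ?P) - g' *v iota j b = n *s (2 *s ?P - ?Q)"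
      using n unfolding two matrix_vector_mult_diff_distrib vector_scalar_commute l(2) .
    have PQ: "hform ?P ?P = -1" "hform ?Q ?P = 0" "hform ?P ?Q = 0" "hform ?Q ?Q \<noteq> 0"
      using b(1,2) bf.B_sym[of j ?e b]
      by (simp_all add: Gam_hform[OF gG] hform_iota del: iota.simps bf.simps) simp
    have s: "4 *s (l *s ?P) = (2 * (m + n)) *s ?P + (m - n) *s ?Q"
      using arg_cong2[OF m' n', of "(+)"] by (simp add: vec_eq_iff algebra_simps)
    have "hform (4 *s (l *s ?P)) ?P = hform ((2 * (m + n)) *s ?P + (m - n) *s ?Q) ?P" by (simp only: s)
    then have "- (4 * l) = - (2 * (m + n))" using PQ by (simp add: hform_simps)
    then have lmn: "4 * l = 2 * (m + n)" by (simp only: neg_equal_iff_equal)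
    have "hform (4 *s (l *s ?P)) ?Q = hform ((2 * (m + n)) *s ?P + (m - n) *s ?Q) ?Q" by (simp only: s)
    then have "m = n" using PQ by (simp add: hform_simps)
    then have "l = m" using lmn by simp
    then show ?thesis using m' by (simp add: vec_eq_iff algebra_simps)
  qed
  have g'l: "g' = mat l ** g"
  proof (rule matrix_eqI_basis[where j = j])
    fix x :: r5
    assume "x \<in> {?e, (0, 1, 0, 0, 0), (0, 0, 1, 0, 0), (0, 0, 0, 1, 0), (0, 0, 0, 0, 1)}"
    then have "x = ?e \<or> (bf j x ?e = 0 \<and> bf j x x \<noteq> 0 \<and> future j (2 *\<^sub>R ?e + x)
      \<and> future j (2 *\<^sub>R ?e - x))"
      by (auto simp: future_def wt_def zero_prod_def split: if_splits)
    then have "g' *v iota j x = l *s (g *v iota j x)" using l(2) basis by blast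
    then show "g' *v iota j x = (mat l ** g) *v iota j x"
      by (simp only: mat_mult_vec flip: matrix_vector_mul_assoc)
  qed
  \<comment> \<open>On the preimage of \<open>?e\<close> under \<open>g\<close>, which is integral,
    \<open>g'\<close> takes the value \<open>l *s iota j ?e\<close>; since \<open>g'\<close> has
    integral entries, \<open>l\<close> is integral.\<close>
  have "l \<in> Eis"
  proof -
    obtain h where h: "h \<in> Gam" "g ** h = mat 1" using Gam_inverse[OF gG] by blast
    let ?z = "h *v iota j ?e"
    have "?z \<in> Lam" by (intro Gam_Lam h) (simp add: iota_Lam del: iota.simps)
    then have "g' *v ?z \<in> Lam"
      by (rule Lam_mult[rotated]) (auto simp: g'_def sg_def intro: Eis_cnj Gam_Eis[OF gG])
    moreover have "g' *v ?z = l *s iota j ?e"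
      unfolding g'l by (simp only: mat_mult_vec vector_smult_lid h(2) matrix_vector_mul_assoc[of g h]
        matrix_vector_mul_lid flip: matrix_vector_mul_assoc[of "mat l" g])
    ultimately show ?thesis by (simp add: Lam_def forall_5)
  qed
  then have "l \<in> EisUnits" using l(1) by (rule EisUnitsI)
  then obtain u s where u: "u \<in> EisUnits" "s \<in> {1, -1}"
    "l * u * u = s" using EisUnits_square_root by blast
  have uc: "u * cnj u = 1" using EisUnits_norm[OF u(1)] .
  \<comment> \<open>Because \<open>l * u * u = s\<close>, dividing \<open>g\<close> by
    \<open>u\<close> reduces its failure to commute with \<open>xi j\<close> to the sign
    \<open>s\<close>.\<close>
  define k where "k = mat (cnj u) ** g"
  have kG: "k \<in> Gam" unfolding k_def by (intro Gam_mult Gam_scalar EisUnits_cnj u gG)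
  have mat_nth: "(mat c ** (A :: cmat)) $ a $ b = c * A $ a $ b" for c A a b
    by (simp add: matrix_matrix_mult_def mat_def if_distrib if_distribR cong: if_cong)
  have ks: "sg j a * sg j b * cnj (k $ a $ b) = s * k $ a $ b" for a b
  proof -
    have "sg j a * sg j b * cnj (k $ a $ b) = u * (g' $ a $ b)" by (simp add: k_def mat_nth g'_def)
    also have "\<dots> = (l * u * u) * (cnj u * g $ a $ b) * 1" using uc by (simp add: g'l mat_nth
      algebra_simps) 
    finally show ?thesis by (simp add: u(3) k_def mat_nth)
  qed
  have s1: "s = 1" using u(2) ks no_antisymmetric_isometry[OF kG, of j] by auto
  have kx: "xi j (k *v iota j x) = k *v iota j x" for x
  proof -
    have "cnj (k $ a $ b) * sg j a = k $ a $ b * sg j b" for a b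
    proof -
      have "cnj (k $ a $ b) * sg j a = (sg j a * sg j b * cnj (k $ a $ b)) * sg j b"
        using sg_sq(1)[of j b] by (simp add: algebra_simps)
      then show ?thesis by (simp add: ks s1)
    qed
    then have "sg j a * (cnj (k $ a $ b) * cnj (v $ b)) = k $ a $ b * (sg j b * cnj (v $ b))" for a b v
      by (metis mult.assoc mult.commute)
    then have "xi j (k *v v) = k *v xi j v" for v
      unfolding vec_eq_iff matrix_vector_mult_def xi_nth vec_lambda_beta cnj_sum complex_cnj_mult
        sum_distrib_left by (simp only: simp_thms)
    then show ?thesis by (simp only: xi_iota[OF j])
  qed
  define G where "G x = ro j (k *v iota j x)" for x
  have kG': "k *v iota j x = iota j (G x)" for x unfolding G_def by (simp only: iota_ro[OF j kx])
  have gk: "g *v v = u *s (k *v v)" for v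
    using uc by (simp add: k_def mat_mult_vec vec_eq_iff mult.assoc[symmetric] flip: matrix_vector_mul_assoc)
  have lin: "linear G"
    by (rule linearI) (simp_all add: G_def iota_add iota_scaleR matrix_vector_right_distrib
      vector_scalar_commute ro_add ro_scaleR del: iota.simps)
  have iso: "bf j (G x) (G y) = bf j x y" for x y
  proof -
    have "complex_of_real (bf j (G x) (G y)) = of_real (bf j x y)"
      by (simp only: hform_iota[symmetric] kG'[symmetric] Gam_hform[OF kG])
    then show ?thesis by (simp only: of_real_eq_iff)
  qed
  have int: "integral5 (G x)" if "integral5 x" for x
    using that Gam_Lam[OF kG, of "iota j x"] by (simp only: kG' iota_Lam)
  have neg: "bf j (G x) (G x) < 0" if "future j x" for x using that iso by (simp add: future_def)
  \<comment> \<open>The whole future cone is sent to one half of the cone, decided by the image of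
    \<open>?e\<close>; if it is the wrong half, a sign is moved from \<open>G\<close> to the
    unit.\<close>
  have sgn: "0 < fst (G x) * fst (G ?e)" if "future j x" for x
    using negative_same_sign[OF neg[OF that] neg[OF fe]] future_bf[OF that fe] by (simp only: iso)
  show ?thesis
  proof (cases "0 < fst (G ?e)")
    case True
    have "future j (G x)" if "future j x" for x
      using sgn[OF that] neg[OF that] True by (simp add: future_def zero_less_mult_iff)
    then show ?thesis using that[of u G] u(1) gk lin iso int by (simp add: rep_def kG' del: iota.simps)
  next
    case False
    have fut: "future j (- G x)" if "future j x" for x
      using sgn[OF that] neg[OF that] False by (simp add: future_def zero_less_mult_iff bf.B_simps)
    show ?thesis
    proof (rule that[of "- u" "\<lambda>x. - G x"])
      show "rep j g (- u) (\<lambda>x. - G x)"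
        unfolding rep_def using gk kG' by (simp add: iota_minus vec_eq_iff del: iota.simps)
      show "linear (\<lambda>x. - G x)" using lin by (rule linear_compose_neg)
      show "integral5 (- G x)" if "integral5 x" for x using int[OF that] by (cases "G x") auto
    qed (use u(1) iso fut in \<open>auto simp: bf.B_simps EisUnits_minus simp del: bf.simps\<close>)
  qed
qed

section \<open>The reflection groups\<close>

abbreviation sm :: "nat \<Rightarrow> nat \<Rightarrow> cmat" where
  "sm j i \<equiv> reflm (roots j ! i)"

abbreviation root_word :: "nat \<Rightarrow> nat list \<Rightarrow> r5 \<Rightarrow> r5" where
  "root_word j \<equiv> refl_word (bf j) ((!) (rts j))"

lemma length_roots: "j \<le> 4 \<Longrightarrow> length (roots j) = length (rts j)"
  by (simp add: roots_iota)

lemma roots_nth: "j \<le> 4 \<Longrightarrow> i < length (rts j) \<Longrightarrow> roots j ! i = iota j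
  (rts j ! i)"
  by (simp add: roots_iota del: iota.simps)

lemma mprod_simps [simp]: "mprod [] = mat 1" "mprod (g # gs) = g ** mprod gs"
  by (simp_all add: mprod_def)

lemma mprod_alternating: "mprod (map s (concat (replicate m [i, k]))) = mprod (replicate m (s i ** s k))"
  by (induction m) (simp_all add: matrix_mul_assoc)

lemma refl_word_alternating:
  "refl_word B \<alpha> (concat (replicate m [i, k])) = (reflect B (\<alpha> i) \<circ> reflect B (\<alpha>
    k)) ^^ m"
  by (induction m) (simp_all add: fun_eq_iff)

lemma rep_word:
  assumes j: "j \<le> 4" and "set w \<subseteq> {..<length (rts j)}"
  shows "rep j (mprod (map (sm j) w)) 1 (root_word j w)"
  using assms(2)
proof (induction w)
  case Nil
  have "root_word j [] = id" by (simp add: refl_word_def)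
  then show ?case using rep_mat[of j 1] by (simp only: list.map mprod_simps)
next
  case (Cons i w)
  have eq: "root_word j (i # w) = reflect (bf j) (rts j ! i) \<circ> root_word j w"
    by (rule ext) (simp only: o_apply refl_word_Cons)
  have i: "i < length (rts j)" and w: "set w \<subseteq> {..<length (rts j)}" using Cons.prems by auto
  show ?case
    using rep_mult[OF rep_reflm[of j "rts j ! i"] Cons.IH[OF w]]
    by (simp only: eq list.map mprod_simps roots_nth[OF j i] mult_1)
qed

lemma root_reflection_Eis:
  assumes "j \<le> 4" "r \<in> set (roots j)"
  shows "reflm r $ a $ b \<in> Eis"
proof -
  have th: "x * theta * theta = -3 * x" for x
    by (simp only: mult.assoc theta_sq) simp
  have "\<forall>r\<in>set (roots j). \<forall>a b. reflm r $ a $ b \<in> Eis"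
    using assms(1)
    by (cases rule: le_4_cases)
      (simp_all add: roots_def reflm_def hform_expand forall_5 theta_sq th Eis_mult)
  then show ?thesis using assms(2) by blast
qed

lemma root_reflection_Gam:
  assumes j: "j \<le> 4" and i: "i < length (rts j)"
  shows "sm j i \<in> Gam"
proof -
  have E: "sm j i $ a $ b \<in> Eis" for a b using root_reflection_Eis[OF j] i length_roots[OF j] by simp
  have n: "bf j (rts j ! i) (rts j ! i) \<noteq> 0" using alpha_norm[OF j i] by simp
  have "hform (roots j ! i) (roots j ! i) \<noteq> 0"
    using n by (simp add: roots_nth[OF j i] hform_iota del: iota.simps)
  then have inv: "sm j i ** sm j i = mat 1" by (rule reflm_reflm)
  have "hform (sm j i *v v) (sm j i *v w) = hform v w" for v w
    by (rule hform_preserving_ext[where j = j])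
      (simp only: roots_nth[OF j i] reflm_iota hform_iota bf.B_refl[OF n])
  then show ?thesis using GamI[OF E E inv] by blast
qed

lemma word_Gam:
  assumes j: "j \<le> 4" and "set w \<subseteq> {..<length (rts j)}"
  shows "mprod (map (sm j) w) \<in> Gam"
  using assms(2) by (induction w) (auto intro: Gam_mult root_reflection_Gam[OF j] Gam_scalar)

text \<open>A word preserves the future cone, so the only unit scalar it can equal is 1. Relations
  modulo units thus become identities between real maps.\<close>

lemma pscalar_word:
  assumes j: "j \<le> 4" and w: "set w \<subseteq> {..<length (rts j)}"
  shows "pscalar (mprod (map (sm j) w)) \<longleftrightarrow> root_word j w = id"
proof
  let ?r = "root_word j w"
  assume "pscalar (mprod (map (sm j) w))"
  then obtain u where u: "u \<in> EisUnits" "mprod (map (sm j) w) = mat u" unfolding pscalar_def by blast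
  have "future j (?r (p5 j))"
    by (rule future_refl_word) (use w alpha_norm[OF j] p5_future[OF j] in auto)
  then show "?r = id"
    using rep_unique[OF rep_word[OF j w] rep_mat[of j u, folded u(2)] EisUnits_1 u(1), of
      "p5 j"] p5_future[OF j]
    by simp
next
  assume "root_word j w = id"
  then have "mprod (map (sm j) w) = mat 1" using rep_eqI[OF _ rep_mat[of j 1]] rep_word[OF j w] by simp
  then show "pscalar (mprod (map (sm j) w))" unfolding pscalar_def by (intro bexI[of _ 1]) auto
qed

lemma order_bound_mono: "order_bound c m \<Longrightarrow> k \<le> m \<Longrightarrow> order_bound c k"
  by (auto simp: order_bound_def)

text \<open>The exponents in \<open>cox_rels\<close> are least orders modulo units.
  \<open>refl_product_order\<close> supplies some exponent within the bound, which dominates the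
  least one, and \<open>order_bound\<close> passes to smaller exponents.\<close>

lemma chamber_rep_roots:
  assumes j: "j \<le> 4"
  shows "chamber_rep j (cox_rels (length (rts j)) (sm j))"
proof (rule chamber_rep.intro[OF j])
  let ?n = "length (rts j)" and ?R = "cox_rels (length (rts j)) (sm j)"
  have pord: "pord g > 0 \<and> pscalar (mprod (replicate (pord g) g))"
    if "\<exists>m>0. pscalar (mprod (replicate m g))" for g
    unfolding pord_def using that by (rule LeastI_ex)
  have pord_le: "pord g \<le> m" if "0 < m" "pscalar (mprod (replicate m g))" for g m
    unfolding pord_def using that by (intro Least_le) simp
  have sc: "pscalar (mprod (replicate m (sm j i ** sm j k))) \<longleftrightarrow>
      root_word j (concat (replicate m [i, k])) = id" if "i < ?n" "k < ?n" for i k m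
    unfolding mprod_alternating[of "sm j" m i k, symmetric] by (rule pscalar_word[OF j]) (use that in auto)
  have R: "\<exists>i k. r = concat (replicate (pord (sm j i ** sm j k)) [i, k]) \<and> i < ?n \<and> k <
    ?n \<and>
      root_word j r = id" if r: "r \<in> ?R" for r
  proof -
    obtain i k where ik: "r = concat (replicate (pord (sm j i ** sm j k)) [i, k])" "i < ?n" "k < ?n"
        "\<exists>m>0. pscalar (mprod (replicate m (sm j i ** sm j k)))"
      using r unfolding cox_rels_def by blast
    then show ?thesis using pord[OF ik(4)] sc[OF ik(2,3)] by auto
  qed
  show "refl_rep ?n ?R (bf j) ((!) (rts j))"
  proof
    fix r assume "r \<in> ?R"
    then obtain i k where ik: "r = concat (replicate (pord (sm j i ** sm j k)) [i, k])" "i < ?n" "k < ?n"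
      "root_word j r = id" using R by blast
    show "set r \<subseteq> {..<?n}" using ik by auto
    show "even (length r)" unfolding ik(1) by (simp add: length_concat sum_list_replicate)
    show "root_word j r = id" by fact
  next
    fix i assume i: "i < ?n"
    \<comment> \<open>On the diagonal the least order is 1, not 2: \<open>sm j i ** sm j i\<close>
      is already scalar, so the relator is \<open>[i, i]\<close>.\<close>
    have "root_word j (concat (replicate 1 [i, i])) = id"
      using alpha_norm[OF j i] by (simp add: fun_eq_iff bf.refl_refl del: split_paired_All)
    then have 1: "pscalar (mprod (replicate 1 (sm j i ** sm j i)))" using sc[OF i i] by blast
    then have ex: "\<exists>m>0. pscalar (mprod (replicate m (sm j i ** sm j i)))" by (intro exI[of _ 1]) simp
    have "pord (sm j i ** sm j i) = 1" using pord[OF ex] pord_le[OF _ 1] by simp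
    then have "[i, i] = concat (replicate (pord (sm j i ** sm j i)) [i, i])" by simp
    then show "[i, i] \<in> ?R" unfolding cox_rels_def using i ex by blast
    show "0 < bf j (rts j ! i) (rts j ! i)" by (rule alpha_norm[OF j i])
  next
    fix i k assume ik: "i < ?n" "k < ?n" "i \<noteq> k"
    show "bf j (rts j ! i) (rts j ! k) \<le> 0" by (rule alpha_pair[OF j ik])
    define c where "c = cartan_product (bf j) (rts j ! i) (rts j ! k)"
    have "4 \<le> c \<or> (\<exists>m>0. concat (replicate m [i, k]) \<in> ?R \<and> order_bound c m)"
    proof (cases "4 \<le> c")
      case False
      then have "c \<in> {0, 1, 2, 3}" using alpha_pair(2)[OF j ik] by (auto simp: c_def)
      then obtain m where m: "0 < m" "order_bound c m" "(reflect (bf j) (rts j ! i) \<circ> reflect (bf j)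
        (rts j ! k)) ^^ m = id"
        using bf.refl_product_order[OF alpha_norm[OF j ik(1)] alpha_norm[OF j ik(2)] c_def] by blast
      then have p: "pscalar (mprod (replicate m (sm j i ** sm j k)))"
        using sc[OF ik(1,2)] refl_word_alternating[of "bf j" "(!) (rts j)" m i k] by simp
      then have ex: "\<exists>m>0. pscalar (mprod (replicate m (sm j i ** sm j k)))" using m by blast
      have "concat (replicate (pord (sm j i ** sm j k)) [i, k]) \<in> ?R"
        unfolding cox_rels_def using ik ex by blast
      moreover have "order_bound c (pord (sm j i ** sm j k))"
        using order_bound_mono[OF m(2)] pord_le[OF m(1) p] by blast
      ultimately show ?thesis using pord[OF ex] by blast
    qed simp
    then show "4 \<le> cartan_product (bf j) (rts j ! i) (rts j ! k) \<or>
      (\<exists>m>0. concat (replicate m [i, k]) \<in> ?R \<and>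
        order_bound (cartan_product (bf j) (rts j ! i) (rts j ! k)) m)"
      unfolding c_def .
  qed
qed

text \<open>The map \<open>dg\<close> in complex coordinates: entries between the scaled coordinate
  4 and the others acquire \<open>theta\<close> or its inverse, and
  \<open>3 / theta = - theta\<close>. Coordinate 3 is fixed and unmixed, so scaling it as well, as
  for \<open>j = 2\<close>, leaves the matrix unchanged.\<close>

definition dmat :: cmat where
  "dmat = (\<chi> a. if a = 0 then vec5 3 2 1 0 (- theta) else if a = 1 then vec5 (-2) (-1) (-1) 0 theta
     else if a = 2 then vec5 (-1) (-1) (-1) 0 0 else if a = 3 then vec5 0 0 0 1 0
     else vec5 (- theta) (- theta) 0 0 (-1))"

lemma rep_dmat:
  assumes "j = 1 \<or> j = 2"
  shows "rep j dmat 1 dg"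
proof -
  have th: "theta * (theta * z) = - 3 * z" for z
    by (simp only: mult.assoc[symmetric] theta_sq)
  have "dmat *v iota j (x0, x1, x2, x3, x4) = iota j (dg (x0, x1, x2, x3, x4))" for x0 x1 x2 x3 x4
    using assms by (auto simp: vec_eq_iff forall_5 matrix_vector_mult_def dmat_def sum_5 tt_def
      algebra_simps th)
  then show ?thesis by (simp add: rep_def del: iota.simps dg.simps)
qed

lemma dmat_Gam: "dmat \<in> Gam"
proof (rule GamI)
  show "dmat $ a $ b \<in> Eis" "dmat $ a $ b \<in> Eis" for a b
    using exhaust_5[of a] exhaust_5[of b] by (auto simp: dmat_def)
  have r: "rep 1 dmat 1 dg" by (rule rep_dmat) simp
  have "dg \<circ> dg = id" by (rule ext) (simp only: o_apply dg_dg id_apply)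
  then show "dmat ** dmat = mat 1" using rep_eqI[OF _ rep_mat[of 1 1]] rep_mult[OF r r] by simp
  show "hform (dmat *v v) (dmat *v w) = hform v w" for v w
    by (rule hform_preserving_ext[where j = 1])
      (use r in \<open>simp add: rep_def hform_iota bf_dg del: iota.simps bf.simps dg.simps
        split_paired_All\<close>)
qed

text \<open>The definition of \<open>Cj\<close> leaves the sign of the representative open. Applied
  to its negative, this shows that a representative satisfying the inequalities lies in the future
  cone.\<close>

lemma opposite_chamber_past:
  assumes "j \<le> 4" "\<And>r. r \<in> set (rts j) \<Longrightarrow> 0 \<le> bf j v r"
  shows "fst v \<le> 0"
proof -
  obtain v0 v1 v2 v3 v4 where v: "v = (v0, v1, v2, v3, v4)" by (cases v) auto
  have L: "\<forall>r\<in>set (rts j). 0 \<le> bf j v r" using assms(2) by blast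
  show ?thesis using assms(1)
    by (cases rule: le_4_cases) (use L in \<open>simp_all add: v rts_def wt_def\<close>)
qed

locale root_system =
  fixes j :: nat
  assumes le_4: "j \<le> 4"
begin

sublocale chamber_rep j "cox_rels (length (rts j)) (sm j)"
  by (rule chamber_rep_roots[OF le_4])

text \<open>The meeting point of two groups: the one generated by all reflections and the one
  generated by the listed roots are both shown to equal this set.\<close>

definition inW :: "cmat \<Rightarrow> bool" where
  "inW g \<longleftrightarrow> (\<exists>u w. u \<in> EisUnits \<and> set w \<subseteq> {..<nr} \<and> rep
    j g u (rho w))"

lemma inWE:
  assumes "inW g"
  obtains u w where "u \<in> EisUnits" "set w \<subseteq> {..<nr}" "rep j g u (rho w)"
  using assms unfolding inW_def by blast

lemma inWI: "u \<in> EisUnits \<Longrightarrow> set w \<subseteq> {..<nr} \<Longrightarrow> rep j g u (rho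
  w) \<Longrightarrow> inW g"
  unfolding inW_def by blast

lemma rho_append: "rho (v @ w) = rho v \<circ> rho w"
  by (rule ext) (simp only: o_apply refl_word_append)

lemma rho_Nil: "rho [] = id"
  by (rule ext) (simp only: id_apply refl_word_Nil)

lemma rep_scaled_word:
  assumes "set w \<subseteq> {..<nr}"
  shows "rep j (mat u ** mprod (map (sm j) w)) u (rho w)"
  using rep_mult[OF rep_mat[of j u] rep_word[OF le_4 assms]] by (simp only: mult_1_right id_o)

lemma inW_eq:
  assumes "inW g"
  obtains u w where "u \<in> EisUnits" "set w \<subseteq> {..<nr}" "g = mat u ** mprod (map (sm j) w)"
proof -
  obtain u w where uw: "u \<in> EisUnits" "set w \<subseteq> {..<nr}"
    "rep j g u (rho w)" using assms by (rule inWE)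
  then have "g = mat u ** mprod (map (sm j) w)" using rep_eqI rep_scaled_word by blast
  then show ?thesis using that uw by blast
qed

lemma inW_mult:
  assumes "inW g" "inW h"
  shows "inW (g ** h)"
proof -
  obtain u w where g: "u \<in> EisUnits" "set w \<subseteq> {..<nr}"
    "rep j g u (rho w)" using assms(1) by (rule inWE)
  obtain v z where h: "v \<in> EisUnits" "set z \<subseteq> {..<nr}"
    "rep j h v (rho z)" using assms(2) by (rule inWE)
  have "rep j (g ** h) (u * v) (rho (w @ z))" unfolding rho_append by (rule rep_mult[OF g(3) h(3)])
  then show ?thesis using g h by (intro inWI[OF EisUnits_mult]) auto
qed

lemma inW_scalar: "u \<in> EisUnits \<Longrightarrow> inW (mat u)"
  using inWI[of u "[]"] rep_mat[of j u] by (simp only: rho_Nil list.set empty_subsetI)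

lemma rho_inverse: "set w \<subseteq> {..<nr} \<Longrightarrow> rho w \<circ> rho (rev w) = id"
  by (rule ext) (simp only: o_apply id_apply rho_rev')

lemma inW_inverse:
  assumes "inW g"
  shows "inW (matrix_inv g)"
proof -
  obtain u w where g: "u \<in> EisUnits" "set w \<subseteq> {..<nr}"
    "rep j g u (rho w)" using assms by (rule inWE)
  have w: "set (rev w) \<subseteq> {..<nr}" using g by simp
  let ?h = "mat (cnj u) ** mprod (map (sm j) (rev w))"
  have h: "rep j ?h (cnj u) (rho (rev w))" by (rule rep_scaled_word[OF w])
  have "rep j (g ** ?h) 1 id"
    using rep_mult[OF g(3) h] by (simp only: EisUnits_norm[OF g(1)] rho_inverse[OF g(2)])
  then have "g ** ?h = mat 1" using rep_eqI rep_mat by blast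
  then have "matrix_inv g = ?h" by (rule matrix_inv_eqI)
  then show ?thesis using inWI[OF EisUnits_cnj[OF g(1)] w] h by simp
qed

lemma inW_Stab:
  assumes "inW g"
  shows "g \<in> Stab j"
proof -
  obtain u w where g: "u \<in> EisUnits" "set w \<subseteq> {..<nr}" "g = mat u ** mprod (map (sm j) w)"
    using assms by (rule inW_eq)
  have G: "g \<in> Gam" unfolding g(3) by (intro Gam_mult Gam_scalar word_Gam le_4 g)
  have r: "rep j g u (rho w)" unfolding g(3) by (rule rep_scaled_word[OF g(2)])
  show ?thesis
    by (rule Stab_I[OF le_4 G r EisUnits_nz[OF g(1)], of "rho (rev w)"])
      (use g(2) future_rho[OF g(2)] future_rho[of "rev w"] rho_rev'[OF g(2)] in auto)
qed

lemma Stab_cases: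
  assumes "g \<in> Stab j"
  obtains u w where "u \<in> EisUnits" "set w \<subseteq> {..<nr}" "rep j g u (rho w)"
    | u w where "u \<in> EisUnits" "set w \<subseteq> {..<nr}" "j = 1 \<or> j = 2"
      "rep j g u (rho w \<circ> dg)"
proof -
  obtain u G where u: "u \<in> EisUnits" "rep j g u G" and G: "linear G"
    "\<And>x y. bf j (G x) (G y) = bf j x y"
    "\<And>x. integral5 x \<Longrightarrow> integral5 (G x)"
      "\<And>x. future j x \<Longrightarrow> future j (G x)"
    using Stab_rep[OF le_4 assms] by blast
  obtain w where w: "set w \<subseteq> {..<nr}" "G = rho w \<or> (j = 1 \<or> j = 2) \<and> G = rho w
    \<circ> dg"
    using lattice_automorphism[OF G] by blast
  then show ?thesis using u that by blast
qed

text \<open>The mirror vector \<open>r\<close> is an arbitrary complex vector, and \<open>g\<close>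
  is a reflection only up to a unit. Once that unit is absorbed, \<open>r\<close> turns out to be a
  complex multiple of a real vector, so that \<open>reflection_in_rho\<close> applies.\<close>

lemma reflection_inW:
  assumes "g \<in> ReflS j"
  shows "inW g"
proof -
  have gS: "g \<in> Stab j" using assms by (simp add: ReflS_def)
  obtain r v where r: "0 < Re (hform r r)" and v: "v \<in> EisUnits" "g = mat v ** reflm r"
    using assms unfolding ReflS_def pequiv_def by blast
  obtain u G where u: "u \<in> EisUnits" "rep j g u G" and G: "linear G"
    "\<And>x y. bf j (G x) (G y) = bf j x y"
    "\<And>x. integral5 x \<Longrightarrow> integral5 (G x)"
      "\<And>x. future j x \<Longrightarrow> future j (G x)"
    using Stab_rep[OF le_4 gS] by blast
  define q where "q = cnj v * u"
  have q: "q \<in> EisUnits" unfolding q_def by (intro EisUnits_mult EisUnits_cnj u v)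
  have vv: "cnj v * v = 1" using EisUnits_norm[OF v(1)] by (simp add: mult.commute)
  have rq: "reflm r *v iota j x = q *s iota j (G x)" for x
  proof -
    have "v *s (reflm r *v iota j x) = u *s iota j (G x)"
      using repD[OF u(2), of x] unfolding v(2) by (simp only: mat_mult_vec flip: matrix_vector_mul_assoc)
    then have "cnj v *s (v *s (reflm r *v iota j x)) = cnj v *s (u *s iota j (G x))" by (simp only:)
    then show ?thesis by (simp only: vector_smult_assoc vv vector_smult_lid q_def)
  qed
  let ?e = "(1, 0, 0, 0, 0) :: r5"
  have fe: "future j ?e" by (simp add: future_def)
  define R where "R = Re (hform r r)"
  have hr: "hform r r = of_real R" unfolding R_def by (rule hform_self_real)
  have R: "0 < R" using r by (simp add: R_def)
  \<comment> \<open>Pairing the image of \<open>?e\<close> with \<open>?e\<close> shows that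
    \<open>q\<close> times a negative real number is a negative real number, so \<open>q\<close> is
    a positive real unit.\<close>
  have q1: "q = 1"
  proof -
    define a where "a = hform (iota j ?e) r"
    have "hform (reflm r *v iota j ?e) (iota j ?e) = hform (iota j ?e) (iota j ?e) - 2 * a / of_real R * cnj a"
      unfolding reflm_vec hform_diff hform_scale a_def hr hform_cnj ..
    also have "\<dots> = of_real (- 1 - 2 * (cmod a)\<^sup>2 / R)"
      by (simp add: hform_iota complex_norm_square mult.assoc del: iota.simps of_real_power)
    finally have 1: "q * of_real (bf j (G ?e) ?e) = of_real (- 1 - 2 * (cmod a)\<^sup>2 / R)"
      unfolding rq hform_scale hform_iota .
    have b: "bf j (G ?e) ?e < 0" using future_bf[OF G(4)[OF fe] fe] .
    define t where "t = (- 1 - 2 * (cmod a)\<^sup>2 / R) / bf j (G ?e) ?e"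
    have "- 1 - 2 * (cmod a)\<^sup>2 / R < 0" using R by (smt (verit) divide_nonneg_pos zero_le_power2)
    then have t0: "0 < t" unfolding t_def using b by (rule divide_neg_neg)
    have qt: "q = of_real t" using 1 b by (simp add: t_def field_simps del: bf.simps)
    then have "of_real (t * t) = (1 :: complex)" using EisUnits_norm[OF q] by simp
    then have "t * t = 1" by (simp only: of_real_eq_1_iff)
    then have "t = 1" using t0 square_eq_1_iff[of t] by auto
    then show ?thesis using qt by simp
  qed
  have rG: "reflm r *v iota j x = iota j (G x)" for x using rq q1 by (simp only: vector_smult_lid)
  have "\<exists>x. hform (iota j x) r \<noteq> 0"
  proof (rule ccontr)
    assume "\<not> ?thesis"
    then have "hform (iota j x) r = 0" for x by blast
    then have "reflm r *v iota j x = mat 1 *v iota j x" for x by (simp add: reflm_vec del: iota.simps)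
    then have "reflm r = mat 1" by (rule matrix_eqI_iota)
    then have "reflm r *v r = r" by simp
    moreover have "reflm r *v r = r - 2 *s r" using hr R by (simp add: reflm_vec)
    ultimately have "2 *s r = 0" by simp
    then have "r = 0" by (simp add: vec_eq_iff)
    then show False using r by (simp add: hform_expand)
  qed
  then obtain x where x: "hform (iota j x) r \<noteq> 0" by (rule exE)
  define c where "c = 2 * hform (iota j x) r / hform r r"
  have c: "c \<noteq> 0" using x hr R by (simp add: c_def del: iota.simps)
  \<comment> \<open>The displacement of \<open>x\<close> is a nonzero multiple of \<open>r\<close>
    and is real, since both \<open>x\<close> and its image are.\<close>
  define b where "b = x - G x"
  have "iota j x - c *s r = iota j (G x)" using rG[of x] by (simp only: reflm_vec c_def)
  then have cr: "c *s r = iota j b" unfolding b_def iota_diff by (simp add: algebra_simps del: iota.simps)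
  have "complex_of_real (bf j b b) = hform (c *s r) (c *s r)" unfolding cr hform_iota ..
  also have "\<dots> = of_real ((cmod c)\<^sup>2 * R)" by (simp add: hform_simps hr complex_norm_square
    del: of_real_power)
  finally have "bf j b b = (cmod c)\<^sup>2 * R" by (simp only: of_real_eq_iff)
  then have b0: "0 < bf j b b" using c R by simp
  have "reflm r = reflm (iota j b)" unfolding cr[symmetric] using reflm_scale[OF c] by simp
  then have "iota j (G y) = iota j (reflect (bf j) b y)" for y using rG[of y] reflm_iota by metis
  then have Gb: "G = reflect (bf j) b" by (simp only: iota_inj) (rule ext)
  obtain w where w: "set w \<subseteq> {..<nr}" "G = rho w \<or> (j = 1 \<or> j = 2) \<and> G = rho w
    \<circ> dg"
    using lattice_automorphism[OF G] by blast
  then obtain w' where "set w' \<subseteq> {..<nr}" "G = rho w'"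
    using reflection_in_rho[OF b0 _ w(1)] unfolding Gb by metis
  then show ?thesis using inWI[OF u(1)] u(2) by blast
qed

lemma root_reflection_inW: "i < nr \<Longrightarrow> inW (sm j i)"
  using inWI[OF EisUnits_1, of "[i]"] rep_word[OF le_4, of "[i]"] by simp

lemma Wgen_eq:
  assumes S: "\<And>g. g \<in> S \<Longrightarrow> inW g" "\<And>i. i < nr \<Longrightarrow> sm j i \<in> S"
  shows "Wgen S = {g. inW g}"
proof (intro equalityI subsetI)
  fix g assume "g \<in> Wgen S"
  then obtain u ws where u: "u \<in> EisUnits" "set ws \<subseteq> S \<union> matrix_inv ` S"
    "g = mat u ** mprod ws"
    unfolding Wgen_def by blast
  have "inW (mprod ws)" using u(2)
    by (induction ws) (auto intro!: inW_mult intro: S(1) inW_inverse inW_scalar)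
  then show "g \<in> {g. inW g}" unfolding u(3) using inW_mult inW_scalar[OF u(1)] by blast
next
  fix g assume "g \<in> {g. inW g}"
  then obtain u w where g: "u \<in> EisUnits" "set w \<subseteq> {..<nr}" "g = mat u ** mprod (map (sm j) w)"
    using inW_eq by blast
  then have "set (map (sm j) w) \<subseteq> S \<union> matrix_inv ` S" using S(2) by auto
  then show "g \<in> Wgen S" unfolding Wgen_def using g by blast
qed

lemma root_reflection_ReflS:
  assumes "i < nr"
  shows "sm j i \<in> ReflS j"
proof -
  have "0 < Re (hform (roots j ! i) (roots j ! i))"
    using alpha_norm[OF le_4 assms] by (simp add: roots_nth[OF le_4 assms] hform_iota del: iota.simps)
  moreover have "pequiv (sm j i) (sm j i)" unfolding pequiv_def by (rule bexI[of _ 1]) auto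
  ultimately show ?thesis using inW_Stab[OF root_reflection_inW[OF assms]] unfolding ReflS_def by blast
qed

lemma W_eq: "W j = {g. inW g}"
  unfolding W_def by (rule Wgen_eq) (auto intro: reflection_inW root_reflection_ReflS)

lemma Wgen_roots_eq: "Wgen (reflm ` set (roots j)) = {g. inW g}"
proof (rule Wgen_eq)
  fix g assume "g \<in> reflm ` set (roots j)"
  then obtain i where "i < nr" "g = sm j i" unfolding length_roots[OF le_4, symmetric]
    by (metis imageE in_set_conv_nth)
  then show "inW g" using root_reflection_inW by blast
next
  show "sm j i \<in> reflm ` set (roots j)" if "i < nr" for i
    using that length_roots[OF le_4] by simp
qed

section \<open>The chamber as a fundamental domain\<close>

lemma chamber_scale:
  assumes "0 < c"
  shows "c *\<^sub>R x \<in> chamber \<longleftrightarrow> x \<in> chamber"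
  using assms by (simp add: chamber_def bf.B_simps mult_le_0_iff)

lemma Cj_eq: "Cj j = {cline (iota j x) | x. future j x \<and> x \<in> chamber}"
proof (intro equalityI subsetI)
  fix L assume "L \<in> Cj j"
  then obtain v where v: "L \<in> H4 j" "v \<in> L" "v \<in> Vreal j"
    "\<forall>r\<in>set (roots j). Re (hform v r) \<le> 0"
      "Re (hform v v) < 0"
    unfolding Cj_def by blast
  obtain x where x: "v = iota j x" using v(3) Vreal_iota[OF le_4] by blast
  have le: "bf j x r \<le> 0" if "r \<in> set (rts j)" for r
  proof -
    have "iota j r \<in> set (roots j)" using that by (simp add: roots_iota[OF le_4] del: iota.simps)
    then show ?thesis using v(4) by (auto simp: x hform_iota simp del: iota.simps)
  qed
  have neg: "bf j x x < 0" using v(5) by (simp add: x hform_iota del: iota.simps)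
  have "fst x > 0"
  proof (rule ccontr)
    assume "\<not> ?thesis"
    moreover have "fst x \<noteq> 0" using negative_same_sign[OF neg neg] neg by auto
    moreover have "fst (- x) \<le> 0" by (rule opposite_chamber_past[OF le_4]) (use le in \<open>simp add:
      bf.B_simps\<close>)
    ultimately show False by simp
  qed
  then have fx: "future j x" using neg by (simp add: future_def)
  obtain y where y: "L = cline (iota j y)" using v(1) unfolding H4_iota[OF le_4] by blast
  obtain c where c: "iota j x = c *s iota j y" using v(2) cline_memD unfolding y x by blast
  have "c \<noteq> 0" using c fx by (metis iota_0 iota_inj vector_smult_lzero future_def bf.B_zero(1)
    less_irrefl)
  then have "L = cline (iota j x)" unfolding c y by (rule cline_scale[symmetric])
  moreover have "x \<in> chamber" using le in_chamber_iff by blast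
  ultimately show "L \<in> {cline (iota j x) | x. future j x \<and> x \<in> chamber}" using fx by blast
next
  fix L assume "L \<in> {cline (iota j x) | x. future j x \<and> x \<in> chamber}"
  then obtain x where x: "L = cline (iota j x)" "future j x" "x \<in> chamber" by blast
  have "L \<in> H4 j" unfolding H4_iota[OF le_4] using x by blast
  moreover have "iota j x \<in> L" unfolding x(1) by (rule cline_self)
  moreover have "iota j x \<in> Vreal j" using Vreal_iota[OF le_4] by blast
  moreover have "Re (hform (iota j x) (iota j x)) < 0" using x(2) by (simp add: hform_iota future_def del:
    iota.simps)
  moreover have "\<forall>r\<in>set (roots j). Re (hform (iota j x) r) \<le> 0"
    using x(3) by (simp add: roots_iota[OF le_4] in_chamber_iff hform_iota del: iota.simps)
  ultimately show "L \<in> Cj j" unfolding Cj_def by blast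
qed

lemma in_Cj_iff:
  assumes "future j x"
  shows "cline (iota j x) \<in> Cj j \<longleftrightarrow> x \<in> chamber"
proof
  assume "cline (iota j x) \<in> Cj j"
  then obtain y where y: "cline (iota j x) = cline (iota j y)" "future j y"
    "y \<in> chamber" unfolding Cj_eq by blast
  obtain c where "0 < c" "y = c *\<^sub>R x" using cline_iota_eq[OF assms y(2,1)] by blast
  then show "x \<in> chamber" using y(3) chamber_scale by blast
next
  assume "x \<in> chamber"
  then show "cline (iota j x) \<in> Cj j" unfolding Cj_eq using assms by blast
qed

text \<open>If a product with a root vanished, a small push of \<open>x\<close> along that root
  would leave the chamber, because the product grows by \<open>t\<close> times the positive norm of
  the root.\<close>

lemma hint_interior:
  assumes "L \<in> hint j (Cj j)"
  obtains x where "future j x" "L = cline (iota j x)" "\<And>i. i < nr \<Longrightarrow> bf j x (alpha j i) < 0"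
proof -
  obtain v e where v: "L \<in> Cj j" "v \<in> L" "v \<in> Vreal j" "Re (hform v v) < 0" "0 < e"
      and near: "\<And>u. u \<in> Vreal j \<Longrightarrow> norm (u - v) < e \<Longrightarrow> cline u
        \<in> Cj j"
    using assms unfolding hint_def by blast
  obtain y where y: "v = iota j y" using v(3) Vreal_iota[OF le_4] by blast
  have neg: "bf j y y < 0" using v(4) by (simp add: y hform_iota del: iota.simps)
  obtain x where x: "future j x" "x = y \<or> x = - y" "cline (iota j y) = cline (iota j x)"
    using real_line_future[OF neg] by blast
  have Lv: "L = cline (iota j x)"
  proof -
    obtain z where z: "L = cline (iota j z)" using v(1) unfolding Cj_eq by blast
    obtain c where c: "iota j y = c *s iota j z" using v(2) cline_memD unfolding z y by blast
    have "c \<noteq> 0" using c neg by (metis iota_0 iota_inj vector_smult_lzero bf.B_zero(1) less_irrefl)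
    then show ?thesis unfolding x(3)[symmetric] c z by (rule cline_scale[symmetric])
  qed
  \<comment> \<open>The representative given by \<open>hint\<close> may lie in the past cone;
    negation carries its neighbourhood to one of \<open>x\<close>.\<close>
  have near': "cline (iota j z) \<in> Cj j" if "norm (iota j z - iota j x) < e" for z
  proof (cases "x = y")
    case True
    have "iota j z \<in> Vreal j" using Vreal_iota[OF le_4] by blast
    then show ?thesis using near that unfolding y True by blast
  next
    case False
    then have xy: "iota j x = - iota j y" using x(2) iota_minus by metis
    have "iota j (- z) \<in> Vreal j" using Vreal_iota[OF le_4] by blast
    moreover have "norm (iota j (- z) - v) < e"
      using that unfolding iota_minus y xy by (metis add.commute diff_minus_eq_add minus_diff_eq
        norm_minus_cancel uminus_add_conv_diff)
    ultimately have "cline (iota j (- z)) \<in> Cj j" using near by blast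
    moreover have "cline (iota j (- z)) = cline (iota j z)"
      using cline_scale[of "-1" "iota j z"] by (simp add: iota_minus del: iota.simps)
    ultimately show ?thesis by simp
  qed
  have xC: "x \<in> chamber" using v(1) in_Cj_iff[OF x(1)] unfolding Lv by blast
  have "bf j x (alpha j i) < 0" if i: "i < nr" for i
  proof -
    \<comment> \<open>Keeps the displacement below \<open>e\<close>; the added 1 makes the
      denominator positive.\<close>
    define t where "t = e / (2 * (norm (iota j (alpha j i)) + 1))"
    have t: "0 < t" using v(5) by (auto simp: t_def intro!: divide_pos_pos add_nonneg_pos)
    have "norm (iota j (x + t *\<^sub>R alpha j i) - iota j x) = t * norm (iota j (alpha j i))"
    proof -
      have "iota j (x + t *\<^sub>R alpha j i) - iota j x = t *\<^sub>R iota j (alpha j i)"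
        unfolding iota_add iota_scaleR by (simp add: vec_eq_iff scaleR_conv_of_real[where 'a = complex]
          del: iota.simps)
      then show ?thesis using t by simp
    qed
    also have "\<dots> < e"
    proof -
      have "e / (2 * (b + 1)) * b < e" if "0 \<le> b" for b
      proof -
        have "0 < b * e + e * 2" using that v(5) by (intro add_nonneg_pos) auto
        then show ?thesis using that by (simp add: field_simps)
      qed
      from this[OF norm_ge_zero] show ?thesis unfolding t_def .
    qed
    finally have "cline (iota j (x + t *\<^sub>R alpha j i)) \<in> Cj j" by (rule near')
    then obtain z where z: "cline (iota j (x + t *\<^sub>R alpha j i)) = cline (iota j z)" "future j z"
      "z \<in> chamber"
      unfolding Cj_eq by blast
    have "iota j (x + t *\<^sub>R alpha j i) \<in> cline (iota j z)" unfolding z(1)[symmetric] by (rule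
      cline_self)
    then obtain c where c: "iota j (x + t *\<^sub>R alpha j i) = c *s iota j z" using cline_memD by blast
    have "complex_of_real (bf j (x + t *\<^sub>R alpha j i) x) = c * of_real (bf j z x)"
      unfolding hform_iota[symmetric] c hform_scale ..
    moreover have zx: "bf j z x < 0" using future_bf z x by blast
    ultimately have cr: "c = of_real (bf j (x + t *\<^sub>R alpha j i) x / bf j z x)" by (simp add: field_simps)
    define d where "d = bf j (x + t *\<^sub>R alpha j i) x / bf j z x"
    \<comment> \<open>Both vectors have negative product with \<open>x\<close>, so the real factor
      \<open>d\<close> is positive and the chamber inequalities pass from \<open>z\<close> to the
      pushed vector.\<close>
    have xd: "x + t *\<^sub>R alpha j i = d *\<^sub>R z" using c unfolding cr d_def[symmetric]
      iota_scaleR[symmetric] iota_inj .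
    have xa: "bf j x (alpha j i) \<le> 0" using xC i by (simp add: chamber_def)
    have "bf j (x + t *\<^sub>R alpha j i) x = bf j x x + t * bf j x (alpha j i)"
      by (simp add: bf.B_simps bf.B_sym[of j "alpha j i" x])
    also have "\<dots> < 0" using x(1) xa t by (intro add_neg_nonpos) (auto simp: future_def mult_nonneg_nonpos)
    finally have "0 < d" unfolding d_def using zx by (rule divide_neg_neg)
    then have "bf j (x + t *\<^sub>R alpha j i) (alpha j i) \<le> 0"
      unfolding xd using z(3) i by (simp add: bf.B_simps chamber_def mult_nonneg_nonpos)
    then have "bf j x (alpha j i) + t * bf j (alpha j i) (alpha j i) \<le> 0" by (simp add: bf.B_simps)
    moreover have "0 < t * bf j (alpha j i) (alpha j i)" using t alpha_norm[OF le_4 i] by simp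
    ultimately show ?thesis by linarith
  qed
  then show ?thesis using that x(1) Lv by blast
qed

lemma p5_interior: "i < nr \<Longrightarrow> bf j (p5 j) (alpha j i) < 0"
  by (rule p5_alpha[OF le_4]) simp

lemma p5_chamber: "p5 j \<in> chamber"
  using p5_interior by (auto simp: chamber_def intro: less_imp_le)

lemma trivial_of_interior:
  assumes w: "set w \<subseteq> {..<nr}" and v: "\<And>i. i < nr \<Longrightarrow> bf j v (alpha j i) < 0"
    and wv: "rho w v \<in> chamber"
  shows "rho w = id"
  using rho_cong[OF chamber_trivial_word[OF w v wv]] by (simp only: rho_Nil)

lemma pscalar_rep: "u \<in> EisUnits \<Longrightarrow> rep j g u id \<Longrightarrow> pscalar g"
  unfolding pscalar_def using rep_eqI rep_mat by blast

theorem fundamental_domain_chamber: "fundamental_domain j (W j) (Cj j)"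
  unfolding fundamental_domain_def
proof (intro conjI ballI impI)
  show "Cj j \<subseteq> H4 j" unfolding Cj_def by blast
  show "(\<Union>g\<in>W j. act g ` Cj j) = H4 j"
  proof (intro equalityI subsetI)
    fix L assume "L \<in> (\<Union>g\<in>W j. act g ` Cj j)"
    then obtain g M where g: "inW g" "M \<in> Cj j" "L = act g M" unfolding W_eq by blast
    have "M \<in> H4 j" using g(2) unfolding Cj_def by blast
    then show "L \<in> H4 j" using inW_Stab[OF g(1)] g(3) unfolding Stab_def by blast
  next
    fix L assume "L \<in> H4 j"
    then obtain x where x: "L = cline (iota j x)" "future j x" unfolding H4_iota[OF le_4] by blast
    obtain w where w: "set w \<subseteq> {..<nr}" "rho w x \<in> chamber" using exists_in_chamber[OF x(2)]
      by blast
    have rw: "set (rev w) \<subseteq> {..<nr}" using w by simp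
    let ?g = "mprod (map (sm j) (rev w))"
    have r: "rep j ?g 1 (rho (rev w))" by (rule rep_word[OF le_4 rw])
    have "act ?g (cline (iota j (rho w x))) = L"
      unfolding act_rep[OF r one_neq_zero] rho_rev[OF w(1)] x(1) ..
    moreover have "cline (iota j (rho w x)) \<in> Cj j" using in_Cj_iff future_rho w x(2) by blast
    moreover have "?g \<in> W j" unfolding W_eq using inWI[OF EisUnits_1 rw r] by blast
    ultimately show "L \<in> (\<Union>g\<in>W j. act g ` Cj j)" by blast
  qed
  fix g assume "g \<in> W j" and ne: "act g ` hint j (Cj j) \<inter> hint j (Cj j) \<noteq> {}"
  then obtain u w where g: "u \<in> EisUnits" "set w \<subseteq> {..<nr}" "rep j g u (rho w)"
    unfolding W_eq using inWE by blast
  obtain L where L: "L \<in> hint j (Cj j)" "act g L \<in> hint j (Cj j)" using ne by blast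
  obtain x where x: "future j x" "L = cline (iota j x)" "\<And>i. i < nr \<Longrightarrow> bf j x (alpha j
    i) < 0"
    using hint_interior[OF L(1)] by blast
  have "act g L \<in> Cj j" using L(2) unfolding hint_def by blast
  then have "cline (iota j (rho w x)) \<in> Cj j" unfolding x(2) act_rep[OF g(3) EisUnits_nz[OF g(1)]] .
  then have "rho w x \<in> chamber" using in_Cj_iff[OF future_rho[OF g(2) x(1)]] by blast
  then have "rho w = id" using trivial_of_interior[OF g(2) x(3)] by blast
  then show "pscalar g" using pscalar_rep g by simp
qed

section \<open>Diagram automorphisms\<close>

lemma dg_alpha:
  assumes d: "j = 1 \<or> j = 2" and i: "i < nr"
  obtains k where "k < nr" "alpha j k = dg (alpha j i)"
proof -
  have "dg (alpha j i) \<in> set (rts j)" using dg_rts[OF d, of "alpha j i"] i by simp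
  then show ?thesis using that by (metis in_set_conv_nth)
qed

lemma bf_dg_alpha:
  assumes d: "j = 1 \<or> j = 2" and i: "i < nr"
  obtains k where "k < nr" "\<And>x. bf j (dg x) (alpha j i) = bf j x (alpha j k)"
proof -
  obtain k where k: "k < nr" "alpha j k = dg (alpha j i)" using dg_alpha[OF d i] by blast
  have "bf j (dg x) (alpha j i) = bf j x (alpha j k)" for x
    unfolding k(2) using bf_dg[OF d, of x "dg (alpha j i)"] by (simp only: dg_dg)
  then show ?thesis using that k by blast
qed

lemma dg_chamber:
  assumes d: "j = 1 \<or> j = 2" and x: "x \<in> chamber"
  shows "dg x \<in> chamber"
proof -
  have "bf j (dg x) (alpha j i) \<le> 0" if i: "i < nr" for i
  proof -
    obtain k where "k < nr" "bf j (dg x) (alpha j i) = bf j x (alpha j k)" using bf_dg_alpha[OF d i] by metis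
    then show ?thesis using x by (simp add: chamber_def)
  qed
  then show ?thesis by (simp add: chamber_def)
qed

lemma dmat_Dj:
  assumes d: "j = 1 \<or> j = 2"
  shows "dmat \<in> Dj j"
proof -
  note r = rep_dmat[OF d]
  have S: "dmat \<in> Stab j"
    by (rule Stab_I[OF le_4 dmat_Gam r one_neq_zero future_dg[OF d] future_dg[OF d] dg_dg])
  have "act dmat ` Cj j \<subseteq> Cj j"
  proof
    fix L assume "L \<in> act dmat ` Cj j"
    then obtain x where x: "L = act dmat (cline (iota j x))" "future j x"
      "x \<in> chamber" unfolding Cj_eq by blast
    show "L \<in> Cj j" unfolding x(1) act_rep[OF r one_neq_zero] Cj_eq
      using future_dg[OF d x(2)] dg_chamber[OF d x(3)] by blast
  qed
  moreover have "Cj j \<subseteq> act dmat ` Cj j"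
  proof
    fix L assume "L \<in> Cj j"
    then obtain x where x: "L = cline (iota j x)" "future j x" "x \<in> chamber" unfolding Cj_eq by blast
    have "L = act dmat (cline (iota j (dg x)))" unfolding x(1) act_rep[OF r one_neq_zero] dg_dg ..
    moreover have "cline (iota j (dg x)) \<in> Cj j" unfolding Cj_eq using future_dg[OF d x(2)]
      dg_chamber[OF d x(3)] by blast
    ultimately show "L \<in> act dmat ` Cj j" by blast
  qed
  ultimately show ?thesis using S by (simp add: Dj_def)
qed

text \<open>Used with \<open>f = id\<close> and \<open>f = dg\<close>. Both send \<open>p5 j\<close>
  to an interior point of the chamber, and the remaining word must then return an interior point to
  the chamber.\<close>

lemma Dj_trivial:
  assumes g: "g \<in> Dj j" and r: "rep j g u (rho w \<circ> f)" and u: "u \<in> EisUnits" and w: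
    "set w \<subseteq> {..<nr}"
    and f: "future j (f (p5 j))" "\<And>i. i < nr \<Longrightarrow> bf j (f (p5 j)) (alpha j i) < 0"
  shows "rho w = id"
proof -
  have "cline (iota j (p5 j)) \<in> Cj j" using in_Cj_iff[OF p5_future[OF le_4]] p5_chamber by blast
  then have "act g (cline (iota j (p5 j))) \<in> Cj j" using g unfolding Dj_def by blast
  then have "cline (iota j (rho w (f (p5 j)))) \<in> Cj j"
    unfolding act_rep[OF r EisUnits_nz[OF u]] by (simp only: o_apply)
  then have "rho w (f (p5 j)) \<in> chamber" using in_Cj_iff[OF future_rho[OF w f(1)]] by blast
  then show ?thesis using trivial_of_interior[OF w f(2)] by blast
qed

lemma dg_p5_interior:
  assumes d: "j = 1 \<or> j = 2" and i: "i < nr"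
  shows "bf j (dg (p5 j)) (alpha j i) < 0"
  using bf_dg_alpha[OF d i] p5_interior by metis

lemma dmat_not_pscalar:
  assumes d: "j = 1 \<or> j = 2"
  shows "\<not> pscalar dmat"
proof
  assume "pscalar dmat"
  then obtain u where u: "u \<in> EisUnits" "dmat = mat u" unfolding pscalar_def by blast
  have "rep j dmat u id" unfolding u(2) by (rule rep_mat)
  then have "dg = id"
    using rep_unique[OF rep_dmat[OF d] _ EisUnits_1 u(1), of id
      "p5 j"] future_dg[OF d p5_future[OF le_4]] p5_future[OF le_4] by simp
  then have "dg (1, 0, 0, 0, 0) = (1, 0, 0, 0, 0)" by (simp only: id_apply)
  then show False by simp
qed

lemma Dj_cases:
  assumes "g \<in> Dj j"
  shows "pscalar g \<or> (j = 1 \<or> j = 2) \<and> pequiv g dmat"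
proof -
  have "g \<in> Stab j" using assms by (simp add: Dj_def)
  then show ?thesis
  proof (cases rule: Stab_cases)
    case (1 u w)
    have "rho w = id"
      by (rule Dj_trivial[OF assms, of u w id]) (use 1 p5_future[OF le_4] p5_interior in
        \<open>simp_all\<close>)
    then show ?thesis using 1 pscalar_rep by simp
  next
    case (2 u w)
    have "rho w = id"
      by (rule Dj_trivial[OF assms 2(4) 2(1) 2(2)])
        (use future_dg[OF 2(3) p5_future[OF le_4]] dg_p5_interior[OF 2(3)] in simp_all)
    then have "rep j g u dg" using 2(4) by simp
    moreover have "rep j (mat u ** dmat) u dg" using rep_mult[OF rep_mat[of j u] rep_dmat[OF 2(3)]] by simp
    ultimately have "g = mat u ** dmat" by (rule rep_eqI)
    then show ?thesis using 2 unfolding pequiv_def by blast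
  qed
qed

lemma mat_1_Dj: "mat 1 \<in> Dj j"
proof -
  have "act (mat 1) L = L" for L by (simp add: act_def)
  then show ?thesis using inW_Stab[OF inW_scalar[OF EisUnits_1]] by (simp add: Dj_def)
qed

lemma W_normal:
  assumes g: "g \<in> Stab j" and w: "h \<in> W j"
  shows "g ** h ** matrix_inv g \<in> W j"
proof -
  have "g \<in> Gam" using g by (simp add: Stab_def)
  then obtain g' where g': "g ** g' = mat 1" "g' ** g = mat 1" by (rule Gam_inverse)
  have inv: "matrix_inv g = g'" by (rule matrix_inv_eqI[OF g'(1)])
  have canc: "k ** g' = h'" if "k = h' ** g" for k h'
    unfolding that by (simp add: g'(1) flip: matrix_mul_assoc)
  obtain v z where h: "v \<in> EisUnits" "set z \<subseteq> {..<nr}"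
    "rep j h v (rho z)" using w inWE unfolding W_eq by blast
  \<comment> \<open>Covers both cases of \<open>Stab_cases\<close>, with \<open>f\<close> being
    \<open>id\<close> or \<open>dg\<close>: passing \<open>f\<close> turns \<open>rho z\<close> into
    \<open>rho y\<close>, and conjugation by \<open>rho a\<close> remains.\<close>
  have mk: ?thesis if y: "set y \<subseteq> {..<nr}" and a: "rep j g u (rho a \<circ> f)"
    "set a \<subseteq> {..<nr}"
      and f: "\<And>x. f (rho z x) = rho y (f x)" for y u a f
  proof -
    let ?h = "mat v ** mprod (map (sm j) (a @ y @ rev a))"
    have s: "set (a @ y @ rev a) \<subseteq> {..<nr}" using y a by simp
    have r: "rep j ?h v (rho (a @ y @ rev a))" by (rule rep_scaled_word[OF s])
    have "rho (a @ y @ rev a) \<circ> (rho a \<circ> f) = (rho a \<circ> f) \<circ> rho z"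
      by (rule ext) (simp only: o_apply refl_word_append rho_rev[OF a(2)] f)
    then have "rep j (?h ** g) (u * v) ((rho a \<circ> f) \<circ> rho z)"
      using rep_mult[OF r a(1)] by (simp only: mult.commute)
    then have "?h ** g = g ** h" using rep_mult[OF a(1) h(3)] rep_eqI by blast
    then have "g ** h ** g' = ?h" by (intro canc) simp
    then show ?thesis unfolding inv W_eq using inWI[OF h(1) s r] by simp
  qed
  show ?thesis using g
  proof (cases rule: Stab_cases)
    case (1 u a)
    then show ?thesis using mk[OF h(2), of u a id] by simp
  next
    case (2 u a)
    obtain y where "set y \<subseteq> {..<nr}" "\<And>x. dg (rho z x) = rho y (dg x)"
      using dg_rho_commute[OF 2(3) h(2)] by blast
    then show ?thesis using mk 2 by blast
  qed
qed

text \<open>A word acting trivially leaves the interior point \<open>p5 j\<close> in the chamber, so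
  the relations reduce it to the empty word. The same point detects that the generators are
  nontrivial and distinct.\<close>

lemma coxeter_system_roots: "coxeter_system nr (sm j)"
proof -
  have word: "pscalar (mprod (map (sm j) w)) \<longleftrightarrow> rho w = id" if
    "set w \<subseteq> {..<nr}" for w
    by (rule pscalar_word[OF le_4 that])
  have ri: "reflect (bf j) (alpha j i) (alpha j i) = - alpha j i" if "i < nr" for i
    using alpha_norm[OF le_4 that] by (simp add: reflect_def scaleR_2)
  have one: "rho [i] \<noteq> id" if i: "i < nr" for i
  proof
    assume "rho [i] = id"
    then have "- alpha j i = alpha j i" using ri[OF i] by (metis id_apply refl_word_Cons refl_word_Nil)
    then have "bf j (p5 j) (- alpha j i) = bf j (p5 j) (alpha j i)" by (simp only:)
    then show False using p5_interior[OF i] by (simp add: bf.B_simps)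
  qed
  \<comment> \<open>Equality would force the reflection in root \<open>k\<close> to send the
    negative of root \<open>i\<close> to root \<open>i\<close>. By obtuseness the former keeps a
    positive product with \<open>p5 j\<close>, while the latter has a negative one.\<close>
  have two: "rho [k, i] \<noteq> id" if i: "i < nr" and k: "k < nr" and ik: "i \<noteq> k" for i k
  proof
    assume "rho [k, i] = id"
    then have "reflect (bf j) (alpha j k) (- alpha j i) = alpha j i"
      using ri[OF i] by (metis id_apply refl_word_Cons refl_word_Nil)
    then have "bf j (p5 j) (reflect (bf j) (alpha j k) (- alpha j i)) = bf j (p5 j) (alpha j i)" by (simp only:)
    moreover have "bf j (p5 j) (reflect (bf j) (alpha j k) (- alpha j i)) =
        - bf j (p5 j) (alpha j i) + 2 * bf j (alpha j i) (alpha j k) / bf j (alpha j k) (alpha j k) * bf j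
          (p5 j) (alpha j k)"
      by (simp add: reflect_def bf.B_simps)
    moreover have "0 \<le> 2 * bf j (alpha j i) (alpha j k) / bf j (alpha j k) (alpha j k) * bf j (p5 j)
      (alpha j k)"
      using alpha_pair(1)[OF le_4 i k ik] p5_interior[OF k] alpha_norm[OF le_4 k]
      by (intro mult_nonpos_nonpos divide_nonpos_pos) auto
    ultimately show False using p5_interior[OF i] by linarith
  qed
  show ?thesis
    unfolding coxeter_system_def
  proof (intro conjI allI impI)
    fix i assume i: "i < nr"
    show "\<not> pscalar (sm j i)" using word[of "[i]"] one[OF i] i by simp
    have "rho [i, i] = id"
      by (rule ext) (use alpha_norm[OF le_4 i] in \<open>simp only: refl_word_Cons refl_word_Nil id_apply
        bf.refl_refl\<close>)
    then show "pscalar (sm j i ** sm j i)" using word[of "[i, i]"] i by simp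
    fix k assume k: "k < nr" and ik: "i \<noteq> k"
    then show "\<not> pscalar (sm j i ** sm j k)" using word[of "[i, k]"] two[OF k i] i by auto
  next
    fix w assume w: "set w \<subseteq> {..<nr}" "pscalar (mprod (map (sm j) w))"
    then have "rho w = id" using word by blast
    then have "rho w (p5 j) \<in> chamber" using p5_chamber by (simp only: id_apply)
    then show "cox_eq (cox_rels nr (sm j)) w []" using chamber_trivial_word[OF w(1) p5_interior] by blast
  qed
qed

end

text \<open>All groups are represented by their preimages in \<open>Gam\<close>, which contain the
  unit scalars. The semidirect product is therefore expressed by normality, by factorization of each
  element of the stabilizer, and by an intersection consisting of scalars.\<close>

theorem theorem5p3:
  fixes j :: nat
  assumes "j \<le> 4"
  shows "W j = Wgen (reflm ` set (roots j))
    \<and> coxeter_system (length (roots j)) (\<lambda>i. reflm (roots j ! i))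
    \<and> fundamental_domain j (W j) (Cj j)
    \<and> (\<forall>g\<in>Stab j. \<forall>w\<in>W j. g ** w ** matrix_inv g \<in> W j)
    \<and> (\<forall>g\<in>Stab j. \<exists>w\<in>W j. \<exists>d\<in>Dj j. g = w ** d)
    \<and> (\<forall>g\<in>W j \<inter> Dj j. pscalar g)
    \<and> (if j = 1 \<or> j = 2
       then (\<exists>d\<in>Dj j. \<not> pscalar d \<and> (\<forall>d'\<in>Dj j. pscalar d' \<or> pequiv d' d))
       else (\<forall>d\<in>Dj j. pscalar d))"
proof -
  interpret root_system j by unfold_locales fact
  have "coxeter_system (length (roots j)) (\<lambda>i. reflm (roots j ! i))"
    unfolding length_roots[OF le_4] by (rule coxeter_system_roots)
  moreover have "\<exists>w\<in>W j. \<exists>d\<in>Dj j. g = w ** d" if "g \<in> Stab j" for g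
    using that
  proof (cases rule: Stab_cases)
    case (1 u w)
    then have "g \<in> W j" unfolding W_eq using inWI by blast
    moreover have "g = g ** mat 1" by simp
    ultimately show ?thesis using mat_1_Dj by blast
  next
    case (2 u w)
    let ?w = "mat u ** mprod (map (sm j) w)"
    have r: "rep j ?w u (rho w)" by (rule rep_scaled_word[OF 2(2)])
    have "rep j (?w ** dmat) u (rho w \<circ> dg)" using rep_mult[OF r rep_dmat[OF 2(3)]] by (simp only:
      mult_1_right)
    then have "g = ?w ** dmat" using 2(4) rep_eqI by blast
    moreover have "?w \<in> W j" unfolding W_eq using inWI[OF 2(1,2) r] by blast
    ultimately show ?thesis using dmat_Dj[OF 2(3)] by blast
  qed
  moreover have "pscalar g" if gm: "g \<in> W j \<inter> Dj j" for g
  proof -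
    obtain u w where g: "u \<in> EisUnits" "set w \<subseteq> {..<nr}" "rep j g u (rho w)"
      using gm inWE unfolding W_eq by blast
    then have "rho w = id"
      using Dj_trivial[of g u w id] gm p5_future[OF le_4] p5_interior by simp
    then show ?thesis using pscalar_rep g by simp
  qed
  moreover have "if j = 1 \<or> j = 2
       then (\<exists>d\<in>Dj j. \<not> pscalar d \<and> (\<forall>d'\<in>Dj j. pscalar d' \<or> pequiv d' d))
       else (\<forall>d\<in>Dj j. pscalar d)"
    using dmat_Dj dmat_not_pscalar Dj_cases by (metis (full_types))
  ultimately show ?thesis
    using W_eq Wgen_roots_eq fundamental_domain_chamber W_normal by simp
qed

end
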